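(* For $m\in\{2,3,4,5\}$ (that is, $p=2m\in\{4,6,8,10\}$) and every $-1<\alpha<2m-2$, one has \[ \|\mathcal H\|_{A^{2m}_\alpha\to A^{2m}_\alpha}=\mathrm B\!\left(\frac{\alpha+2}{2m},1-\frac{\alpha+2}{2m}\right)=\frac{\pi}{\sin((\alpha+2)\pi/(2m))}. \]
   Context: Let $\mathbb D$ be the open unit disk and $dA(z)=\pi^{-1}\,dx\,dy$ normalized area measure. For $\alpha>-1$ put $dA_\alpha(z)=(\alpha+1)(1-|z|^2)^\alpha\,dA(z)$. The weighted Bergman space $A^p_\alpha$ consists of analytic functions $f$ on $\mathbb D$ with $\|f\|_{A^p_\alpha}^p=\int_{\mathbb D}|f|^p\,dA_\alpha<\infty$. The Hilbert matrix operator is, for $f(z)=\sum_{k\ge0}a_kz^k$, \[ \mathcal Hf(z)=\sum_{n=0}^\infty\Big(\sum_{k=0}^\infty\frac{a_k}{n+k+1}\Big)z^n=\int_0^1\frac{f(t)}{1-tz}\,dt, \] (initially for polynomials, which are dense in $A^p_\alpha$), and $\|\mathcal H\|_{A^p_\alpha\to A^p_\alpha}$ denotes its operator norm. $\mathrm B(x,y)=\int_0^1t^{x-1}(1-t)^{y-1}\,dt$ is the beta function. *)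

theory Defs
  imports "HOL-Complex_Analysis.Complex_Analysis"
begin

text \<open>
  The measure \<open>dA\<^sub>\<alpha>\<close> on the open unit disk; the factor \<open>1 / pi\<close> is the normalization of area.
\<close>
definition disk_measure :: "real \<Rightarrow> complex measure" where
  "disk_measure \<alpha> =
     density (restrict_space lborel (ball 0 1))
       (\<lambda>z. ennreal ((\<alpha> + 1) * (1 - (cmod z)\<^sup>2) powr \<alpha> / pi))"

text \<open>
  Elements of the Bergman space are represented by total functions; their values outside
  the disk are arbitrary and play no role in any of the definitions below.
\<close>
definition bergman_space :: "real \<Rightarrow> real \<Rightarrow> (complex \<Rightarrow> complex) set" where
  "bergman_space p \<alpha> =
     {f. f holomorphic_on ball 0 1 \<and> integrable (disk_measure \<alpha>) (\<lambda>z. cmod (f z) powr p)}"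

definition bergman_norm :: "real \<Rightarrow> real \<Rightarrow> (complex \<Rightarrow> complex) \<Rightarrow> real" where
  "bergman_norm p \<alpha> f = (LINT z|disk_measure \<alpha>. cmod (f z) powr p) powr (1 / p)"

text \<open>
  The operator norm on \<open>A\<^sup>p\<^sub>\<alpha>\<close>, as the least admissible constant. It is \<open>\<infinity>\<close> if the operator
  does not map \<open>A\<^sup>p\<^sub>\<alpha>\<close> to itself or is unbounded, so an equation with a finite right-hand
  side includes boundedness.
\<close>
definition bergman_opnorm ::
  "real \<Rightarrow> real \<Rightarrow> ((complex \<Rightarrow> complex) \<Rightarrow> complex \<Rightarrow> complex) \<Rightarrow> ereal" where
  "bergman_opnorm p \<alpha> T =
     (INF C \<in> {C. 0 \<le> C \<and> (\<forall>f \<in> bergman_space p \<alpha>. T f \<in> bergman_space p \<alpha> \<and>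
                              bergman_norm p \<alpha> (T f) \<le> C * bergman_norm p \<alpha> f)}. ereal C)"

text \<open>
  The Hilbert matrix operator in its integral form. For \<open>\<alpha> < p - 2\<close> the integral converges
  absolutely for every \<open>f\<close> in \<open>A\<^sup>p\<^sub>\<alpha>\<close>, because \<open>cmod (f t) = O((1 - t) powr (- (\<alpha> + 2) / p))\<close>.
  On polynomials it is the action of the Hilbert matrix on Taylor coefficients, as proved in
  \<open>hilbert_op_poly\<close> below.
\<close>
definition hilbert_op :: "(complex \<Rightarrow> complex) \<Rightarrow> complex \<Rightarrow> complex" where
  "hilbert_op f z = (LINT t:{0..<1}|lborel. f (complex_of_real t) / (1 - complex_of_real t * z))"

lemma set_integrable_unit_interval:
  fixes g :: "real \<Rightarrow> 'a :: {banach, second_countable_topology}"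
  assumes "continuous_on {0..1} g"
  shows "set_integrable lborel {0..<1} g"
  by (rule set_integrable_subset[OF borel_integrable_atLeastAtMost'[OF assms]]) auto

lemma LINT_unit_interval_power:
  "(LINT t:{0..<1}|lborel. complex_of_real t ^ n) = 1 / of_nat (n + 1)"
proof -
  have "(LINT t:{0..<1}|lborel. complex_of_real t ^ n) = (LINT t:{0..1}|lborel. complex_of_real (t ^ n))"
    unfolding set_lebesgue_integral_def
    by (intro integral_cong_AE AE_I[where N = "{1::real}"])
       (auto simp: indicator_def split: if_splits)
  also have "\<dots> = complex_of_real (LINT t:{0..1}|lborel. t ^ n)"
    by (rule set_integral_complex_of_real)
  also have "(LINT t:{0..1::real}|lborel. t ^ n) = 1 / real (n + 1)"
    using integral_power[of 0 1 n] by (simp add: set_lebesgue_integral_def mult.commute)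
  finally show ?thesis by simp
qed

lemma hilbert_op_poly:
  assumes z: "cmod z < 1"
  shows "(\<lambda>n. (\<Sum>k\<le>degree q. coeff q k / of_nat (n + k + 1)) * z ^ n) sums hilbert_op (poly q) z"
proof -
  define F where "F n t = indicator {0..<1::real} t *\<^sub>R
    (poly q (complex_of_real t) * (complex_of_real t * z) ^ n)" for n t
  have F_int: "integrable lborel (F n)" for n
    unfolding F_def
    by (rule set_integrable_unit_interval[unfolded set_integrable_def]) (intro continuous_intros)
  have "bounded ((\<lambda>t. poly q (complex_of_real t)) ` {0..1})"
    by (intro compact_imp_bounded compact_continuous_image continuous_intros) auto
  then obtain B where B: "\<And>t. t \<in> {0..1} \<Longrightarrow> cmod (poly q (complex_of_real t)) \<le> B"
    unfolding bounded_iff by blast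
  have F_bound: "norm (F n t) \<le> indicator {0..1} t *\<^sub>R (B * cmod z ^ n)" for n t
  proof (cases "t \<in> {0..<1}")
    case True
    have "cmod (poly q (complex_of_real t)) * (t * cmod z) ^ n \<le> B * cmod z ^ n"
    proof (rule mult_mono)
      show "(t * cmod z) ^ n \<le> cmod z ^ n"
        using True by (intro power_mono mult_left_le_one_le) auto
      show "0 \<le> B"
        using norm_ge_zero B[of 0] by (rule order_trans) auto
    qed (use True B[of t] in auto)
    with True show ?thesis
      by (simp add: F_def norm_mult norm_power)
  next
    case False
    have "0 \<le> B"
      using norm_ge_zero B[of 0] by (rule order_trans) auto
    with False show ?thesis by (simp add: F_def)
  qed
  have "(\<lambda>n. LINT t|lborel. F n t) sums (LINT t|lborel. (\<Sum>n. F n t))"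
  proof (rule sums_integral[OF F_int])
    have "summable (\<lambda>n. norm (F n t))" for t
    proof (rule summable_comparison_test')
      show "summable (\<lambda>n. indicator {0..1} t *\<^sub>R (B * cmod z ^ n))"
        using z by (intro summable_scaleR_right summable_mult summable_geometric) auto
      show "norm (norm (F n t)) \<le> indicator {0..1} t *\<^sub>R (B * cmod z ^ n)" if "0 \<le> n" for n
        using F_bound[of n t] by simp
    qed
    then show "AE t in lborel. summable (\<lambda>n. norm (F n t))" by simp
    have le: "(LINT t|lborel. norm (F n t)) \<le> B * cmod z ^ n" for n
    proof -
      have "(LINT t|lborel. norm (F n t)) \<le> (LINT t|lborel. indicator {0..1::real} t *\<^sub>R (B * cmod z ^ n))"
      proof (rule integral_mono)
        show "integrable lborel (\<lambda>t. indicator {0..1::real} t *\<^sub>R (B * cmod z ^ n))"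
          by (rule borel_integrable_atLeastAtMost'[unfolded set_integrable_def]) (intro continuous_intros)
      qed (use F_int F_bound in auto)
      then show ?thesis by simp
    qed
    show "summable (\<lambda>n. LINT t|lborel. norm (F n t))"
    proof (rule summable_comparison_test')
      show "summable (\<lambda>n. B * cmod z ^ n)"
        using z by (intro summable_mult summable_geometric) auto
      show "norm (LINT t|lborel. norm (F n t)) \<le> B * cmod z ^ n" if "0 \<le> n" for n
        using le[of n] by simp
    qed
  qed
  also have "(LINT t|lborel. (\<Sum>n. F n t)) = hilbert_op (poly q) z"
    unfolding hilbert_op_def set_lebesgue_integral_def
  proof (intro Bochner_Integration.integral_cong refl)
    fix t :: real
    show "(\<Sum>n. F n t) = indicator {0..<1} t *\<^sub>R (poly q (complex_of_real t) / (1 - complex_of_real t * z))"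
    proof (cases "t \<in> {0..<1}")
      case True
      have "cmod (complex_of_real t * z) < 1"
        using True z mult_left_le_one_le[of "cmod z" t] by (simp add: norm_mult)
      then show ?thesis
        using True by (simp add: F_def suminf_mult suminf_geometric summable_geometric)
    qed (simp add: F_def)
  qed
  finally have "(\<lambda>n. LINT t|lborel. F n t) sums hilbert_op (poly q) z" .
  moreover have "(LINT t|lborel. F n t) = (\<Sum>k\<le>degree q. coeff q k / of_nat (n + k + 1)) * z ^ n" for n
  proof -
    have "(LINT t|lborel. F n t) =
        (LINT t|lborel. (\<Sum>k\<le>degree q. coeff q k * z ^ n *
           (indicator {0..<1} t *\<^sub>R complex_of_real t ^ (n + k))))"
    proof (intro Bochner_Integration.integral_cong refl)
      fix t :: real
      show "F n t = (\<Sum>k\<le>degree q. coeff q k * z ^ n *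
           (indicator {0..<1} t *\<^sub>R complex_of_real t ^ (n + k)))"
      proof (cases "t \<in> {0..<1}")
        case True
        then show ?thesis
          by (simp add: F_def poly_altdef sum_distrib_left power_mult_distrib power_add ac_simps)
      qed (simp add: F_def)
    qed
    also have "\<dots> = (\<Sum>k\<le>degree q. LINT t|lborel. coeff q k * z ^ n *
           (indicator {0..<1} t *\<^sub>R complex_of_real t ^ (n + k)))"
    proof (rule Bochner_Integration.integral_sum)
      fix k
      have "integrable lborel (\<lambda>t. indicator {0..<1::real} t *\<^sub>R complex_of_real t ^ (n + k))"
        by (rule set_integrable_unit_interval[unfolded set_integrable_def]) (intro continuous_intros)
      then show "integrable lborel (\<lambda>t. coeff q k * z ^ n *
           (indicator {0..<1} t *\<^sub>R complex_of_real t ^ (n + k)))"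
        by (rule integrable_mult_right)
    qed
    also have "\<dots> = (\<Sum>k\<le>degree q. coeff q k / of_nat (n + k + 1) * z ^ n)"
    proof (intro sum.cong refl)
      fix k
      have "(LINT t|lborel. coeff q k * z ^ n * (indicator {0..<1} t *\<^sub>R complex_of_real t ^ (n + k))) =
          coeff q k * z ^ n * (LINT t|lborel. indicator {0..<1} t *\<^sub>R complex_of_real t ^ (n + k))"
        by (rule integral_mult_right_zero)
      also have "(LINT t|lborel. indicator {0..<1} t *\<^sub>R complex_of_real t ^ (n + k)) = 1 / of_nat (n + k + 1)"
        by (rule LINT_unit_interval_power[unfolded set_lebesgue_integral_def])
      finally show "(LINT t|lborel. coeff q k * z ^ n * (indicator {0..<1} t *\<^sub>R complex_of_real t ^ (n + k))) =
          coeff q k / of_nat (n + k + 1) * z ^ n"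
        by (simp only: times_divide_eq_left times_divide_eq_right mult_1_right)
    qed
    also have "\<dots> = (\<Sum>k\<le>degree q. coeff q k / of_nat (n + k + 1)) * z ^ n"
      by (rule sum_distrib_right[symmetric])
    finally show ?thesis .
  qed
  ultimately show ?thesis by simp
qed

end

theory Submission
  imports Defs
begin

text \<open>For fixed t, passing to \<open>f ^ m\<close> turns \<open>comp_op\<close> into g |-> (1
  - (1-t) z)^(-m) g(t / (1 - (1-t) z)). With any kappa > 0 in place of m, this operator has a
  nonnegative Taylor matrix, and (1 - z)^(-kappa) is an eigenfunction with eigenvalue
  (1-t)^(-kappa). The coefficients of the eigenfunction are the Cauchy-Schwarz weights, so the
  estimate is a Schur test.

  The choice kappa = s matches the Bergman norm and gives exactly the powers of t and 1-t that the
  average absorbs. It requires trading |1 - (1-t) z|^(s-m) for t^(s-m), which works only for s <= m.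
  For s > m the proof keeps kappa = m; the entries then depend on n and are controlled only after
  integration in t. Euler's integral represents each entry, and a Moebius substitution leaves t in a
  product of powers on the region t < r, so that exchanging the integrals exposes the moments.

  The zeroth moment is a 3F2 series at 1. Two termwise majorants bring it under Gauss's summation
  theorem; the polynomial inequalities that remain are checked separately for m = 2, 3, 4,
  5.\<close>

text \<open>
  Deforming the path of integration writes \<open>hilbert_op f z\<close> as the integral over \<open>t\<close> of
  \<open>comp_op f z t = f (t / (1 - (1 - t) z)) / (1 - (1 - t) z)\<close>. Put \<open>s = \<alpha> + 2\<close> and
  \<open>a = s / (2 m)\<close>. Jensen's inequality for the density proportional to
  \<open>t powr (a - 1) * (1 - t) powr (- a)\<close> reduces the upper bound to an average over \<open>t\<close> of the
  \<open>2 m\<close>-th powers of the norms of \<open>comp_op f _ t\<close>. As the exponent is even, these are squared norms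
  of weighted composition operators applied to \<open>f ^ m\<close>, and Parseval's formula together with a
  weighted Cauchy-Schwarz inequality bounds them by diagonal forms in the Taylor coefficients of
  \<open>f ^ m\<close>. For \<open>s \<le> m\<close> each norm is small enough by itself. For \<open>s > m\<close> the average over \<open>t\<close> turns
  the \<open>n\<close>-th diagonal entry into the \<open>n\<close>-th moment of a function of one variable that crosses the
  required level only once, downwards, so that only the moment \<open>n = 0\<close> has to be estimated; this
  is an inequality between Gamma values, which holds for \<open>m \<le> 5\<close>.

  For the lower bound, \<open>hilbert_op\<close> multiplies the test function \<open>(1 - z) powr (- \<delta>)\<close> by a symbol
  that tends to \<open>Beta a (1 - a)\<close> as \<open>\<delta> \<rightarrow> a\<close> and \<open>z \<rightarrow> 1\<close>, while the norms of the test functions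
  tend to infinity and their mass concentrates at \<open>1\<close>.
\<close>

section \<open>Area measure on the disk\<close>

text \<open>Lebesgue measure is determined by its values on boxes. The identification with a product
  measure makes coordinatewise integration over the complex plane available.\<close>

lemma distr_lborel_pair_complex:
  "distr (lborel \<Otimes>\<^sub>M lborel) borel (\<lambda>(x, y). Complex x y) = (lborel :: complex measure)"
proof (rule lborel_eqI[symmetric])
  have [measurable]: "(\<lambda>(x, y). Complex x y) \<in> borel_measurable (borel \<Otimes>\<^sub>M borel)"
    unfolding borel_prod
    by (intro borel_measurable_continuous_onI) (auto simp: case_prod_beta Complex_eq
       intro!: continuous_intros)
  fix l u :: complex
  assume lu: "\<And>b. b \<in> Basis \<Longrightarrow> l \<bullet> b \<le> u \<bullet> b"
  have "emeasure (distr (lborel \<Otimes>\<^sub>M lborel) borel (\<lambda>(x, y). Complex x y)) (box l u) =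
     emeasure (lborel \<Otimes>\<^sub>M lborel) (((\<lambda>(x, y). Complex x y) -` box l u))"
    by (subst emeasure_distr) (auto simp: space_pair_measure)
  also have "((\<lambda>(x, y). Complex x y) -` box l u) = box (Re l) (Re u) \<times> box (Im l) (Im u)"
    by (auto simp: box_def Basis_complex_def)
  also have "emeasure (lborel \<Otimes>\<^sub>M lborel) \<dots> = ennreal (Re u - Re l) * ennreal (Im u - Im l)"
    using lu[of 1] lu[of \<i>] by (subst lborel.emeasure_pair_measure_Times) (auto simp: Basis_complex_def)
  also have "\<dots> = (\<Prod>b\<in>Basis. (u - l) \<bullet> b)"
    using lu[of 1] lu[of \<i>] by (simp add: Basis_complex_def ennreal_mult)
  finally show "emeasure (distr (lborel \<Otimes>\<^sub>M lborel) borel (\<lambda>(x, y). Complex x y)) (box l u) =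
      (\<Prod>b\<in>Basis. (u - l) \<bullet> b)" .
qed simp

lemma nn_integral_lborel_complex:
  fixes F :: "complex \<Rightarrow> ennreal"
  assumes [measurable]: "F \<in> borel_measurable borel"
  shows "(\<integral>\<^sup>+z. F z \<partial>lborel) = (\<integral>\<^sup>+x. \<integral>\<^sup>+y. F (Complex x y) \<partial>lborel \<partial>lborel)"
    and "(\<integral>\<^sup>+z. F z \<partial>lborel) = (\<integral>\<^sup>+y. \<integral>\<^sup>+x. F (Complex x y) \<partial>lborel \<partial>lborel)"
proof -
  have [measurable]: "(\<lambda>(x, y). Complex x y) \<in> borel_measurable (borel \<Otimes>\<^sub>M borel)"
    unfolding borel_prod
    by (intro borel_measurable_continuous_onI) (auto simp: case_prod_beta Complex_eq
       intro!: continuous_intros)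
  have *: "(\<integral>\<^sup>+z. F z \<partial>lborel) = (\<integral>\<^sup>+p. F (Complex (fst p) (snd p)) \<partial>(lborel \<Otimes>\<^sub>M lborel))"
    by (subst distr_lborel_pair_complex[symmetric], subst nn_integral_distr) (auto simp: case_prod_beta)
  have m: "(\<lambda>p. F (Complex (fst p) (snd p))) \<in> borel_measurable (lborel \<Otimes>\<^sub>M lborel)"
    using measurable_compose[OF \<open>(\<lambda>(x, y). Complex x y) \<in> _\<close> assms]
    by (simp add: case_prod_beta)
  show "(\<integral>\<^sup>+z. F z \<partial>lborel) = (\<integral>\<^sup>+x. \<integral>\<^sup>+y. F (Complex x y) \<partial>lborel \<partial>lborel)"
    unfolding * using lborel.nn_integral_fst[OF m] by simp
  show "(\<integral>\<^sup>+z. F z \<partial>lborel) = (\<integral>\<^sup>+y. \<integral>\<^sup>+x. F (Complex x y) \<partial>lborel \<partial>lborel)"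
    unfolding * using lborel_pair.nn_integral_snd[OF m] by simp
qed

text \<open>For a fixed imaginary part the shear is a translation of the real line, so invariance
  holds already for the inner integral.\<close>

lemma nn_integral_complex_shear_Re:
  fixes F :: "complex \<Rightarrow> ennreal"
  assumes [measurable]: "F \<in> borel_measurable borel"
  shows "(\<integral>\<^sup>+z. F (z + of_real (a * Im z)) \<partial>lborel) = (\<integral>\<^sup>+z. F z \<partial>lborel)"
proof -
  have m: "(\<lambda>z. z + complex_of_real (a * Im z)) \<in> borel_measurable borel"
    by (intro borel_measurable_continuous_onI continuous_intros)
  have c: "(\<lambda>x. Complex x y) \<in> borel_measurable borel" for y
    by (intro borel_measurable_continuous_onI) (auto simp: Complex_eq intro!: continuous_intros)
  have "(\<integral>\<^sup>+z. F (z + of_real (a * Im z)) \<partial>lborel) =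
      (\<integral>\<^sup>+y. \<integral>\<^sup>+x. F (Complex x y + of_real (a * y)) \<partial>lborel \<partial>lborel)"
    using measurable_compose[OF m assms] by (subst nn_integral_lborel_complex(2)) auto
  also have "\<dots> = (\<integral>\<^sup>+y. \<integral>\<^sup>+x. F (Complex x y) \<partial>lborel \<partial>lborel)"
  proof (rule nn_integral_cong)
    fix y :: real
    have "(\<integral>\<^sup>+x. F (Complex x y) \<partial>lborel) = (\<integral>\<^sup>+x. F (Complex (a * y + 1 * x) y) \<partial>lborel)"
      using nn_integral_real_affine[OF measurable_compose[OF c assms], of 1 y "a * y"] by simp
    then show "(\<integral>\<^sup>+x. F (Complex x y + of_real (a * y)) \<partial>lborel) = (\<integral>\<^sup>+x. F (Complex x y) \<partial>lborel)"
      by (simp add: Complex_eq algebra_simps)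
  qed
  finally show ?thesis by (simp add: nn_integral_lborel_complex(2))
qed

lemma nn_integral_complex_shear_Im:
  fixes F :: "complex \<Rightarrow> ennreal"
  assumes [measurable]: "F \<in> borel_measurable borel"
  shows "(\<integral>\<^sup>+z. F (z + \<i> * of_real (a * Re z)) \<partial>lborel) = (\<integral>\<^sup>+z. F z \<partial>lborel)"
proof -
  have m: "(\<lambda>z. z + \<i> * complex_of_real (a * Re z)) \<in> borel_measurable borel"
    by (intro borel_measurable_continuous_onI continuous_intros)
  have c: "(\<lambda>y. Complex x y) \<in> borel_measurable borel" for x
    by (intro borel_measurable_continuous_onI) (auto simp: Complex_eq intro!: continuous_intros)
  have "(\<integral>\<^sup>+z. F (z + \<i> * of_real (a * Re z)) \<partial>lborel) =
      (\<integral>\<^sup>+x. \<integral>\<^sup>+y. F (Complex x y + \<i> * of_real (a * x)) \<partial>lborel \<partial>lborel)"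
    using measurable_compose[OF m assms] by (subst nn_integral_lborel_complex(1)) auto
  also have "\<dots> = (\<integral>\<^sup>+x. \<integral>\<^sup>+y. F (Complex x y) \<partial>lborel \<partial>lborel)"
  proof (rule nn_integral_cong)
    fix x :: real
    have "(\<integral>\<^sup>+y. F (Complex x y) \<partial>lborel) = (\<integral>\<^sup>+y. F (Complex x (a * x + 1 * y)) \<partial>lborel)"
      using nn_integral_real_affine[OF measurable_compose[OF c assms], of 1 x "a * x"] by simp
    then show "(\<integral>\<^sup>+y. F (Complex x y + \<i> * of_real (a * x)) \<partial>lborel) = (\<integral>\<^sup>+y. F (Complex x y) \<partial>lborel)"
      by (simp add: Complex_eq algebra_simps)
  qed
  finally show ?thesis by (simp add: nn_integral_lborel_complex(1))
qed

text \<open>A rotation by an angle other than \<open>pi\<close> is a product of three shears.\<close>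

lemma nn_integral_complex_rotation:
  fixes F :: "complex \<Rightarrow> ennreal"
  assumes [measurable]: "F \<in> borel_measurable borel" and c: "cmod c = 1" "c \<noteq> -1"
  shows "(\<integral>\<^sup>+z. F (c * z) \<partial>lborel) = (\<integral>\<^sup>+z. F z \<partial>lborel)"
proof -
  define u v where "u = Re c" and "v = Im c"
  have uv: "u\<^sup>2 + v\<^sup>2 = 1" using c(1) by (simp add: u_def v_def cmod_def)
  have "u \<noteq> -1"
  proof
    assume "u = -1"
    with uv have "v = 0" by simp
    with \<open>u = -1\<close> c(2) show False by (simp add: u_def v_def complex_eq_iff)
  qed
  then have u1: "1 + u \<noteq> 0" by linarith
  \<comment> \<open>For c = cis theta this is - tan (theta / 2), the coefficient of the two outer
    shears; the middle one has coefficient sin theta. The half-angle tangent has a pole at theta =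
    pi, which is why c = -1 is excluded.\<close>
  define a where "a = - v / (1 + u)"
  define s1 where "s1 = (\<lambda>z. z + complex_of_real (a * Im z))"
  define s2 where "s2 = (\<lambda>z. z + \<i> * complex_of_real (v * Re z))"
  have m1: "s1 \<in> borel_measurable borel" and m2: "s2 \<in> borel_measurable borel"
    unfolding s1_def s2_def by (intro borel_measurable_continuous_onI continuous_intros)+
  have av: "1 + a * v = u" "a * (1 + u) = - v"
    using u1 uv by (auto simp: a_def field_simps power2_eq_square)
  have 1: "s1 (s2 (s1 z)) = c * z" for z
  proof -
    have "Re (s1 (s2 (s1 z))) = (1 + a * v) * Re z + a * (1 + (1 + a * v)) * Im z"
      by (simp add: s1_def s2_def algebra_simps)
    also have "\<dots> = u * Re z - v * Im z" using av by (simp add: algebra_simps)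
    finally have R: "Re (s1 (s2 (s1 z))) = Re (c * z)" by (simp add: u_def v_def)
    have "Im (s1 (s2 (s1 z))) = v * Re z + (1 + a * v) * Im z"
      by (simp add: s1_def s2_def algebra_simps)
    then have "Im (s1 (s2 (s1 z))) = Im (c * z)" unfolding av by (simp add: u_def v_def algebra_simps)
    with R show ?thesis by (simp add: complex_eq_iff)
  qed
  have "(\<integral>\<^sup>+z. F z \<partial>lborel) = (\<integral>\<^sup>+z. F (s1 z) \<partial>lborel)"
    unfolding s1_def by (rule nn_integral_complex_shear_Re[symmetric]) simp
  also have "\<dots> = (\<integral>\<^sup>+z. F (s1 (s2 z)) \<partial>lborel)"
    unfolding s2_def using measurable_compose[OF m1 assms(1)]
    by (intro nn_integral_complex_shear_Im[symmetric, of "\<lambda>z. F (s1 z)"])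
  also have "\<dots> = (\<integral>\<^sup>+z. F (s1 (s2 (s1 z))) \<partial>lborel)"
    using measurable_compose[OF m2 measurable_compose[OF m1 assms(1)]]
      nn_integral_complex_shear_Re[of "\<lambda>z. F (s1 (s2 z))" a] by (simp add: s1_def)
  finally show ?thesis by (simp add: 1)
qed

text \<open>The area of an annulus is linear in the squares of its radii, so the squared modulus
  pushes area on the disk forward to pi times Lebesgue measure on (0,1). The two measures are
  compared on half-lines, which avoids polar coordinates.\<close>

lemma nn_integral_radial:
  fixes F :: "real \<Rightarrow> ennreal"
  assumes [measurable]: "F \<in> borel_measurable borel"
  shows "(\<integral>\<^sup>+z. indicator (ball 0 1) z * F ((cmod z)\<^sup>2) \<partial>lborel) =
         ennreal pi * (\<integral>\<^sup>+x. indicator {0<..<1} x * F x \<partial>lborel)"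
proof -
  define M where "M = distr (density lborel (indicator (ball (0::complex) 1))) borel (\<lambda>z. (cmod z)\<^sup>2)"
  define N where "N = density lborel (\<lambda>x::real. ennreal pi * indicator {0<..<1} x)"
  have [measurable]: "(\<lambda>z::complex. (cmod z)\<^sup>2) \<in> borel_measurable borel" by measurable
  have eM: "emeasure M {x<..} = ennreal pi * ennreal (if x < 0 then 1 else if x < 1 then 1 - x else 0)"
      for x
  proof -
    have "emeasure M {x<..} = (\<integral>\<^sup>+z. indicator (ball 0 1 \<inter> {z. x < (cmod z)\<^sup>2}) z \<partial>lborel)"
    proof -
      have "emeasure M {x<..} = emeasure (density lborel (indicator (ball (0::complex) 1))) {z. x <
          (cmod z)\<^sup>2}"
        unfolding M_def by (subst emeasure_distr) (auto simp: vimage_def)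
      also have "\<dots> = (\<integral>\<^sup>+z. indicator (ball 0 1) z * indicator {z. x < (cmod z)\<^sup>2} z \<partial>lborel)"
      proof (rule emeasure_density)
        show "indicator (ball (0::complex) 1) \<in> borel_measurable lborel"
            by (rule borel_measurable_indicator) simp
        have "{z::complex. x < (cmod z)\<^sup>2} \<in> sets borel" by measurable
        then show "{z::complex. x < (cmod z)\<^sup>2} \<in> sets lborel" by simp
      qed
      finally show ?thesis by (simp add: indicator_inter_arith)
    qed
    also have "\<dots> = emeasure lborel (ball 0 1 \<inter> {z::complex. x < (cmod z)\<^sup>2})"
      by (rule nn_integral_indicator) measurable
    also have "\<dots> = ennreal pi * ennreal (if x < 0 then 1 else if x < 1 then 1 - x else 0)"
    proof -
      consider "x < 0" | "0 \<le> x" "x < 1" | "1 \<le> x" by linarith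
      then show ?thesis
      proof cases
        case 1
        then have "ball 0 1 \<inter> {z::complex. x < (cmod z)\<^sup>2} = ball 0 1"
          by (auto intro: less_le_trans)
        with 1 show ?thesis by (simp add: emeasure_ball unit_ball_vol_2)
      next
        case 2
        have "ball 0 1 \<inter> {z::complex. x < (cmod z)\<^sup>2} = ball 0 1 - cball 0 (sqrt x)"
        proof -
          have iff: "x < (cmod z)\<^sup>2 \<longleftrightarrow> sqrt x < cmod z" for z
            by (metis real_sqrt_less_iff real_sqrt_abs abs_norm_cancel)
          show ?thesis unfolding iff by (rule set_eqI) (simp add: not_le)
        qed
        also have "emeasure lborel \<dots> = emeasure lborel (ball (0::complex) 1)
            - emeasure lborel (cball (0::complex) (sqrt x))"
          using 2 order_le_less_trans[of _ "sqrt x" 1] by (intro emeasure_Diff) (auto simp: emeasure_cball)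
        also have "\<dots> = ennreal pi * ennreal (1 - x)"
          using 2 by (simp add: emeasure_ball emeasure_cball unit_ball_vol_2 ennreal_minus
              ennreal_mult'[symmetric] algebra_simps)
        finally show ?thesis using 2 by simp
      next
        case 3
        have "(cmod z)\<^sup>2 \<le> x" if "cmod z < 1" for z :: complex
          using 3 that by (intro order_trans[OF power_le_one]) auto
        then have "ball 0 1 \<inter> {z::complex. x < (cmod z)\<^sup>2} = {}"
          by (force simp flip: not_le)
        with 3 show ?thesis by simp
      qed
    qed
    finally show ?thesis .
  qed
  have eN: "emeasure N {x<..} = ennreal pi * ennreal (if x < 0 then 1 else if x < 1 then 1 - x else 0)"
      for x
  proof -
    have "emeasure N {x<..} = (\<integral>\<^sup>+y. ennreal pi * indicator ({0<..<1} \<inter> {x<..}) y \<partial>lborel)"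
      unfolding N_def by (subst emeasure_density) (auto intro!: nn_integral_cong split: split_indicator)
    also have "\<dots> = ennreal pi * emeasure lborel ({0<..<1} \<inter> {x<..})"
      by (subst nn_integral_cmult_indicator) auto
    also have "{0<..<1} \<inter> {x<..} = {max 0 x<..<1::real}" by auto
    finally show ?thesis by (auto simp: max_def)
  qed
  have "M = N"
  proof (rule measure_eqI_lessThan)
    show "sets M = sets borel" "sets N = sets borel" by (simp_all add: M_def N_def)
    show "emeasure M {x<..} < \<infinity>" "emeasure M {x<..} = emeasure N {x<..}" for x
      unfolding eM eN by (auto simp: ennreal_mult_less_top)
  qed
  have "(\<integral>\<^sup>+z. indicator (ball 0 1) z * F ((cmod z)\<^sup>2) \<partial>lborel) = (\<integral>\<^sup>+x. F x \<partial>M)"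
  proof -
    have i: "indicator (ball (0::complex) 1) \<in> borel_measurable lborel"
      by (rule borel_measurable_indicator) simp
    show ?thesis
      unfolding M_def by (subst nn_integral_distr, simp, simp, subst nn_integral_density[OF i]) auto
  qed
  also have "\<dots> = (\<integral>\<^sup>+x. ennreal pi * (indicator {0<..<1} x * F x) \<partial>lborel)"
    unfolding \<open>M = N\<close> N_def by (subst nn_integral_density) (auto simp: mult.assoc)
  finally show ?thesis by (simp add: nn_integral_cmult)
qed

lemma nn_integral_Beta:
  assumes "x > 0" "y > 0"
  shows "(\<integral>\<^sup>+t. indicator {0<..<1} t * ennreal (t powr (x - 1) * (1 - t) powr (y - 1)) \<partial>lborel) =
      ennreal (Beta x y)"
proof -
  have "((\<lambda>t. t powr (x - 1) * (1 - t) powr (y - 1)) has_integral Beta x y) {0<..<1}"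
    using has_integral_Beta_real[OF assms] by (simp add: has_integral_Icc_iff_Ioo)
  from nn_integral_has_integral_lebesgue[OF _ this]
  show ?thesis by (simp add: ennreal_mult'' ennreal_indicator)
qed

lemma Beta_real_pos: "0 < Beta x y" if "0 < x" "0 < (y::real)"
  using that by (auto simp: Beta_def intro!: divide_pos_pos mult_pos_pos Gamma_real_pos)

section \<open>The weighted measure on the disk: radial integrals, rotations and monomials\<close>

lemma space_disk_measure [simp]: "space (disk_measure \<alpha>) = ball 0 1"
  by (simp add: disk_measure_def space_restrict_space)

lemma sets_disk_measure: "sets (disk_measure \<alpha>) = sets (restrict_space borel (ball 0 1))"
  by (simp add: disk_measure_def sets_restrict_space)

lemma borel_measurable_disk_measureI:
  "F \<in> borel_measurable borel \<Longrightarrow> F \<in> borel_measurable (disk_measure \<alpha>)"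
  using measurable_restrict_space1[of F borel borel "ball 0 1"]
    measurable_cong_sets[OF sets_disk_measure refl] by blast

lemma continuous_on_imp_measurable_disk:
  "continuous_on (ball 0 1) F \<Longrightarrow> F \<in> borel_measurable (disk_measure \<alpha>)"
  using borel_measurable_continuous_on_restrict[of "ball 0 1" F]
    measurable_cong_sets[OF sets_disk_measure refl] by blast

text \<open>The density is taken as a function of the squared modulus, the variable in which area is
  uniform.\<close>

definition disk_weight :: "real \<Rightarrow> real \<Rightarrow> real" where
  "disk_weight \<alpha> x = (\<alpha> + 1) * (1 - x) powr \<alpha> / pi"

lemma nn_integral_disk_measure:
  assumes "F \<in> borel_measurable (disk_measure \<alpha>)"
  shows "(\<integral>\<^sup>+z. F z \<partial>disk_measure \<alpha>) =
    (\<integral>\<^sup>+z. indicator (ball 0 1) z * (ennreal (disk_weight \<alpha> ((cmod z)\<^sup>2)) * F z) \<partial>lborel)"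
proof -
  have F: "F \<in> borel_measurable (restrict_space lborel (ball 0 1))"
    using assms by (simp add: disk_measure_def)
  have w: "(\<lambda>z. ennreal ((\<alpha> + 1) * (1 - (cmod z)\<^sup>2) powr \<alpha> / pi))
      \<in> borel_measurable (restrict_space lborel (ball 0 1))"
    by (rule measurable_restrict_space1) measurable
  show ?thesis
    unfolding disk_measure_def disk_weight_def nn_integral_density[OF w F]
    by (subst nn_integral_restrict_space) (auto simp: mult_ac intro!: nn_integral_cong)
qed

lemma nn_integral_disk_radial:
  assumes [measurable]: "F \<in> borel_measurable borel"
  shows "(\<integral>\<^sup>+z. F ((cmod z)\<^sup>2) \<partial>disk_measure \<alpha>) =
    ennreal pi * (\<integral>\<^sup>+x. indicator {0<..<1} x * (ennreal (disk_weight \<alpha> x) * F x) \<partial>lborel)"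
proof -
  have 1: "(\<lambda>z. F ((cmod z)\<^sup>2)) \<in> borel_measurable (disk_measure \<alpha>)"
    by (rule borel_measurable_disk_measureI) measurable
  have 2: "(\<lambda>x. ennreal (disk_weight \<alpha> x) * F x) \<in> borel_measurable borel"
    unfolding disk_weight_def by measurable
  show ?thesis
    unfolding nn_integral_disk_measure[OF 1] nn_integral_radial[OF 2] ..
qed

text \<open>A Beta integral in the squared modulus. The values are the Parseval weights; their
  reciprocals are the coefficients of (1 - x)^(-(alpha + 2)), which ties the Bergman norm to
  binomial series.\<close>

lemma nn_integral_disk_power:
  assumes "-1 < \<alpha>"
  shows "(\<integral>\<^sup>+z. ennreal (cmod z ^ (2 * n)) \<partial>disk_measure \<alpha>) = ennreal (fact n / pochhammer (\<alpha> + 2) n)"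
proof -
  have "(\<integral>\<^sup>+z. ennreal (cmod z ^ (2 * n)) \<partial>disk_measure \<alpha>) =
      ennreal pi * (\<integral>\<^sup>+x. indicator {0<..<1} x * (ennreal (disk_weight \<alpha> x) * ennreal (x ^ n)) \<partial>lborel)"
    using nn_integral_disk_radial[of "\<lambda>x. ennreal (x ^ n)" \<alpha>] by (simp add: power_mult)
  also have "(\<integral>\<^sup>+x. indicator {0<..<1} x * (ennreal (disk_weight \<alpha> x) * ennreal (x ^ n)) \<partial>lborel) =
     (\<integral>\<^sup>+x. ennreal ((\<alpha> + 1) / pi) * (indicator {0<..<1} x *
        ennreal (x powr (real (n + 1) - 1) * (1 - x) powr ((\<alpha> + 1) - 1))) \<partial>lborel)"
    using assms by (intro nn_integral_cong)
      (auto simp: disk_weight_def ennreal_mult'[symmetric] powr_realpow mult_ac split: split_indicator)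
  also have "\<dots> = ennreal ((\<alpha> + 1) / pi) * ennreal (Beta (real (n + 1)) (\<alpha> + 1))"
    using assms by (subst nn_integral_cmult) (measurable, subst nn_integral_Beta, auto)
  also have "ennreal pi * \<dots> = ennreal ((\<alpha> + 1) * Beta (real (n + 1)) (\<alpha> + 1))"
    using assms Beta_real_pos[of "real (n + 1)" "\<alpha> + 1"] by (simp add: ennreal_mult'[symmetric])
  also have "(\<alpha> + 1) * Beta (real (n + 1)) (\<alpha> + 1) = fact n / pochhammer (\<alpha> + 2) n"
  proof -
    have np: "\<alpha> + 1 \<notin> \<int>\<^sub>\<le>\<^sub>0" "\<alpha> + 2 \<notin> \<int>\<^sub>\<le>\<^sub>0"
      using assms by (auto dest: nonpos_Ints_nonpos)
    have G: "(\<alpha> + 1) * Gamma (\<alpha> + 1) = Gamma (\<alpha> + 2)"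
      using np Gamma_plus1[of "\<alpha> + 1"] by (simp add: add.assoc)
    have F: "Gamma (real (n + 1)) = fact n" using Gamma_fact[of n, where 'a = real] by (simp add: add_ac)
    have P: "pochhammer (\<alpha> + 2) n = Gamma (\<alpha> + 2 + real n) / Gamma (\<alpha> + 2)"
      using np by (subst pochhammer_Gamma) auto
    have "(\<alpha> + 1) * Beta (real (n + 1)) (\<alpha> + 1) =
        fact n * ((\<alpha> + 1) * Gamma (\<alpha> + 1)) / Gamma (real (n + 1) + (\<alpha> + 1))"
      by (simp only: Beta_def F times_divide_eq_right mult_ac)
    also have "real (n + 1) + (\<alpha> + 1) = \<alpha> + 2 + real n" by simp
    finally show ?thesis unfolding G P by simp
  qed
  finally show ?thesis .
qed

lemma emeasure_disk_measure: "-1 < \<alpha> \<Longrightarrow> emeasure (disk_measure \<alpha>) (ball 0 1) = 1"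
  using nn_integral_disk_power[of \<alpha> 0] nn_integral_const[of "disk_measure \<alpha>" 1] by simp

lemma finite_measure_disk_measure: "-1 < \<alpha> \<Longrightarrow> finite_measure (disk_measure \<alpha>)"
  by (rule finite_measureI) (simp add: emeasure_disk_measure)

text \<open>The density depends on |z| only, so this reduces to the invariance of Lebesgue
  measure.\<close>

lemma distr_disk_measure_rotation:
  assumes c: "cmod c = 1" "c \<noteq> -1"
  shows "distr (disk_measure \<alpha>) (disk_measure \<alpha>) (\<lambda>z. c * z) = disk_measure \<alpha>"
proof (rule measure_eqI)
  have m: "(\<lambda>z. c * z) \<in> disk_measure \<alpha> \<rightarrow>\<^sub>M disk_measure \<alpha>"
  proof -
    have "(\<lambda>z. c * z) \<in> restrict_space borel (ball 0 1) \<rightarrow>\<^sub>M restrict_space borel (ball 0 1)"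
      using c by (intro measurable_restrict_space2 borel_measurable_continuous_on_restrict
          continuous_intros)
        (auto simp: space_restrict_space norm_mult)
    then show ?thesis
      using measurable_cong_sets[OF sets_disk_measure sets_disk_measure] by blast
  qed
  fix A assume "A \<in> sets (distr (disk_measure \<alpha>) (disk_measure \<alpha>) (\<lambda>z. c * z))"
  then have A: "A \<in> sets (disk_measure \<alpha>)" by simp
  then have A': "A \<in> sets borel" "A \<subseteq> ball 0 1"
    using sets.sets_into_space[OF A] by (auto simp: sets_disk_measure sets_restrict_space)
  have [measurable]: "indicator A \<in> borel_measurable borel" using A' by simp
  define G where "G z = indicator (ball 0 1) z
      * (ennreal (disk_weight \<alpha> ((cmod z)\<^sup>2)) * indicator A z)" for z :: complex
  have [measurable]: "G \<in> borel_measurable borel"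
    unfolding G_def disk_weight_def
    by (intro borel_measurable_times_ennreal borel_measurable_indicator measurable_ennreal)
       (use A' in measurable)
  have "emeasure (distr (disk_measure \<alpha>) (disk_measure \<alpha>) (\<lambda>z. c * z)) A =
      (\<integral>\<^sup>+z. indicator A (c * z) \<partial>disk_measure \<alpha>)"
    using m A by (subst nn_integral_indicator[symmetric], simp, subst nn_integral_distr) auto
  also have "\<dots> = (\<integral>\<^sup>+z. G (c * z) \<partial>lborel)"
    using c measurable_compose[OF m, of "indicator A" borel] A
    by (subst nn_integral_disk_measure) (auto simp: G_def norm_mult indicator_def dist_norm)
  also have "\<dots> = (\<integral>\<^sup>+z. G z \<partial>lborel)"
    by (rule nn_integral_complex_rotation[OF _ c]) measurable
  also have "\<dots> = (\<integral>\<^sup>+z. indicator A z \<partial>disk_measure \<alpha>)"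
    using A by (subst nn_integral_disk_measure) (simp_all add: G_def[abs_def])
  also have "\<dots> = emeasure (disk_measure \<alpha>) A" using A by simp
  finally show "emeasure (distr (disk_measure \<alpha>) (disk_measure \<alpha>) (\<lambda>z. c * z)) A =
      emeasure (disk_measure \<alpha>) A" .
qed simp

text \<open>A rotation by c preserves the measure and multiplies the integral by
  \<open>c ^ k * cnj c ^ l\<close>; one rotation for which this factor is not 1 forces the integral
  to vanish. The smaller ball allows truncation at a radius below 1.\<close>

lemma disk_monomials_orthogonal:
  fixes k l :: nat
  assumes "k \<noteq> l"
  shows "(LINT z|disk_measure \<alpha>. indicator (ball 0 R) z *\<^sub>R (z ^ k * cnj z ^ l)) = 0"
proof -
  define d where "d = \<bar>real k - real l\<bar>"
  have d: "d \<ge> 1" using assms by (auto simp: d_def)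
  \<comment> \<open>With this angle the factor becomes cis (pi/2) or cis (-pi/2), and c stays in the
    closed right half plane, hence differs from -1.\<close>
  define c where "c = cis (pi / (2 * d))"
  have c1: "cmod c = 1" by (simp add: c_def)
  have "Re c \<ge> 0"
  proof -
    have "pi / (2 * d) \<le> pi / 2" "0 \<le> pi / (2 * d)"
      using d by (auto simp: field_simps)
    then show ?thesis using pi_gt_zero by (simp add: c_def cos_ge_zero)
  qed
  then have c2: "c \<noteq> -1" by auto
  have ck: "c ^ k * cnj c ^ l = cis ((real k - real l) * pi / (2 * d))"
    by (simp add: c_def Complex.DeMoivre cis_cnj cis_mult algebra_simps flip: power_inverse)
       (simp add: diff_divide_distrib)
  have "(real k - real l) * pi / (2 * d) = pi / 2 \<or> (real k - real l) * pi / (2 * d) = - (pi / 2)"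
    using d by (auto simp: d_def abs_real_def field_simps split: if_splits)
  then have ne: "c ^ k * cnj c ^ l \<noteq> 1"
  proof (elim disjE)
    assume eq: "(real k - real l) * pi / (2 * d) = pi / 2"
    show ?thesis unfolding ck eq by (simp add: complex_eq_iff)
  next
    assume eq: "(real k - real l) * pi / (2 * d) = - (pi / 2)"
    show ?thesis unfolding ck eq by (simp add: complex_eq_iff)
  qed
  define G where "G z = indicator (ball 0 R) z *\<^sub>R (z ^ k * cnj z ^ l)" for z :: complex
  have [measurable]: "G \<in> borel_measurable (disk_measure \<alpha>)"
    unfolding G_def
    by (intro borel_measurable_disk_measureI borel_measurable_scaleR borel_measurable_indicator
         borel_measurable_continuous_onI continuous_intros) auto
  have m: "(\<lambda>z. c * z) \<in> disk_measure \<alpha> \<rightarrow>\<^sub>M disk_measure \<alpha>"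
  proof -
    have "(\<lambda>z. c * z) \<in> restrict_space borel (ball 0 1) \<rightarrow>\<^sub>M restrict_space borel (ball 0 1)"
      using c1 by (intro measurable_restrict_space2 borel_measurable_continuous_on_restrict
          continuous_intros)
        (auto simp: space_restrict_space norm_mult)
    then show ?thesis
      using measurable_cong_sets[OF sets_disk_measure sets_disk_measure] by blast
  qed
  have "(LINT z|disk_measure \<alpha>. G z) = (LINT z|distr (disk_measure \<alpha>) (disk_measure \<alpha>) (\<lambda>z. c * z). G z)"
    by (simp add: distr_disk_measure_rotation[OF c1 c2])
  also have "\<dots> = (LINT z|disk_measure \<alpha>. G (c * z))"
    by (rule integral_distr[OF m]) simp
  also have "\<dots> = (LINT z|disk_measure \<alpha>. (c ^ k * cnj c ^ l) * G z)"
    using c1 by (intro Bochner_Integration.integral_cong)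
      (auto simp: G_def norm_mult indicator_def power_mult_distrib)
  also have "\<dots> = (c ^ k * cnj c ^ l) * (LINT z|disk_measure \<alpha>. G z)"
    by (rule integral_mult_right_zero)
  finally show ?thesis using ne by (simp add: G_def)
qed

section \<open>Parseval's formula\<close>

lemma power_series_summable_norm:
  fixes c :: "nat \<Rightarrow> complex"
  assumes sums: "\<And>z. cmod z < 1 \<Longrightarrow> summable (\<lambda>n. c n * z ^ n)" and "0 \<le> R" "R < 1"
  shows "summable (\<lambda>n. cmod (c n) * R ^ n)"
proof -
  have "summable (\<lambda>n. norm (c n * complex_of_real R ^ n))"
    by (rule powser_insidea[where x = "complex_of_real ((R + 1) / 2)"])
       (use assms in \<open>auto simp: norm_power simp flip: of_real_add of_real_divide intro!: sums\<close>)
  then show ?thesis using assms by (simp add: norm_mult norm_power)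
qed

text \<open>On a ball of radius R < 1 all partial sums share the bound \<open>K\<close>, so
  dominated convergence applies without any integrability assumption on h; for a partial sum the
  identity is orthogonality of monomials.\<close>

lemma power_series_disk_norm_partial:
  fixes c :: "nat \<Rightarrow> complex"
  assumes \<alpha>: "-1 < \<alpha>" and R: "0 < R" "R < 1"
    and sums: "\<And>z. cmod z < 1 \<Longrightarrow> (\<lambda>n. c n * z ^ n) sums h z"
  shows "(\<integral>\<^sup>+z. indicator (ball 0 R) z * ennreal ((cmod (h z))\<^sup>2) \<partial>disk_measure \<alpha>) =
    (\<Sum>n. ennreal ((cmod (c n))\<^sup>2) * (\<integral>\<^sup>+z. indicator (ball 0 R) z * ennreal (cmod z ^ (2 * n))
        \<partial>disk_measure \<alpha>))"
proof -
  interpret finite_measure "disk_measure \<alpha>" by (rule finite_measure_disk_measure[OF \<alpha>])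
  define \<mu> where "\<mu> = disk_measure \<alpha>"
  define K where "K = (\<Sum>n. cmod (c n) * R ^ n)"
  have sm: "summable (\<lambda>n. cmod (c n) * R ^ n)"
    using sums R by (intro power_series_summable_norm) (auto simp: sums_iff)
  define P where "P N z = (\<Sum>n<N. c n * z ^ n)" for N z
  define M where "M n = (LINT z|\<mu>. indicator (ball 0 R) z * cmod z ^ (2 * n))" for n
  have P_bound: "cmod (P N z) \<le> K" if "z \<in> ball 0 R" for N z
  proof -
    have "cmod (P N z) \<le> (\<Sum>n<N. cmod (c n) * R ^ n)"
      unfolding P_def using that
      by (intro sum_norm_le) (auto simp: norm_mult norm_power intro!: mult_left_mono power_mono)
    also have "\<dots> \<le> K" unfolding K_def using R by (intro sum_le_suminf sm) auto
    finally show ?thesis .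
  qed
  have meas: "(\<lambda>z. indicator (ball 0 R) z *\<^sub>R f z) \<in> borel_measurable \<mu>"
    if "continuous_on UNIV f" for f :: "complex \<Rightarrow> 'b :: {second_countable_topology, real_normed_vector}"
    unfolding \<mu>_def using that
    by (intro borel_measurable_disk_measureI borel_measurable_scaleR borel_measurable_indicator
         borel_measurable_continuous_onI) auto
  have int: "integrable \<mu> (\<lambda>z. indicator (ball 0 R) z *\<^sub>R f z)"
    if f: "continuous_on UNIV f" for f :: "complex \<Rightarrow> 'b :: {second_countable_topology, banach}"
  proof -
    have "bounded (f ` cball 0 R)"
      by (intro compact_imp_bounded compact_continuous_image continuous_on_subset[OF f]) auto
    then obtain C where C: "\<And>z. z \<in> cball 0 R \<Longrightarrow> norm (f z) \<le> C" unfolding bounded_iff by blast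
    have "0 \<le> C" by (rule order_trans[OF norm_ge_zero C[of 0]]) (use R in simp)
    then show ?thesis
      unfolding \<mu>_def
      by (intro integrable_const_bound[where B = C] AE_I2 meas[OF f, unfolded \<mu>_def])
         (auto simp: indicator_def intro!: C)
  qed
  have eq: "(LINT z|\<mu>. indicator (ball 0 R) z * (cmod (P N z))\<^sup>2) = (\<Sum>n<N. (cmod (c n))\<^sup>2 * M n)" for N
  proof -
    have "complex_of_real (LINT z|\<mu>. indicator (ball 0 R) z * (cmod (P N z))\<^sup>2) =
       (LINT z|\<mu>. complex_of_real (indicator (ball 0 R) z * (cmod (P N z))\<^sup>2))"
      by (rule integral_complex_of_real[symmetric])
    also have "\<dots> = (LINT z|\<mu>. (\<Sum>n<N. \<Sum>l<N. (c n * cnj (c l))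
        * (indicator (ball 0 R) z *\<^sub>R (z ^ n * cnj z ^ l))))"
    proof (intro Bochner_Integration.integral_cong refl)
      fix z
      have "complex_of_real ((cmod (P N z))\<^sup>2) = P N z * cnj (P N z)"
        by (rule complex_norm_square)
      also have "\<dots> = (\<Sum>n<N. \<Sum>l<N. (c n * cnj (c l)) * (z ^ n * cnj z ^ l))"
        unfolding P_def by (simp add: sum_product mult_ac)
      finally show "complex_of_real (indicator (ball 0 R) z * (cmod (P N z))\<^sup>2) =
         (\<Sum>n<N. \<Sum>l<N. (c n * cnj (c l)) * (indicator (ball 0 R) z *\<^sub>R (z ^ n * cnj z ^ l)))"
        by (simp add: indicator_def)
    qed
    also have "\<dots> = (\<Sum>n<N. \<Sum>l<N. (c n * cnj (c l))
        * (LINT z|\<mu>. indicator (ball 0 R) z *\<^sub>R (z ^ n * cnj z ^ l)))"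
    proof -
      have I: "integrable \<mu> (\<lambda>z. (c n * cnj (c l))
          * (indicator (ball 0 R) z *\<^sub>R (z ^ n * cnj z ^ l)))" for n l
        by (rule integrable_mult_right) (intro int continuous_intros)
      show ?thesis
        by (simp only: Bochner_Integration.integral_sum Bochner_Integration.integrable_sum I
           integral_mult_right_zero)
    qed
    also have "\<dots> = (\<Sum>n<N. \<Sum>l<N. if l = n then complex_of_real ((cmod (c n))\<^sup>2 * M n) else 0)"
    proof (intro sum.cong refl)
      fix n l
      have "(LINT z|\<mu>. indicator (ball 0 R) z *\<^sub>R (z ^ n * cnj z ^ n)) = complex_of_real (M n)"
        unfolding M_def integral_complex_of_real[symmetric]
      proof (intro Bochner_Integration.integral_cong refl)
        fix z :: complex
        have "complex_of_real (cmod z ^ (2 * n)) = (z * cnj z) ^ n"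
          unfolding power_mult of_real_power[symmetric] complex_norm_square[symmetric]
              by (simp only: of_real_power)
        then show "indicator (ball 0 R) z *\<^sub>R (z ^ n * cnj z ^ n) =
            complex_of_real (indicator (ball 0 R) z * cmod z ^ (2 * n))"
          by (simp add: indicator_def power_mult_distrib)
      qed
      moreover have "c n * cnj (c n) = complex_of_real ((cmod (c n))\<^sup>2)"
        by (rule complex_norm_square[symmetric])
      ultimately show "(c n * cnj (c l)) * (LINT z|\<mu>. indicator (ball 0 R) z *\<^sub>R (z ^ n * cnj z ^ l)) =
          (if l = n then complex_of_real ((cmod (c n))\<^sup>2 * M n) else 0)"
        using disk_monomials_orthogonal[of n l \<alpha> R] by (auto simp: \<mu>_def)
    qed
    also have "\<dots> = complex_of_real (\<Sum>n<N. (cmod (c n))\<^sup>2 * M n)"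
      by (simp add: sum.delta)
    finally show ?thesis by (simp only: of_real_eq_iff)
  qed
  have conv: "(\<lambda>N. P N z) \<longlonglongrightarrow> h z" if "z \<in> ball 0 R" for z
    using sums[of z] that R by (auto simp: sums_def P_def)
  have contP: "continuous_on UNIV (\<lambda>z. (cmod (P N z))\<^sup>2)" for N
    unfolding P_def by (intro continuous_intros)
  have tendsto_mult_indicator_ball: "(\<lambda>N. indicator (ball 0 R) z * (cmod (P N z))\<^sup>2) \<longlonglongrightarrow>
      indicator (ball 0 R) z * (cmod (h z))\<^sup>2" for z
    by (cases "z \<in> ball 0 R") (use conv[of z] in \<open>simp_all add: tendsto_power tendsto_norm\<close>)
  have meas_h: "(\<lambda>z. indicator (ball 0 R) z * (cmod (h z))\<^sup>2) \<in> borel_measurable \<mu>"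
  proof (rule borel_measurable_LIMSEQ_real)
    show "(\<lambda>N. indicator (ball 0 R) z * (cmod (P N z))\<^sup>2) \<longlonglongrightarrow> indicator (ball 0 R) z * (cmod (h z))\<^sup>2" for z
      by (rule tendsto_mult_indicator_ball)
    show "(\<lambda>z. indicator (ball 0 R) z * (cmod (P N z))\<^sup>2) \<in> borel_measurable \<mu>" for N
      using meas[OF contP] by simp
  qed
  have lim: "(\<lambda>N. LINT z|\<mu>. indicator (ball 0 R) z * (cmod (P N z))\<^sup>2) \<longlonglongrightarrow>
      (LINT z|\<mu>. indicator (ball 0 R) z * (cmod (h z))\<^sup>2)"
    and int_h: "integrable \<mu> (\<lambda>z. indicator (ball 0 R) z * (cmod (h z))\<^sup>2)"
  proof -
    have 1: "(\<lambda>z. indicator (ball 0 R) z * (cmod (P N z))\<^sup>2) \<in> borel_measurable \<mu>" for N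
      using meas[OF contP] by simp
    have 2: "AE z in \<mu>. (\<lambda>N. indicator (ball 0 R) z * (cmod (P N z))\<^sup>2) \<longlonglongrightarrow>
        indicator (ball 0 R) z * (cmod (h z))\<^sup>2"
      by (intro AE_I2 tendsto_mult_indicator_ball)
    have 3: "AE z in \<mu>. norm (indicator (ball 0 R) z * (cmod (P N z))\<^sup>2) \<le> K\<^sup>2" for N
    proof (rule AE_I2)
      fix z show "norm (indicator (ball 0 R) z * (cmod (P N z))\<^sup>2) \<le> K\<^sup>2"
        using P_bound[of z N] by (cases "z \<in> ball 0 R") (simp_all add: power_mono)
    qed
    have 4: "integrable \<mu> (\<lambda>_. K\<^sup>2)" by (simp add: \<mu>_def)
    show "(\<lambda>N. LINT z|\<mu>. indicator (ball 0 R) z * (cmod (P N z))\<^sup>2) \<longlonglongrightarrow>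
        (LINT z|\<mu>. indicator (ball 0 R) z * (cmod (h z))\<^sup>2)"
      by (rule integral_dominated_convergence[OF meas_h 1 4 2 3])
    show "integrable \<mu> (\<lambda>z. indicator (ball 0 R) z * (cmod (h z))\<^sup>2)"
      by (rule integrable_dominated_convergence[OF meas_h 1 4 2 3])
  qed
  have nonneg: "0 \<le> M n" for n unfolding M_def by (intro integral_nonneg_AE) auto
  have s: "(\<lambda>n. (cmod (c n))\<^sup>2 * M n) sums (LINT z|\<mu>. indicator (ball 0 R) z * (cmod (h z))\<^sup>2)"
    unfolding sums_def using lim by (simp add: eq)
  have M_eq: "ennreal (M n) = (\<integral>\<^sup>+z. indicator (ball 0 R) z * ennreal (cmod z ^ (2 * n)) \<partial>\<mu>)" for n
  proof -
    have "integrable \<mu> (\<lambda>z. indicator (ball 0 R) z * cmod z ^ (2 * n))"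
      using int[of "\<lambda>z. cmod z ^ (2 * n)"] by (auto intro!: continuous_intros)
    from nn_integral_eq_integral[OF this] show ?thesis
      by (auto simp: M_def ennreal_mult'' ennreal_indicator)
  qed
  have "(\<integral>\<^sup>+z. indicator (ball 0 R) z * ennreal ((cmod (h z))\<^sup>2) \<partial>\<mu>) =
      ennreal (LINT z|\<mu>. indicator (ball 0 R) z * (cmod (h z))\<^sup>2)"
    using nn_integral_eq_integral[OF int_h] by (auto simp: ennreal_mult'' ennreal_indicator)
  also have "\<dots> = (\<Sum>n. ennreal ((cmod (c n))\<^sup>2 * M n))"
    using s nonneg by (intro suminf_ennreal_eq[symmetric]) auto
  finally show ?thesis
    using nonneg by (simp add: ennreal_mult' M_eq \<mu>_def)
qed

text \<open>Monotone convergence along radii increasing to 1. Both sides may be infinite, so the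
  formula can also be used to establish membership in the space.\<close>

lemma power_series_disk_norm:
  fixes c :: "nat \<Rightarrow> complex"
  assumes \<alpha>: "-1 < \<alpha>"
    and sums: "\<And>z. cmod z < 1 \<Longrightarrow> (\<lambda>n. c n * z ^ n) sums h z"
  shows "(\<integral>\<^sup>+z. ennreal ((cmod (h z))\<^sup>2) \<partial>disk_measure \<alpha>) =
    (\<Sum>n. ennreal ((cmod (c n))\<^sup>2 * (fact n / pochhammer (\<alpha> + 2) n)))"
proof -
  define R where "R i = 1 - 1 / (real i + 2)" for i
  have R: "0 < R i" "R i < 1" for i by (auto simp: R_def field_simps)
  have R_mono: "R i \<le> R j" if "i \<le> j" for i j using that by (auto simp: R_def field_simps)
  have lim: "(\<integral>\<^sup>+z. F z \<partial>disk_measure \<alpha>) = (SUP i. \<integral>\<^sup>+z. indicator (ball 0 (R i)) z * F z \<partial>disk_measure \<alpha>)"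
    if F: "F \<in> borel_measurable (disk_measure \<alpha>)" for F
  proof -
    have "(SUP i. \<integral>\<^sup>+z. indicator (ball 0 (R i)) z * F z \<partial>disk_measure \<alpha>) =
          (\<integral>\<^sup>+z. (SUP i. indicator (ball 0 (R i)) z * F z) \<partial>disk_measure \<alpha>)"
    proof (rule nn_integral_monotone_convergence_SUP[symmetric])
      show "incseq (\<lambda>i z. indicator (ball 0 (R i)) z * F z)"
        by (intro incseq_SucI le_funI mult_right_mono)
           (auto simp: indicator_def intro: less_le_trans[OF _ R_mono])
      show "(\<lambda>z. indicator (ball 0 (R i)) z * F z) \<in> borel_measurable (disk_measure \<alpha>)" for i
        by (intro borel_measurable_times_ennreal F borel_measurable_disk_measureI
           borel_measurable_indicator) auto
    qed
    also have "\<dots> = (\<integral>\<^sup>+z. F z \<partial>disk_measure \<alpha>)"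
    proof (rule nn_integral_cong)
      fix z assume "z \<in> space (disk_measure \<alpha>)"
      then have z: "cmod z < 1" by simp
      obtain i :: nat where "1 / (1 - cmod z) < real i" using reals_Archimedean2 by blast
      then have "1 < real i * (1 - cmod z)" using z by (simp add: field_simps)
      then have "1 < (real i + 2) * (1 - cmod z)" using z by (simp add: algebra_simps)
      then have "cmod z < R i" by (simp add: R_def field_simps)
      then have "indicator (ball 0 (R i)) z * F z = F z" by simp
      moreover have "indicator (ball 0 (R j)) z * F z \<le> F z" for j
        by (auto simp: indicator_def)
      ultimately show "(SUP i. indicator (ball 0 (R i)) z * F z) = F z"
        by (intro antisym SUP_least) (auto intro: SUP_upper2[of i])
    qed
    finally show ?thesis ..
  qed
  have inc: "incseq (\<lambda>i. \<integral>\<^sup>+z. indicator (ball 0 (R i)) z * F z \<partial>disk_measure \<alpha>)" for F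
    by (intro incseq_SucI nn_integral_mono mult_right_mono)
       (auto simp: indicator_def intro: less_le_trans[OF _ R_mono])
  have hm: "(\<lambda>z. ennreal ((cmod (h z))\<^sup>2)) \<in> borel_measurable (disk_measure \<alpha>)"
  proof -
    have h': "h z = (\<Sum>n. c n * z ^ n)" if "z \<in> ball 0 1" for z
      using sums[of z] that by (simp add: sums_iff)
    have "h holomorphic_on ball 0 1"
      by (rule power_series_holomorphic[where a = c]) (use sums in auto)
    then have "continuous_on (ball 0 1) h" by (rule holomorphic_on_imp_continuous_on)
    then have "h \<in> borel_measurable (disk_measure \<alpha>)" by (rule continuous_on_imp_measurable_disk)
    then show ?thesis by measurable
  qed
  have pm: "(\<lambda>z. ennreal (cmod z ^ (2 * n))) \<in> borel_measurable (disk_measure \<alpha>)" for n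
    by (rule borel_measurable_disk_measureI) measurable
  have "(\<integral>\<^sup>+z. ennreal ((cmod (h z))\<^sup>2) \<partial>disk_measure \<alpha>) =
     (SUP i. \<Sum>n. ennreal ((cmod (c n))\<^sup>2) * (\<integral>\<^sup>+z. indicator (ball 0 (R i)) z * ennreal (cmod z ^ (2 * n))
         \<partial>disk_measure \<alpha>))"
    unfolding lim[OF hm] by (intro SUP_cong refl power_series_disk_norm_partial[OF \<alpha> R sums])
  also have "\<dots> = (\<Sum>n. SUP i. ennreal ((cmod (c n))\<^sup>2)
      * (\<integral>\<^sup>+z. indicator (ball 0 (R i)) z * ennreal (cmod z ^ (2 * n)) \<partial>disk_measure \<alpha>))"
    by (intro ennreal_suminf_SUP_eq[symmetric] incseq_SucI mult_left_mono incseqD[OF inc]) auto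
  also have "\<dots> = (\<Sum>n. ennreal ((cmod (c n))\<^sup>2) * ennreal (fact n / pochhammer (\<alpha> + 2) n))"
    by (simp add: SUP_mult_left_ennreal[symmetric] lim[OF pm, symmetric] nn_integral_disk_power[OF \<alpha>])
  finally show ?thesis by (simp only: ennreal_mult'[OF zero_le_power2])
qed

section \<open>Weighted composition operators\<close>

lemma binomial_series_real:
  fixes \<kappa> q :: real
  assumes "\<bar>q\<bar> < 1"
  shows "(\<lambda>j. pochhammer \<kappa> j / fact j * q ^ j) sums (1 - q) powr (- \<kappa>)"
proof -
  have "(- \<kappa> gchoose j) * (- q) ^ j = pochhammer \<kappa> j / fact j * q ^ j" for j
    by (simp add: gbinomial_pochhammer power_mult_distrib[symmetric] field_simps flip: power_mult_distrib)
  then show ?thesis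
    using gen_binomial_real[of "- q" "- \<kappa>"] assms by simp
qed

lemma binomial_series_complex:
  fixes \<kappa> :: real and w :: complex
  assumes "cmod w < 1"
  shows "(\<lambda>j. of_real (pochhammer \<kappa> j / fact j) * w ^ j) sums (1 - w) powr (- of_real \<kappa>)"
proof -
  have "(- of_real \<kappa> gchoose j) * (- w) ^ j = of_real (pochhammer \<kappa> j / fact j) * w ^ j" for j
  proof -
    have "(- w) ^ j = (-1) ^ j * w ^ j" by (rule power_minus)
    moreover have "(-1::complex) ^ j * (-1) ^ j = 1" by (simp flip: power_mult_distrib)
    ultimately show ?thesis
      by (simp add: gbinomial_pochhammer pochhammer_of_real)
  qed
  then show ?thesis
    using gen_binomial_complex[of "- w" "- of_real \<kappa>"] assms by simp
qed

lemma suminf_swap_ennreal: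
  fixes f :: "nat \<Rightarrow> nat \<Rightarrow> ennreal"
  shows "(\<Sum>i. \<Sum>j. f i j) = (\<Sum>j. \<Sum>i. f i j)"
  using nn_integral_suminf[of "\<lambda>j i. f i j" "count_space UNIV"]
  by (simp add: nn_integral_count_space_nat)

text \<open>Each term a x is split as sqrt (a v) times sqrt (a / v) x. The finite inequality passes
  to the limit; extended values allow the right-hand series to diverge.\<close>

lemma weighted_Cauchy_Schwarz_ennreal:
  fixes a v x :: "nat \<Rightarrow> real"
  assumes a: "\<And>n. 0 \<le> a n" and v: "\<And>n. 0 < v n" and x: "\<And>n. 0 \<le> x n"
    and sx: "summable (\<lambda>n. a n * x n)" and sv: "(\<lambda>n. a n * v n) sums A"
  shows "ennreal ((\<Sum>n. a n * x n)\<^sup>2) \<le> ennreal A * (\<Sum>n. ennreal (a n * (x n)\<^sup>2 / v n))"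
proof (rule LIMSEQ_le_const2)
  show "(\<lambda>N. ennreal ((\<Sum>n<N. a n * x n)\<^sup>2)) \<longlonglongrightarrow> ennreal ((\<Sum>n. a n * x n)\<^sup>2)"
    by (intro tendsto_ennrealI tendsto_power summable_LIMSEQ sx)
  show "\<exists>N0. \<forall>N\<ge>N0. ennreal ((\<Sum>n<N. a n * x n)\<^sup>2) \<le> ennreal A * (\<Sum>n. ennreal (a n * (x n)\<^sup>2 / v n))"
  proof (intro exI allI impI)
    fix N :: nat
    have "(\<Sum>n<N. a n * x n)\<^sup>2 = (\<Sum>n<N. sqrt (a n * v n) * (sqrt (a n / v n) * x n))\<^sup>2"
    proof -
      have "a n * x n = sqrt (a n * v n) * (sqrt (a n / v n) * x n)" for n
      proof -
        have "(a n * v n) * (a n / v n) = a n * a n"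
          using v[of n] by simp
        then have "sqrt (a n * v n) * sqrt (a n / v n) = sqrt (a n * a n)"
          by (metis real_sqrt_mult)
        also have "\<dots> = a n" using a[of n] by (simp add: real_sqrt_abs2)
        finally show ?thesis by (simp only: mult.assoc[symmetric])
      qed
      then show ?thesis by (simp only:)
    qed
    also have "\<dots> \<le> (\<Sum>n<N. (sqrt (a n * v n))\<^sup>2) * (\<Sum>n<N. (sqrt (a n / v n) * x n)\<^sup>2)"
      by (rule Cauchy_Schwarz_ineq_sum)
    also have "\<dots> = (\<Sum>n<N. a n * v n) * (\<Sum>n<N. a n * (x n)\<^sup>2 / v n)"
      using a v by (simp add: power_mult_distrib less_imp_le)
    also have "\<dots> \<le> A * (\<Sum>n<N. a n * (x n)\<^sup>2 / v n)"
    proof (rule mult_right_mono)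
      show "(\<Sum>n<N. a n * v n) \<le> A"
        unfolding sums_unique[OF sv] using a v sv by (intro sum_le_suminf) (auto simp: sums_iff less_imp_le)
    qed (use a v in \<open>auto intro!: sum_nonneg divide_nonneg_pos\<close>)
    finally have "ennreal ((\<Sum>n<N. a n * x n)\<^sup>2) \<le> ennreal (A * (\<Sum>n<N. a n * (x n)\<^sup>2 / v n))"
      by (rule ennreal_leI)
    also have "\<dots> = ennreal A * (\<Sum>n<N. ennreal (a n * (x n)\<^sup>2 / v n))"
      using a v by (subst ennreal_mult'') (auto intro!: sum_nonneg divide_nonneg_pos
          simp: sum_ennreal less_imp_le)
    also have "\<dots> \<le> ennreal A * (\<Sum>n. ennreal (a n * (x n)\<^sup>2 / v n))"
      by (intro mult_left_mono sum_le_suminf) auto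
    finally show "ennreal ((\<Sum>n<N. a n * x n)\<^sup>2) \<le> ennreal A * (\<Sum>n. ennreal (a n * (x n)\<^sup>2 / v n))" .
  qed
qed

text \<open>Here \<open>a j n\<close> is the Taylor matrix of the operator g |-> (1 - q z)^(-kappa)
  g(t / (1 - q z)): the image of z^n is t^n (1 - q z)^(-(kappa + n)), a binomial series. The content
  is the exchange of the sums over n and j.\<close>

lemma weighted_composition_coefficients:
  fixes c :: "nat \<Rightarrow> complex" and \<kappa> t :: real
  assumes \<kappa>: "0 < \<kappa>" and t: "0 < t" "t < 1"
    and sums: "\<And>z. cmod z < 1 \<Longrightarrow> (\<lambda>n. c n * z ^ n) sums g z"
  defines "q \<equiv> 1 - t"
  defines "a \<equiv> (\<lambda>j n. t ^ n * q ^ j * pochhammer (\<kappa> + real n) j / fact j)"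
  assumes z: "cmod z < 1"
  shows "(\<lambda>j. (\<Sum>n. c n * of_real (a j n)) * z ^ j) sums
           ((1 - of_real q * z) powr (- of_real \<kappa>) * g (of_real t / (1 - of_real q * z)))"
    and "summable (\<lambda>n. cmod (c n) * a j n)"
proof -
  have q: "0 < q" "q < 1" using t by (auto simp: q_def)
  have a0: "0 \<le> a j n" for j n
    using \<kappa> t q by (auto simp: a_def intro!: mult_nonneg_nonneg divide_nonneg_pos pochhammer_nonneg)
  \<comment> \<open>As the matrix is nonnegative, taking moduli amounts to evaluating at r = |w|.
    Summing over j first leaves a power series with coefficients |c n| at the point t / (1 - q r),
    which is below 1 because t = 1 - q.\<close>
  have key: "(\<lambda>p. norm (case p of (n, j) \<Rightarrow> c n * of_real (a j n) * w ^ j)) summable_on UNIV"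
      if w: "cmod w < 1" for w
  proof -
    define r where "r = cmod w"
    have r: "0 \<le> r" "r < 1" using w by (auto simp: r_def)
    have "q * r < q" using q r by simp
    then have qr: "0 \<le> q * r" "q * r < 1" "t < 1 - q * r"
    proof -
      have "t = 1 - q" by (simp add: q_def)
      with \<open>q * r < q\<close> q r show "0 \<le> q * r" "q * r < 1" "t < 1 - q * r" by (simp, linarith, linarith)
    qed
    have s1: "(\<lambda>j. norm (c n * of_real (a j n) * w ^ j)) sums
        (cmod (c n) * t ^ n * (1 - q * r) powr (- (\<kappa> + real n)))" for n
    proof -
      have "(\<lambda>j. (cmod (c n) * t ^ n) * (pochhammer (\<kappa> + real n) j / fact j * (q * r) ^ j)) sums
          ((cmod (c n) * t ^ n) * (1 - q * r) powr (- (\<kappa> + real n)))"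
        using qr by (intro sums_mult binomial_series_real) auto
      moreover have "norm (c n * of_real (a j n) * w ^ j) =
          (cmod (c n) * t ^ n) * (pochhammer (\<kappa> + real n) j / fact j * (q * r) ^ j)" for j
      proof -
        have "norm (c n * of_real (a j n) * w ^ j) = cmod (c n) * a j n * r ^ j"
          using a0[of j n] by (simp add: norm_mult norm_power r_def)
        then show ?thesis by (simp add: a_def power_mult_distrib mult_ac)
      qed
      ultimately show ?thesis by simp
    qed
    have s2: "summable (\<lambda>n. cmod (c n) * t ^ n * (1 - q * r) powr (- (\<kappa> + real n)))"
    proof -
      have "summable (\<lambda>n. cmod (c n) * (t / (1 - q * r)) ^ n)"
        using sums t qr by (intro power_series_summable_norm) (auto simp: sums_iff)
      then have "summable (\<lambda>n. (1 - q * r) powr (- \<kappa>) * (cmod (c n) * (t / (1 - q * r)) ^ n))"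
        by (rule summable_mult)
      moreover have "(1 - q * r) powr (- \<kappa>) * (cmod (c n) * (t / (1 - q * r)) ^ n) =
          cmod (c n) * t ^ n * (1 - q * r) powr (- (\<kappa> + real n))" for n
        using qr by (simp add: powr_diff powr_realpow power_divide)
      ultimately show ?thesis by simp
    qed
    have "(\<lambda>p. norm (case p of (n, j) \<Rightarrow> c n * of_real (a j n) * w ^ j)) summable_on (UNIV \<times> UNIV)"
    proof (subst Infinite_Sum.abs_summable_on_Sigma_iff, intro conjI ballI)
      fix n :: nat
      show "(\<lambda>j. norm (case (n, j) of (n, j) \<Rightarrow> c n * of_real (a j n) * w ^ j)) summable_on UNIV"
        using s1[of n] by (simp add: norm_summable_imp_summable_on sums_iff
            summable_on_UNIV_nonneg_real_iff)
    next
      have inf: "(\<Sum>\<^sub>\<infinity>j. norm (c n * of_real (a j n) * w ^ j)) =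
          cmod (c n) * t ^ n * (1 - q * r) powr (- (\<kappa> + real n))" for n
        by (intro infsumI sums_nonneg_imp_has_sum s1) auto
      show "(\<lambda>n. norm (\<Sum>\<^sub>\<infinity>j. norm (case (n, j) of (n, j) \<Rightarrow> c n * of_real
          (a j n) * w ^ j))) summable_on UNIV"
        unfolding prod.case inf using s2 t by (simp add: summable_on_UNIV_nonneg_real_iff)
    qed
    then show ?thesis by simp
  qed
  have "(\<lambda>(n, j). c n * of_real (a j n) * z ^ j) summable_on (UNIV \<times> UNIV)"
    using key[OF z] by (simp add: abs_summable_summable)
  note sw = this
  have qz: "cmod (complex_of_real q * z) < 1"
  proof -
    have "q * cmod z < q" using q z by simp
    moreover have "cmod (complex_of_real q * z) = q * cmod z" using q by (simp add: norm_mult)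
    ultimately show ?thesis using q by linarith
  qed
  have q1: "1 - complex_of_real q * z \<noteq> 0"
  proof
    assume "1 - complex_of_real q * z = 0"
    then have "complex_of_real q * z = 1" by simp
    with qz show False by simp
  qed
  have phi: "cmod (of_real t / (1 - of_real q * z)) < 1"
  proof -
    have "q * cmod z < q" using q z by simp
    moreover have "cmod (of_real q * z) = q * cmod z" using q by (simp add: norm_mult)
    moreover have "t = 1 - q" by (simp add: q_def)
    ultimately have "t < 1 - cmod (of_real q * z)" by linarith
    also have "\<dots> \<le> cmod (1 - of_real q * z)" using norm_triangle_ineq2[of 1 "of_real q * z"] by simp
    finally show ?thesis using t q1 by (simp add: norm_divide divide_less_eq)
  qed
  have inner1: "(\<Sum>\<^sub>\<infinity>j. c n * of_real (a j n) * z ^ j) =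
      (1 - of_real q * z) powr (- of_real \<kappa>) * (c n * (of_real t / (1 - of_real q * z)) ^ n)" for n
  proof -
    have "(\<lambda>j. (c n * of_real t ^ n) * (of_real (pochhammer (\<kappa> + real n) j / fact j)
        * (of_real q * z) ^ j)) sums
        ((c n * of_real t ^ n) * (1 - of_real q * z) powr (- of_real (\<kappa> + real n)))"
      using qz by (intro sums_mult binomial_series_complex)
    also have "(\<lambda>j. (c n * of_real t ^ n) * (of_real (pochhammer (\<kappa> + real n) j / fact j)
        * (of_real q * z) ^ j)) =
        (\<lambda>j. c n * of_real (a j n) * z ^ j)"
      by (simp add: a_def power_mult_distrib mult_ac)
    also have "(1 - of_real q * z) powr (- of_real (\<kappa> + real n)) =
        (1 - of_real q * z) powr (- of_real \<kappa>) / (1 - of_real q * z) ^ n"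
      using q1 powr_diff[of "1 - of_real q * z" "- of_real \<kappa>" "of_nat n"] by (simp add: powr_nat)
    finally have s: "(\<lambda>j. c n * of_real (a j n) * z ^ j) sums
        ((1 - of_real q * z) powr (- of_real \<kappa>) * (c n * (of_real t / (1 - of_real q * z)) ^ n))"
      by (simp add: power_divide mult_ac)
    have "(\<lambda>j. c n * of_real (a j n) * z ^ j) summable_on UNIV"
      using summable_on_SigmaD1[OF sw, of n] by simp
    from has_sum_imp_sums[OF has_sum_infsum[OF this]] s show ?thesis by (simp add: sums_unique2)
  qed
  have row: "(\<lambda>n. norm (c n * of_real (a j n) * w ^ j)) summable_on UNIV" if "cmod w < 1" for w j
  proof -
    have "(\<lambda>(j, n). norm (c n * of_real (a j n) * w ^ j)) summable_on (UNIV \<times> UNIV)"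
      using key[OF that] by (subst summable_on_swap) (simp add: case_prod_unfold)
    from summable_on_SigmaD1[OF this, of j] show ?thesis by simp
  qed
  show sm: "summable (\<lambda>n. cmod (c n) * a j n)" for j
  proof -
    \<comment> \<open>Any nonzero point of the disk serves: the factor |w|^j is constant along a row
      and can be divided out.\<close>
    define w :: complex where "w = 1 / 2"
    have w: "cmod w < 1" "cmod w ^ j \<noteq> 0" by (auto simp: w_def norm_divide)
    have "summable (\<lambda>n. norm (c n * of_real (a j n) * w ^ j))"
      using row[OF w(1), of j] by (rule summable_on_imp_summable)
    moreover have "norm (c n * of_real (a j n) * w ^ j) = cmod (c n) * a j n * cmod w ^ j" for n
      using a0[of j n] by (simp add: norm_mult norm_power)
    ultimately have s: "summable (\<lambda>n. cmod (c n) * a j n * cmod w ^ j / cmod w ^ j)"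
      by (intro summable_divide) (simp only:)
    have eq: "cmod (c n) * a j n * cmod w ^ j / cmod w ^ j = cmod (c n) * a j n" for n
      by (rule nonzero_mult_div_cancel_right[OF w(2)])
    show ?thesis using s unfolding eq .
  qed
  have inner2: "(\<Sum>\<^sub>\<infinity>n. c n * of_real (a j n) * z ^ j) = (\<Sum>n. c n * of_real (a j n)) * z ^ j" for j
  proof -
    have "summable (\<lambda>n. c n * of_real (a j n))"
      by (rule summable_norm_cancel) (use sm[of j] a0 in \<open>simp add: norm_mult\<close>)
    then have "(\<lambda>n. c n * of_real (a j n) * z ^ j) sums ((\<Sum>n. c n * of_real (a j n)) * z ^ j)"
      by (intro sums_mult2 summable_sums)
    moreover have "(\<lambda>n. c n * of_real (a j n) * z ^ j) summable_on UNIV"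
      using row[OF z, of j] by (rule abs_summable_summable)
    ultimately show ?thesis
      using has_sum_imp_sums[OF has_sum_infsum] by (metis sums_unique2)
  qed
  have "(\<Sum>\<^sub>\<infinity>j. (\<Sum>n. c n * of_real (a j n)) * z ^ j) = (\<Sum>\<^sub>\<infinity>n. \<Sum>\<^sub>\<infinity>j. c n * of_real (a j n) * z ^ j)"
    unfolding inner2[symmetric] by (rule infsum_swap_banach[OF sw, symmetric])
  also have "\<dots> = (1 - of_real q * z) powr (- of_real \<kappa>) * g (of_real t / (1 - of_real q * z))"
  proof -
    have "(\<lambda>n. \<Sum>\<^sub>\<infinity>j. c n * of_real (a j n) * z ^ j) summable_on UNIV"
      using summable_on_Sigma_banach[OF sw] by simp
    from has_sum_imp_sums[OF has_sum_infsum[OF this]]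
    have "(\<lambda>n. (1 - of_real q * z) powr (- of_real \<kappa>) * (c n * (of_real t / (1 - of_real q * z)) ^ n)) sums
       (\<Sum>\<^sub>\<infinity>n. \<Sum>\<^sub>\<infinity>j. c n * of_real (a j n) * z ^ j)" by (simp add: inner1)
    moreover have "(\<lambda>n. (1 - of_real q * z) powr (- of_real \<kappa>) * (c n
        * (of_real t / (1 - of_real q * z)) ^ n)) sums
       ((1 - of_real q * z) powr (- of_real \<kappa>) * g (of_real t / (1 - of_real q * z)))"
      by (intro sums_mult sums phi)
    ultimately show ?thesis by (rule sums_unique2)
  qed
  finally have tot: "(\<Sum>\<^sub>\<infinity>j. (\<Sum>n. c n * of_real (a j n)) * z ^ j) =
      (1 - of_real q * z) powr (- of_real \<kappa>) * g (of_real t / (1 - of_real q * z))" .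
  have "(\<lambda>(j, n). c n * of_real (a j n) * z ^ j) summable_on (UNIV \<times> UNIV)"
    using sw by (subst summable_on_swap) (simp add: case_prod_unfold)
  from summable_on_Sigma_banach[OF this]
  have "(\<lambda>j. \<Sum>\<^sub>\<infinity>n. c n * of_real (a j n) * z ^ j) summable_on UNIV" by simp
  then have "(\<lambda>j. (\<Sum>n. c n * of_real (a j n)) * z ^ j) summable_on UNIV" by (simp add: inner2)
  from has_sum_imp_sums[OF has_sum_infsum[OF this]]
  show "(\<lambda>j. (\<Sum>n. c n * of_real (a j n)) * z ^ j) sums
           ((1 - of_real q * z) powr (- of_real \<kappa>) * g (of_real t / (1 - of_real q * z)))"
    by (simp add: tot)
qed

text \<open>Schur's test. The weights \<open>v\<close>, the coefficients of (1 - z)^(-kappa), are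
  reproduced by the matrix up to the factor q^(-kappa), so Cauchy-Schwarz row by row and an exchange
  of nonnegative sums leave a diagonal form in the coefficients of g.\<close>

lemma weighted_composition_norm_le:
  fixes c :: "nat \<Rightarrow> complex" and \<kappa> t :: real
  assumes \<alpha>: "-1 < \<alpha>" and \<kappa>: "0 < \<kappa>" and t: "0 < t" "t < 1"
    and sums: "\<And>z. cmod z < 1 \<Longrightarrow> (\<lambda>n. c n * z ^ n) sums g z"
  defines "q \<equiv> 1 - t"
  shows "(\<integral>\<^sup>+z. ennreal ((cmod ((1 - of_real q * z) powr (- of_real \<kappa>) * g (of_real t / (1
      - of_real q * z))))\<^sup>2) \<partial>disk_measure \<alpha>)
    \<le> (\<Sum>n. ennreal ((cmod (c n))\<^sup>2 * fact n / pochhammer \<kappa> n) *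
          (\<Sum>j. ennreal (q powr (- \<kappa>) * t ^ n *
             (pochhammer \<kappa> j * pochhammer (\<kappa> + real n) j / (fact j * pochhammer (\<alpha> + 2) j) * q ^ j))))"
proof -
  have q: "0 < q" "q < 1" using t by (auto simp: q_def)
  define a where "a = (\<lambda>j n. t ^ n * q ^ j * pochhammer (\<kappa> + real n) j / fact j)"
  define v where "v n = pochhammer \<kappa> n / fact n" for n
  have v: "0 < v n" for n using \<kappa> by (auto simp: v_def pochhammer_pos)
  have a0: "0 \<le> a j n" for j n
    using \<kappa> t q by (auto simp: a_def intro!: mult_nonneg_nonneg divide_nonneg_pos pochhammer_nonneg)
  have coeff: "(\<lambda>j. (\<Sum>n. c n * of_real (a j n)) * z ^ j) sums
      ((1 - of_real q * z) powr (- of_real \<kappa>) * g (of_real t / (1 - of_real q * z)))" if "cmod z < 1" for z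
    using weighted_composition_coefficients(1)[OF \<kappa> t sums that] by (simp only: a_def q_def)
  have sm: "summable (\<lambda>n. cmod (c n) * a j n)" for j
    using weighted_composition_coefficients(2)[OF \<kappa> t sums, of 0] by (simp add: a_def q_def)
  \<comment> \<open>The eigenfunction relation: since 1 - t / (1 - q z) = q (1 - z) / (1 - q z), the
    operator sends (1 - z)^(-kappa) to q^(-kappa) (1 - z)^(-kappa). Coefficientwise it is a binomial
    series in t.\<close>
  have A: "(\<lambda>n. a j n * v n) sums (pochhammer \<kappa> j / fact j * q powr (- \<kappa>))" for j
  proof -
    have 1: "(\<lambda>n. (q ^ j * pochhammer \<kappa> j / fact j) * (pochhammer (\<kappa> + real j) n / fact n * t ^ n)) sums
       ((q ^ j * pochhammer \<kappa> j / fact j) * (1 - t) powr (- (\<kappa> + real j)))"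
      using t by (intro sums_mult binomial_series_real) auto
    have 2: "(q ^ j * pochhammer \<kappa> j / fact j) * (pochhammer (\<kappa> + real j) n / fact n * t ^ n) =
        a j n * v n" for n
    proof -
      have "pochhammer \<kappa> j * pochhammer (\<kappa> + real j) n = pochhammer \<kappa> n * pochhammer (\<kappa> + real n) j"
        using pochhammer_product'[of \<kappa> j n] pochhammer_product'[of \<kappa> n j] by (simp add: add.commute)
      then have "(q ^ j * t ^ n / (fact j * fact n)) * (pochhammer \<kappa> j * pochhammer (\<kappa> + real j) n) =
          (q ^ j * t ^ n / (fact j * fact n)) * (pochhammer \<kappa> n * pochhammer (\<kappa> + real n) j)" by simp
      then show ?thesis by (simp add: a_def v_def mult_ac)
    qed
    have "q ^ j * (1 - t) powr (- (\<kappa> + real j)) = q powr (- \<kappa>)"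
    proof -
      have "(1 - t) powr (- (\<kappa> + real j)) = q powr (- \<kappa> - real j)" by (simp add: q_def)
      also have "\<dots> = q powr (- \<kappa>) / q ^ j" using q by (simp add: powr_diff powr_realpow)
      finally show ?thesis using q by simp
    qed
    then have 3: "(q ^ j * pochhammer \<kappa> j / fact j) * (1 - t) powr (- (\<kappa> + real j)) =
        pochhammer \<kappa> j / fact j * q powr (- \<kappa>)"
      by (simp add: field_simps)
    show ?thesis using 1 unfolding 2 3 .
  qed
  have A0: "0 \<le> pochhammer \<kappa> j / fact j * q powr (- \<kappa>)" for j
    using \<kappa> by (auto intro!: mult_nonneg_nonneg divide_nonneg_pos pochhammer_nonneg)
  have N0: "0 \<le> fact j / pochhammer (\<alpha> + 2) j" for j
    using \<alpha> by (auto intro!: divide_nonneg_pos pochhammer_pos)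
  have d_le: "ennreal ((cmod (\<Sum>n. c n * of_real (a j n)))\<^sup>2) \<le>
      ennreal (pochhammer \<kappa> j / fact j * q powr (- \<kappa>)) * (\<Sum>n. ennreal (a j n * (cmod (c n))\<^sup>2 / v n))" for j
  proof -
    have "cmod (\<Sum>n. c n * of_real (a j n)) \<le> (\<Sum>n. norm (c n * of_real (a j n)))"
      using sm[of j] a0 by (intro summable_norm) (simp add: norm_mult)
    also have "\<dots> = (\<Sum>n. a j n * cmod (c n))" using a0 by (simp add: norm_mult mult.commute)
    finally have "ennreal ((cmod (\<Sum>n. c n * of_real (a j n)))\<^sup>2) \<le> ennreal ((\<Sum>n. a j n * cmod (c n))\<^sup>2)"
      by (intro ennreal_leI power_mono) auto
    also have "\<dots> \<le> ennreal (pochhammer \<kappa> j / fact j * q powr (- \<kappa>)) * (\<Sum>n. ennreal (a j n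
        * (cmod (c n))\<^sup>2 / v n))"
      using sm[of j] by (intro weighted_Cauchy_Schwarz_ennreal a0 v A) (auto simp: mult.commute)
    finally show ?thesis .
  qed
  have "(\<integral>\<^sup>+z. ennreal ((cmod ((1 - of_real q * z) powr (- of_real \<kappa>) * g (of_real t / (1
      - of_real q * z))))\<^sup>2) \<partial>disk_measure \<alpha>)
     = (\<Sum>j. ennreal ((cmod (\<Sum>n. c n * of_real (a j n)))\<^sup>2 * (fact j / pochhammer (\<alpha> + 2) j)))"
    by (rule power_series_disk_norm[OF \<alpha> coeff])
  also have "\<dots> \<le> (\<Sum>j. \<Sum>n. ennreal ((cmod (c n))\<^sup>2 * fact n / pochhammer \<kappa> n) * ennreal (q powr
      (- \<kappa>) * t ^ n *
             (pochhammer \<kappa> j * pochhammer (\<kappa> + real n) j / (fact j * pochhammer (\<alpha> + 2) j) * q ^ j)))"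
  proof (intro suminf_le allI)
    fix j
    have "ennreal ((cmod (\<Sum>n. c n * of_real (a j n)))\<^sup>2 * (fact j / pochhammer (\<alpha> + 2) j)) \<le>
      (ennreal (pochhammer \<kappa> j / fact j * q powr (- \<kappa>)) * (\<Sum>n. ennreal (a j n * (cmod (c n))\<^sup>2 / v n))) *
       ennreal (fact j / pochhammer (\<alpha> + 2) j)"
      using N0[of j] d_le[of j] by (subst ennreal_mult) (auto intro!: mult_right_mono)
    also have "\<dots> = (\<Sum>n. (ennreal (fact j / pochhammer (\<alpha>
        + 2) j) * ennreal (pochhammer \<kappa> j / fact j * q powr (- \<kappa>))) *
         ennreal (a j n * (cmod (c n))\<^sup>2 / v n))"
      by (simp add: mult_ac)
    also have "\<dots> = (\<Sum>n. ennreal ((cmod (c n))\<^sup>2 * fact n / pochhammer \<kappa> n) * ennreal (q powr (- \<kappa>) * t ^ n *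
             (pochhammer \<kappa> j * pochhammer (\<kappa> + real n) j / (fact j * pochhammer (\<alpha> + 2) j) * q ^ j)))"
    proof (intro suminf_cong)
      fix n
      have p: "pochhammer \<kappa> n > 0" "pochhammer (\<kappa> + real n) j > 0" "pochhammer (\<alpha>
          + 2) j > 0" "pochhammer \<kappa> j > 0"
        using \<kappa> \<alpha> by (auto intro!: pochhammer_pos)
      have "(ennreal (fact j / pochhammer (\<alpha> + 2) j) * ennreal (pochhammer \<kappa> j / fact j * q powr (- \<kappa>))) *
         ennreal (a j n * (cmod (c n))\<^sup>2 / v n) =
             ennreal ((fact j / pochhammer (\<alpha> + 2) j * (pochhammer \<kappa> j / fact j * q powr (- \<kappa>))) *
         (a j n * (cmod (c n))\<^sup>2 / v n))"
        using N0[of j] A0[of j] by (simp only: ennreal_mult'[symmetric] mult_nonneg_nonneg)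
      also have "(fact j / pochhammer (\<alpha> + 2) j * (pochhammer \<kappa> j / fact j * q powr (- \<kappa>))) *
         (a j n * (cmod (c n))\<^sup>2 / v n) = ((cmod (c n))\<^sup>2 * fact n / pochhammer \<kappa> n)
             * (q powr (- \<kappa>) * t ^ n *
             (pochhammer \<kappa> j * pochhammer (\<kappa> + real n) j / (fact j * pochhammer (\<alpha> + 2) j) * q ^ j))"
        using p by (simp add: a_def v_def field_simps)
      also have "ennreal \<dots> = ennreal ((cmod (c n))\<^sup>2 * fact n / pochhammer \<kappa> n) * ennreal (q powr
          (- \<kappa>) * t ^ n *
             (pochhammer \<kappa> j * pochhammer (\<kappa> + real n) j / (fact j * pochhammer (\<alpha> + 2) j) * q ^ j))"
        using p by (intro ennreal_mult') (auto intro!: divide_nonneg_pos)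
      finally show "(ennreal (fact j / pochhammer (\<alpha>
          + 2) j) * ennreal (pochhammer \<kappa> j / fact j * q powr (- \<kappa>))) *
         ennreal (a j n * (cmod (c n))\<^sup>2 / v n) =
             ennreal ((cmod (c n))\<^sup>2 * fact n / pochhammer \<kappa> n) * ennreal (q powr (- \<kappa>) * t ^ n *
             (pochhammer \<kappa> j * pochhammer (\<kappa> + real n) j / (fact j * pochhammer (\<alpha> + 2) j) * q ^ j))" .
    qed
    finally show "ennreal ((cmod (\<Sum>n. c n * of_real (a j n)))\<^sup>2 * (fact j / pochhammer (\<alpha> + 2) j)) \<le>
      (\<Sum>n. ennreal ((cmod (c n))\<^sup>2 * fact n / pochhammer \<kappa> n) * ennreal (q powr (- \<kappa>) * t ^ n *
             (pochhammer \<kappa> j * pochhammer (\<kappa> + real n) j / (fact j * pochhammer (\<alpha> + 2) j) * q ^ j)))" .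
  qed auto
  finally show ?thesis by (subst (asm) suminf_swap_ennreal) simp
qed

section \<open>Inequalities for the Beta function\<close>

text \<open>Gamma is log-convex, hence so is Gamma x * Gamma (M - x), which therefore lies below its
  chord. At integer arguments the end values are products of factorials, so a Gamma product is
  replaced by a linear polynomial.\<close>

lemma Gamma_product_chord:
  fixes x M :: real
  assumes i: "0 < i" "i + 1 < M" and x: "i \<le> x" "x \<le> i + 1"
  shows "Gamma x * Gamma (M - x) \<le> (i + 1 - x) * (Gamma i * Gamma (M - i)) + (x - i) * (Gamma (i
      + 1) * Gamma (M - i - 1))"
proof -
  define l where "l = x - i"
  have l: "0 \<le> l" "l \<le> 1" using x by (auto simp: l_def)
  define f where "f y = ln (Gamma y) + ln (Gamma (M - y))" for y :: real
  have fexp: "exp (f y) = Gamma y * Gamma (M - y)" if "0 < y" "y < M" for y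
    using that by (simp add: f_def exp_add Gamma_real_pos)
  have 1: "ln (Gamma x) \<le> (1 - l) * ln (Gamma i) + l * ln (Gamma (i + 1))"
    using convex_onD[OF log_convex_Gamma_real, of l i "i + 1"] l i by (simp add: l_def algebra_simps)
  have 2: "ln (Gamma (M - x)) \<le> (1 - l) * ln (Gamma (M - i)) + l * ln (Gamma (M - i - 1))"
    using convex_onD[OF log_convex_Gamma_real, of l "M - i" "M - i - 1"] l i
        by (simp add: l_def algebra_simps)
  have "f x \<le> (1 - l) * f i + l * f (i + 1)"
    using 1 2 by (simp add: f_def algebra_simps)
  then have "exp (f x) \<le> exp ((1 - l) * f i + l * f (i + 1))" by simp
  also have "\<dots> \<le> (1 - l) * exp (f i) + l * exp (f (i + 1))"
    using convex_onD[OF exp_convex, of l "f i" "f (i + 1)"] l by simp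
  finally show ?thesis
    using fexp[of x] fexp[of i] fexp[of "i + 1"] i x by (simp add: l_def algebra_simps)
qed

lemma Gamma_add_nat:
  fixes x :: real
  assumes "0 < x"
  shows "Gamma (x + real n) = pochhammer x n * Gamma x"
proof -
  have "x \<notin> \<int>\<^sub>\<le>\<^sub>0" using assms by (auto dest: nonpos_Ints_nonpos)
  then have "pochhammer x n = Gamma (x + real n) / Gamma x" by (rule pochhammer_Gamma)
  moreover have "Gamma x > 0" using assms by (rule Gamma_real_pos)
  ultimately show ?thesis by simp
qed

lemma Gamma_reflection_real_pi:
  fixes x :: real
  shows "Gamma x * Gamma (1 - x) = pi / sin (pi * x)"
proof -
  have "complex_of_real (Gamma x * Gamma (1 - x)) = Gamma (of_real x) * Gamma (of_real (1 - x))"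
    by (simp only: of_real_mult Gamma_complex_of_real)
  also have "\<dots> = Gamma (complex_of_real x) * Gamma (1 - complex_of_real x)" by simp
  also have "\<dots> = of_real pi / sin (of_real pi * complex_of_real x)" by (rule Gamma_reflection_complex)
  also have "\<dots> = of_real (pi / sin (pi * x))"
    by (simp only: of_real_mult[symmetric] sin_of_real of_real_divide)
  finally show ?thesis by (simp only: of_real_eq_iff)
qed

text \<open>Reflection together with sin y <= y. It trades the transcendental Gamma x * Gamma (1 -
  x) for 1 / x in the criteria below.\<close>

lemma Gamma_reflection_lower:
  fixes x :: real
  assumes "0 < x" "x < 1"
  shows "1 \<le> x * (Gamma x * Gamma (1 - x))"
proof -
  have s: "0 < sin (pi * x)" using assms by (intro sin_gt_zero) auto
  have "sin (pi * x) \<le> pi * x" using assms by (intro sin_x_le_x) auto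
  then show ?thesis
    unfolding Gamma_reflection_real_pi using s by (simp add: le_divide_eq mult.commute)
qed

text \<open>In the application epsilon = 1 - a, k = s - m and delta = m + a - 1 - k. Shifts by
  integers turn all other Gamma quotients into Pochhammer symbols, leaving Gamma delta * Gamma (m -
  delta) against Gamma epsilon * Gamma (1 - epsilon), and the latter is bounded below by 1 /
  epsilon.\<close>

lemma Beta_criterion_1:
  fixes m :: nat and \<epsilon> :: real
  assumes m: "2 \<le> m" and \<epsilon>: "0 < \<epsilon>" "\<epsilon> < 1"
  defines "k \<equiv> real m - 2 * real m * \<epsilon>" and "\<delta> \<equiv> (2 * real m - 1) * \<epsilon>"
  assumes k: "0 < k" and \<delta>: "\<delta> < real m"
    and le: "Gamma \<delta> * Gamma (real m - \<delta>) * pochhammer (k + 1) (m - 1) * \<epsilon> \<le>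
        fact (m - 1) * pochhammer (1 - \<epsilon>) (m - 1)"
  shows "Beta \<delta> k * Beta (1 - \<epsilon>) (k + \<epsilon>) \<le> Beta (1 - \<epsilon>) \<epsilon> * Beta (real m) k"
proof -
  have \<delta>0: "0 < \<delta>" using m \<epsilon> by (auto simp: \<delta>_def)
  have pos: "Gamma \<delta> > 0" "Gamma k > 0" "Gamma (real m - \<epsilon>) > 0" "Gamma (1 - \<epsilon>) > 0" "Gamma (k + 1) > 0"
     "Gamma \<epsilon> > 0" "Gamma (real m + k) > 0" "Gamma (real m - \<delta>) > 0"
    using m \<epsilon> k \<delta> \<delta>0 by (auto intro!: Gamma_real_pos)
  have P1: "Gamma (real m + k) = pochhammer (k + 1) (m - 1) * Gamma (k + 1)"
    using k m Gamma_add_nat[of "k + 1" "m - 1"] by (simp add: of_nat_diff add_ac)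
  have P2: "Gamma (real m - \<epsilon>) = pochhammer (1 - \<epsilon>) (m - 1) * Gamma (1 - \<epsilon>)"
    using \<epsilon> m Gamma_add_nat[of "1 - \<epsilon>" "m - 1"] by (simp add: of_nat_diff algebra_simps)
  have P3: "Gamma (real m) = fact (m - 1)"
    using Gamma_fact[of "m - 1", where 'a = real] m by (simp add: of_nat_diff)
  have e1: "\<delta> + k = real m - \<epsilon>" "1 - \<epsilon> + (k + \<epsilon>) = k + 1" "k + \<epsilon> = real m - \<delta>"
    by (auto simp: k_def \<delta>_def algebra_simps)
  have pp: "pochhammer (1 - \<epsilon>) (m - 1) > 0" "pochhammer (k + 1) (m - 1) > 0"
    using \<epsilon> k by (auto intro!: pochhammer_pos)
  have "Gamma \<delta> * Gamma (real m - \<delta>) * pochhammer (k + 1) (m - 1)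
      \<le> Gamma \<delta> * Gamma (real m - \<delta>) * pochhammer (k + 1) (m - 1) * (\<epsilon> * (Gamma \<epsilon> * Gamma (1 - \<epsilon>)))"
    using mult_left_mono[OF Gamma_reflection_lower[OF \<epsilon>], of "Gamma \<delta> * Gamma (real m - \<delta>) * pochhammer (k
        + 1) (m - 1)"] pos pp
    by simp
  also have "\<dots> = (Gamma \<delta> * Gamma (real m - \<delta>) * pochhammer (k + 1) (m - 1) * \<epsilon>)
      * (Gamma \<epsilon> * Gamma (1 - \<epsilon>))"
    by simp
  also have "\<dots> \<le> (fact (m - 1) * pochhammer (1 - \<epsilon>) (m - 1)) * (Gamma \<epsilon> * Gamma (1 - \<epsilon>))"
    using pos by (intro mult_right_mono le) auto
  finally have main: "Gamma \<delta> * Gamma (real m - \<delta>) * pochhammer (k + 1) (m - 1) \<le>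
      fact (m - 1) * (Gamma (real m - \<epsilon>) * Gamma \<epsilon>)"
    unfolding P2 by (simp add: mult_ac)
  have L: "Beta \<delta> k * Beta (1 - \<epsilon>) (k + \<epsilon>) =
     (Gamma \<delta> * Gamma (real m - \<delta>) * pochhammer (k + 1) (m - 1)) *
     (Gamma k * Gamma (1 - \<epsilon>) / (Gamma (real m - \<epsilon>) * Gamma (real m + k)))"
    unfolding Beta_def e1(1,2) unfolding e1(3) P1 using pos pp by (simp add: field_simps)
  have R: "Beta (1 - \<epsilon>) \<epsilon> * Beta (real m) k =
     (fact (m - 1) * (Gamma (real m - \<epsilon>) * Gamma \<epsilon>)) *
     (Gamma k * Gamma (1 - \<epsilon>) / (Gamma (real m - \<epsilon>) * Gamma (real m + k)))"
    unfolding Beta_def P3 using pos by (simp add: field_simps)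
  show ?thesis
    unfolding L R using pos by (intro mult_right_mono main) auto
qed

text \<open>The same reduction for the other majorant. Here the product Gamma (1 + delta) * Gamma (m
  - 1 - delta) stays bounded as delta tends to 0, where the first criterion has a pole; in exchange
  it blows up as delta tends to m - 1.\<close>

lemma Beta_criterion_2:
  fixes m :: nat and \<epsilon> :: real
  assumes m: "2 \<le> m" and \<epsilon>: "0 < \<epsilon>" "\<epsilon> < 1"
  defines "k \<equiv> real m - 2 * real m * \<epsilon>" and "\<delta> \<equiv> (2 * real m - 1) * \<epsilon>"
  assumes k: "0 < k" and \<delta>: "\<delta> < real m - 1"
    and le: "Gamma (1 + \<delta>) * Gamma (real m - 1 - \<delta>) * pochhammer k m * \<epsilon> \<le>
        fact (m - 1) * pochhammer (1 - \<epsilon>) m"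
  shows "Beta (1 + \<delta>) (real m - 1 - \<delta>) * Beta (1 - \<epsilon>) (real m) \<le> Beta (1 - \<epsilon>) \<epsilon> * Beta (real m) k"
proof -
  have \<delta>0: "0 < \<delta>" using m \<epsilon> by (auto simp: \<delta>_def)
  have pos: "Gamma (1 + \<delta>) > 0" "Gamma k > 0" "Gamma (real m + 1 - \<epsilon>) > 0" "Gamma (1 - \<epsilon>) > 0"
     "Gamma \<epsilon> > 0" "Gamma (real m + k) > 0" "Gamma (real m - 1 - \<delta>) > 0" "Gamma (real m) > 0"
    using m \<epsilon> k \<delta> \<delta>0 by (auto intro!: Gamma_real_pos)
  have P1: "Gamma (real m + k) = pochhammer k m * Gamma k"
    using k Gamma_add_nat[of k m] by (simp add: add_ac)
  have P2: "Gamma (real m + 1 - \<epsilon>) = pochhammer (1 - \<epsilon>) m * Gamma (1 - \<epsilon>)"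
    using \<epsilon> Gamma_add_nat[of "1 - \<epsilon>" m] by (simp add: algebra_simps)
  have P3: "Gamma (real m) = fact (m - 1)"
    using Gamma_fact[of "m - 1", where 'a = real] m by (simp add: of_nat_diff)
  have e1: "1 + \<delta> + (real m - 1 - \<delta>) = real m" "1 - \<epsilon> + real m = real m + 1 - \<epsilon>"
    by auto
  have pp: "pochhammer (1 - \<epsilon>) m > 0" "pochhammer k m > 0"
    using \<epsilon> k by (auto intro!: pochhammer_pos)
  have "Gamma (1 + \<delta>) * Gamma (real m - 1 - \<delta>) * pochhammer k m
      \<le> Gamma (1 + \<delta>) * Gamma (real m - 1 - \<delta>) * pochhammer k m * (\<epsilon> * (Gamma \<epsilon> * Gamma (1 - \<epsilon>)))"
    using mult_left_mono[OF Gamma_reflection_lower[OF \<epsilon>], of "Gamma (1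
        + \<delta>) * Gamma (real m - 1 - \<delta>) * pochhammer k m"] pos pp
    by simp
  also have "\<dots> = (Gamma (1 + \<delta>) * Gamma (real m - 1 - \<delta>) * pochhammer k m * \<epsilon>) * (Gamma \<epsilon> * Gamma (1 - \<epsilon>))"
    by simp
  also have "\<dots> \<le> (fact (m - 1) * pochhammer (1 - \<epsilon>) m) * (Gamma \<epsilon> * Gamma (1 - \<epsilon>))"
    using pos by (intro mult_right_mono le) auto
  finally have main: "Gamma (1 + \<delta>) * Gamma (real m - 1 - \<delta>) * pochhammer k m \<le>
      Gamma (real m) * (Gamma (real m + 1 - \<epsilon>) * Gamma \<epsilon>)"
    unfolding P2 P3 by (simp add: mult_ac)
  have L: "Beta (1 + \<delta>) (real m - 1 - \<delta>) * Beta (1 - \<epsilon>) (real m) =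
     (Gamma (1 + \<delta>) * Gamma (real m - 1 - \<delta>) * pochhammer k m) *
     (Gamma k * Gamma (1 - \<epsilon>) / (Gamma (real m + 1 - \<epsilon>) * Gamma (real m + k)))"
    unfolding Beta_def e1 P1 using pos pp by (simp add: field_simps)
  have R: "Beta (1 - \<epsilon>) \<epsilon> * Beta (real m) k =
     (Gamma (real m) * (Gamma (real m + 1 - \<epsilon>) * Gamma \<epsilon>)) *
     (Gamma k * Gamma (1 - \<epsilon>) / (Gamma (real m + 1 - \<epsilon>) * Gamma (real m + k)))"
    unfolding Beta_def using pos by (simp add: field_simps)
  show ?thesis
    unfolding L R using pos by (intro mult_right_mono main) auto
qed

section \<open>Polynomial inequalities behind the Beta criteria\<close>

lemma le_if_scaled_diff_nonneg:
  fixes A B c :: real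
  shows "0 \<le> c * (A - B) \<Longrightarrow> 0 < c \<Longrightarrow> B \<le> A"
  by (simp add: zero_le_mult_iff)

lemma pochhammer_small:
  fixes x :: "'a :: comm_semiring_1"
  shows "pochhammer x 2 = x * (x + 1)" "pochhammer x 3 = x * (x + 1) * (x + 2)"
    "pochhammer x 4 = x * (x + 1) * (x + 2) * (x + 3)"
    "pochhammer x 5 = x * (x + 1) * (x + 2) * (x + 3) * (x + 4)"
  by (simp_all add: eval_nat_numeral pochhammer_Suc add_ac)

text \<open>
  In each bound \<open>\<delta> = (2 m - 1) e\<close> runs through one interval between consecutive integers, and
  the leading factor is the chord over that interval provided by \<open>Gamma_product_chord\<close>. The
  polynomial inequality is read off from nonnegative coefficients in the Bernstein basis of the
  interval.
\<close>

lemma pochhammer_bound_3_0: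
  fixes e :: real
  assumes "0 \<le> 5 * e" "5 * e \<le> 1"
  shows "1 * pochhammer (3 - 6 * e) 3 * e \<le> 2 * pochhammer (1 - e) 3"
proof -
  have "625 * (2 * pochhammer (1 - e) 3 - 1 * pochhammer (3 - 6 * e) 3 * e) =
      7500 * (5 * e) ^ 0 * (1 - 5 * e) ^ 4
      + 19750 * (5 * e) ^ 1 * (1 - 5 * e) ^ 3
      + 21600 * (5 * e) ^ 2 * (1 - 5 * e) ^ 2
      + 11780 * (5 * e) ^ 3 * (1 - 5 * e) ^ 1
      + 2646 * (5 * e) ^ 4 * (1 - 5 * e) ^ 0"
    unfolding pochhammer_small by algebra
  also have "\<dots> \<ge> 0"
    using assms by (intro add_nonneg_nonneg mult_nonneg_nonneg zero_le_power) auto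
  finally show ?thesis by (rule le_if_scaled_diff_nonneg) simp
qed

lemma pochhammer_bound_3_1:
  fixes e :: real
  assumes "1 \<le> 5 * e" "5 * e \<le> 2"
  shows "1 * pochhammer (4 - 6 * e) 2 * e \<le> 2 * pochhammer (1 - e) 2"
proof -
  have "125 * (2 * pochhammer (1 - e) 2 - 1 * pochhammer (4 - 6 * e) 2 * e) =
      94 * (5 * e - 1) ^ 0 * (2 - 5 * e) ^ 3
      + 84 * (5 * e - 1) ^ 1 * (2 - 5 * e) ^ 2
      + 58 * (5 * e - 1) ^ 2 * (2 - 5 * e) ^ 1
      + 32 * (5 * e - 1) ^ 3 * (2 - 5 * e) ^ 0"
    unfolding pochhammer_small by algebra
  also have "\<dots> \<ge> 0"
    using assms by (intro add_nonneg_nonneg mult_nonneg_nonneg zero_le_power) auto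
  finally show ?thesis by (rule le_if_scaled_diff_nonneg) simp
qed

lemma pochhammer_bound_4_0:
  fixes e :: real
  assumes "0 \<le> 7 * e" "7 * e \<le> 1"
  shows "(2 - (7 * e)) * pochhammer (4 - 8 * e) 4 * e \<le> 6 * pochhammer (1 - e) 4"
proof -
  have "16807 * (6 * pochhammer (1 - e) 4 - (2 - (7 * e)) * pochhammer (4 - 8 * e) 4 * e) =
      2420208 * (7 * e) ^ 0 * (1 - 7 * e) ^ 6
      + 9767268 * (7 * e) ^ 1 * (1 - 7 * e) ^ 5
      + 18123434 * (7 * e) ^ 2 * (1 - 7 * e) ^ 4
      + 20348916 * (7 * e) ^ 3 * (1 - 7 * e) ^ 3
      + 14394786 * (7 * e) ^ 4 * (1 - 7 * e) ^ 2
      + 5834428 * (7 * e) ^ 5 * (1 - 7 * e) ^ 1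
      + 1016280 * (7 * e) ^ 6 * (1 - 7 * e) ^ 0"
    unfolding pochhammer_small by algebra
  also have "\<dots> \<ge> 0"
    using assms by (intro add_nonneg_nonneg mult_nonneg_nonneg zero_le_power) auto
  finally show ?thesis by (rule le_if_scaled_diff_nonneg) simp
qed

lemma pochhammer_bound_4_1:
  fixes e :: real
  assumes "1 \<le> 7 * e" "7 * e \<le> 2"
  shows "(7 * e) * pochhammer (4 - 8 * e) 4 * e \<le> 6 * pochhammer (1 - e) 4"
proof -
  have "16807 * (6 * pochhammer (1 - e) 4 - (7 * e) * pochhammer (4 - 8 * e) 4 * e) =
      1016280 * (7 * e - 1) ^ 0 * (2 - 7 * e) ^ 6
      + 4855412 * (7 * e - 1) ^ 1 * (2 - 7 * e) ^ 5
      + 9690474 * (7 * e - 1) ^ 2 * (2 - 7 * e) ^ 4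
      + 10742460 * (7 * e - 1) ^ 3 * (2 - 7 * e) ^ 3
      + 7165954 * (7 * e - 1) ^ 4 * (2 - 7 * e) ^ 2
      + 2741316 * (7 * e - 1) ^ 5 * (2 - 7 * e) ^ 1
      + 462384 * (7 * e - 1) ^ 6 * (2 - 7 * e) ^ 0"
    unfolding pochhammer_small by algebra
  also have "\<dots> \<ge> 0"
    using assms by (intro add_nonneg_nonneg mult_nonneg_nonneg zero_le_power) auto
  finally show ?thesis by (rule le_if_scaled_diff_nonneg) simp
qed

lemma pochhammer_bound_4_2:
  fixes e :: real
  assumes "2 \<le> 7 * e" "7 * e \<le> 3"
  shows "((7 * e) - 1) * pochhammer (5 - 8 * e) 3 * e \<le> 6 * pochhammer (1 - e) 3"
proof -
  have "2401 * (6 * pochhammer (1 - e) 3 - ((7 * e) - 1) * pochhammer (5 - 8 * e) 3 * e) =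
      15276 * (7 * e - 2) ^ 0 * (3 - 7 * e) ^ 5
      + 43052 * (7 * e - 2) ^ 1 * (3 - 7 * e) ^ 4
      + 42170 * (7 * e - 2) ^ 2 * (3 - 7 * e) ^ 3
      + 22796 * (7 * e - 2) ^ 3 * (3 - 7 * e) ^ 2
      + 11454 * (7 * e - 2) ^ 4 * (3 - 7 * e) ^ 1
      + 3564 * (7 * e - 2) ^ 5 * (3 - 7 * e) ^ 0"
    unfolding pochhammer_small by algebra
  also have "\<dots> \<ge> 0"
    using assms by (intro add_nonneg_nonneg mult_nonneg_nonneg zero_le_power) auto
  finally show ?thesis by (rule le_if_scaled_diff_nonneg) simp
qed

lemma pochhammer_bound_5_0:
  fixes e :: real
  assumes "0 \<le> 9 * e" "9 * e \<le> 1"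
  shows "(6 - 4 * (9 * e)) * pochhammer (5 - 10 * e) 5 * e \<le> 24 * pochhammer (1 - e) 5"
proof -
  have "531441 * (24 * pochhammer (1 - e) 5 - (6 - 4 * (9 * e)) * pochhammer (5 - 10 * e) 5 * e) =
      1530550080 * (9 * e) ^ 0 * (1 - 9 * e) ^ 7
      + 4968619056 * (9 * e) ^ 1 * (1 - 9 * e) ^ 6
      + 5714998416 * (9 * e) ^ 2 * (1 - 9 * e) ^ 5
      + 3200368320 * (9 * e) ^ 3 * (1 - 9 * e) ^ 4
      + 2659926600 * (9 * e) ^ 4 * (1 - 9 * e) ^ 3
      + 3363779664 * (9 * e) ^ 5 * (1 - 9 * e) ^ 2
      + 2085324504 * (9 * e) ^ 6 * (1 - 9 * e) ^ 1
      + 457632560 * (9 * e) ^ 7 * (1 - 9 * e) ^ 0"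
    unfolding pochhammer_small by algebra
  also have "\<dots> \<ge> 0"
    using assms by (intro add_nonneg_nonneg mult_nonneg_nonneg zero_le_power) auto
  finally show ?thesis by (rule le_if_scaled_diff_nonneg) simp
qed

lemma pochhammer_bound_5_1:
  fixes e :: real
  assumes "1 \<le> 9 * e" "9 * e \<le> 2"
  shows "2 * pochhammer (5 - 10 * e) 5 * e \<le> 24 * pochhammer (1 - e) 5"
proof -
  have "531441 * (24 * pochhammer (1 - e) 5 - 2 * pochhammer (5 - 10 * e) 5 * e) =
      457632560 * (9 * e - 1) ^ 0 * (2 - 9 * e) ^ 6
      + 2426733816 * (9 * e - 1) ^ 1 * (2 - 9 * e) ^ 5
      + 5736760680 * (9 * e - 1) ^ 2 * (2 - 9 * e) ^ 4
      + 7601478080 * (9 * e - 1) ^ 3 * (2 - 9 * e) ^ 3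
      + 5836818000 * (9 * e - 1) ^ 4 * (2 - 9 * e) ^ 2
      + 2423270544 * (9 * e - 1) ^ 5 * (2 - 9 * e) ^ 1
      + 420471200 * (9 * e - 1) ^ 6 * (2 - 9 * e) ^ 0"
    unfolding pochhammer_small by algebra
  also have "\<dots> \<ge> 0"
    using assms by (intro add_nonneg_nonneg mult_nonneg_nonneg zero_le_power) auto
  finally show ?thesis by (rule le_if_scaled_diff_nonneg) simp
qed

lemma pochhammer_bound_5_2:
  fixes e :: real
  assumes "2 \<le> 9 * e" "9 * e \<le> 3"
  shows "(4 * (9 * e) - 6) * pochhammer (5 - 10 * e) 5 * e \<le> 24 * pochhammer (1 - e) 5"
proof -
  have "531441 * (24 * pochhammer (1 - e) 5 - (4 * (9 * e) - 6) * pochhammer (5 - 10 * e) 5 * e) =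
      420471200 * (9 * e - 2) ^ 0 * (3 - 9 * e) ^ 7
      + 2115362256 * (9 * e - 2) ^ 1 * (3 - 9 * e) ^ 6
      + 4615962336 * (9 * e - 2) ^ 2 * (3 - 9 * e) ^ 5
      + 5989070880 * (9 * e - 2) ^ 3 * (3 - 9 * e) ^ 4
      + 5262560280 * (9 * e - 2) ^ 4 * (3 - 9 * e) ^ 3
      + 3163580064 * (9 * e - 2) ^ 5 * (3 - 9 * e) ^ 2
      + 1157226264 * (9 * e - 2) ^ 6 * (3 - 9 * e) ^ 1
      + 188606880 * (9 * e - 2) ^ 7 * (3 - 9 * e) ^ 0"
    unfolding pochhammer_small by algebra
  also have "\<dots> \<ge> 0"
    using assms by (intro add_nonneg_nonneg mult_nonneg_nonneg zero_le_power) auto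
  finally show ?thesis by (rule le_if_scaled_diff_nonneg) simp
qed

lemma pochhammer_bound_5_3:
  fixes e :: real
  assumes "3 \<le> 9 * e" "9 * e \<le> 4"
  shows "(4 * (9 * e) - 10) * pochhammer (6 - 10 * e) 4 * e \<le> 24 * pochhammer (1 - e) 4"
proof -
  have "59049 * (24 * pochhammer (1 - e) 4 - (4 * (9 * e) - 10) * pochhammer (6 - 10 * e) 4 * e) =
      5217696 * (9 * e - 3) ^ 0 * (4 - 9 * e) ^ 9
      + 30253176 * (9 * e - 3) ^ 1 * (4 - 9 * e) ^ 8
      + 70315560 * (9 * e - 3) ^ 2 * (4 - 9 * e) ^ 7
      + 80590608 * (9 * e - 3) ^ 3 * (4 - 9 * e) ^ 6
      + 42411264 * (9 * e - 3) ^ 4 * (4 - 9 * e) ^ 5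
      + 4409176 * (9 * e - 3) ^ 5 * (4 - 9 * e) ^ 4
      + 143016 * (9 * e - 3) ^ 6 * (4 - 9 * e) ^ 3
      + 6602400 * (9 * e - 3) ^ 7 * (4 - 9 * e) ^ 2
      + 4757008 * (9 * e - 3) ^ 8 * (4 - 9 * e) ^ 1
      + 989184 * (9 * e - 3) ^ 9 * (4 - 9 * e) ^ 0"
    unfolding pochhammer_small by algebra
  also have "\<dots> \<ge> 0"
    using assms by (intro add_nonneg_nonneg mult_nonneg_nonneg zero_le_power) auto
  finally show ?thesis by (rule le_if_scaled_diff_nonneg) simp
qed

text \<open>In the application delta < m - 1 means k > a. For m = 2 the first criterion works
  throughout; for m = 3, 4, 5 the second one is used up to delta = m - 2 and the first on the last
  unit interval.\<close>

lemma Beta_criterion: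
  fixes m :: nat and \<epsilon> :: real
  assumes m: "m \<in> {2, 3, 4, 5}" and \<epsilon>: "0 < \<epsilon>" "\<epsilon> < 1"
  defines "k \<equiv> real m - 2 * real m * \<epsilon>" and "\<delta> \<equiv> (2 * real m - 1) * \<epsilon>"
  assumes \<delta>: "\<delta> < real m - 1"
  shows "Beta \<delta> k * Beta (1 - \<epsilon>) (k + \<epsilon>) \<le> Beta (1 - \<epsilon>) \<epsilon> * Beta (real m) k \<or>
    Beta (1 + \<delta>) (real m - 1 - \<delta>) * Beta (1 - \<epsilon>) (real m) \<le> Beta (1 - \<epsilon>) \<epsilon> * Beta (real m) k"
proof -
  have k: "0 < k" using \<delta> \<epsilon> by (simp add: k_def \<delta>_def algebra_simps)
  have m2: "2 \<le> m" and \<delta>0: "0 < \<delta>" using m \<epsilon> by (auto simp: \<delta>_def)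
  have G: "Gamma 2 = (1::real)" "Gamma 3 = (2::real)" "Gamma 4 = (6::real)"
    using Gamma_fact[of 1, where 'a = real] Gamma_fact[of 2, where 'a = real] Gamma_fact[of 3, where 'a =
        real] by (simp_all add: fact_numeral)
  have R2: ?thesis if "Gamma \<delta> * Gamma (real m - \<delta>) \<le> C"
      "C * pochhammer (k + 1) (m - 1) * \<epsilon> \<le> fact (m - 1) * pochhammer (1 - \<epsilon>) (m - 1)" for C
  proof -
    have "Gamma \<delta> * Gamma (real m - \<delta>) * pochhammer (k + 1) (m - 1) * \<epsilon> \<le>
        C * pochhammer (k + 1) (m - 1) * \<epsilon>"
      using that(1) k \<epsilon> by (intro mult_right_mono) (auto intro!: pochhammer_nonneg)
    also note that(2)
    finally show ?thesis
      using Beta_criterion_1[OF m2 \<epsilon>, folded k_def \<delta>_def] k \<delta> by auto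
  qed
  have R3: ?thesis if "Gamma (1 + \<delta>) * Gamma (real m - 1 - \<delta>) \<le> C"
      "C * pochhammer k m * \<epsilon> \<le> fact (m - 1) * pochhammer (1 - \<epsilon>) m" for C
  proof -
    have "Gamma (1 + \<delta>) * Gamma (real m - 1 - \<delta>) * pochhammer k m * \<epsilon> \<le> C * pochhammer k m * \<epsilon>"
      using that(1) k \<epsilon> by (intro mult_right_mono) (auto intro!: pochhammer_nonneg)
    also note that(2)
    finally show ?thesis
      using Beta_criterion_2[OF m2 \<epsilon>, folded k_def \<delta>_def] k \<delta> by auto
  qed
  consider "m = 2" | "m = 3" "\<delta> \<le> 1" | "m = 3" "1 \<le> \<delta>"
    | "m = 4" "\<delta> \<le> 1" | "m = 4" "1 \<le> \<delta>" "\<delta> \<le> 2" | "m = 4" "2 \<le> \<delta>"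
    | "m = 5" "\<delta> \<le> 1" | "m = 5" "1 \<le> \<delta>" "\<delta> \<le> 2" | "m = 5" "2 \<le> \<delta>" "\<delta> \<le> 3" | "m = 5" "3 \<le> \<delta>"
  proof -
    have "m = 2 \<or> m = 3 \<or> m = 4 \<or> m = 5" using m by simp
    then show thesis
      using that linear[of \<delta> 1] linear[of \<delta> 2] linear[of \<delta> 3] by blast
  qed
  then show ?thesis
  proof cases
    \<comment> \<open>On (0,1) no chord from 0 exists for Gamma delta, so the chord is taken for
      Gamma (1 + delta) and divided by delta. What remains is (3 - 4 epsilon) / 3 <= 1 -
      epsilon.\<close>
    case 1
    have "Gamma (1 + \<delta>) * Gamma (3 - (1 + \<delta>)) \<le> 1"
      using Gamma_product_chord[of 1 3 "1 + \<delta>"] G \<delta> \<delta>0 1 by simp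
    moreover have "Gamma (1 + \<delta>) = \<delta> * Gamma \<delta>"
      using Gamma_add_nat[OF \<delta>0, of 1] by (simp add: add.commute)
    ultimately have "Gamma \<delta> * Gamma (real m - \<delta>) \<le> 1 / \<delta>"
      using \<delta>0 1 by (simp add: field_simps)
    moreover have "1 / \<delta> * pochhammer (k + 1) (m - 1) * \<epsilon> \<le> fact (m - 1) * pochhammer (1 - \<epsilon>) (m - 1)"
      using \<epsilon> 1 by (simp add: \<delta>_def k_def field_simps)
    ultimately show ?thesis by (rule R2)
  next
    case 2
    have "Gamma (1 + \<delta>) * Gamma (real m - 1 - \<delta>) \<le> 1"
      using Gamma_product_chord[of "1" 3 "1 + \<delta>"] G 2 \<delta> \<delta>0 by (simp add: algebra_simps)
    moreover have "1 * pochhammer k m * \<epsilon> \<le> fact (m - 1) * pochhammer (1 - \<epsilon>) m"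
      using pochhammer_bound_3_0[of \<epsilon>] 2 \<delta>0 by (simp add: k_def \<delta>_def fact_numeral)
    ultimately show ?thesis by (rule R3)
  next
    case 3
    have "Gamma \<delta> * Gamma (real m - \<delta>) \<le> 1"
      using Gamma_product_chord[of "1" 3 "\<delta>"] G 3 \<delta> \<delta>0 by (simp add: algebra_simps)
    moreover have "1 * pochhammer (k + 1) (m - 1) * \<epsilon> \<le> fact (m - 1) * pochhammer (1 - \<epsilon>) (m - 1)"
      using pochhammer_bound_3_1[of \<epsilon>] 3 \<delta> by (simp add: k_def \<delta>_def fact_numeral add.commute)
    ultimately show ?thesis by (rule R2)
  next
    case 4
    have "Gamma (1 + \<delta>) * Gamma (real m - 1 - \<delta>) \<le> (2 - \<delta>)"
      using Gamma_product_chord[of "1" 4 "1 + \<delta>"] G 4 \<delta> \<delta>0 by (simp add: algebra_simps)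
    moreover have "(2 - \<delta>) * pochhammer k m * \<epsilon> \<le> fact (m - 1) * pochhammer (1 - \<epsilon>) m"
      using pochhammer_bound_4_0[of \<epsilon>] 4 \<delta>0 by (simp add: k_def \<delta>_def fact_numeral)
    ultimately show ?thesis by (rule R3)
  next
    case 5
    have "Gamma (1 + \<delta>) * Gamma (real m - 1 - \<delta>) \<le> \<delta>"
      using Gamma_product_chord[of "2" 4 "1 + \<delta>"] G 5 \<delta> \<delta>0 by (simp add: algebra_simps)
    moreover have "\<delta> * pochhammer k m * \<epsilon> \<le> fact (m - 1) * pochhammer (1 - \<epsilon>) m"
      using pochhammer_bound_4_1[of \<epsilon>] 5 \<delta>0 by (simp add: k_def \<delta>_def fact_numeral)
    ultimately show ?thesis by (rule R3)
  next
    case 6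
    have "Gamma \<delta> * Gamma (real m - \<delta>) \<le> (\<delta> - 1)"
      using Gamma_product_chord[of "2" 4 "\<delta>"] G 6 \<delta> \<delta>0 by (simp add: algebra_simps)
    moreover have "(\<delta> - 1) * pochhammer (k + 1) (m - 1) * \<epsilon> \<le> fact (m - 1) * pochhammer (1 - \<epsilon>) (m - 1)"
      using pochhammer_bound_4_2[of \<epsilon>] 6 \<delta> by (simp add: k_def \<delta>_def fact_numeral add.commute)
    ultimately show ?thesis by (rule R2)
  next
    case 7
    have "Gamma (1 + \<delta>) * Gamma (real m - 1 - \<delta>) \<le> (6 - 4 * \<delta>)"
      using Gamma_product_chord[of "1" 5 "1 + \<delta>"] G 7 \<delta> \<delta>0 by (simp add: algebra_simps)
    moreover have "(6 - 4 * \<delta>) * pochhammer k m * \<epsilon> \<le> fact (m - 1) * pochhammer (1 - \<epsilon>) m"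
      using pochhammer_bound_5_0[of \<epsilon>] 7 \<delta>0 by (simp add: k_def \<delta>_def fact_numeral)
    ultimately show ?thesis by (rule R3)
  next
    case 8
    have "Gamma (1 + \<delta>) * Gamma (real m - 1 - \<delta>) \<le> 2"
      using Gamma_product_chord[of "2" 5 "1 + \<delta>"] G 8 \<delta> \<delta>0 by (simp add: algebra_simps)
    moreover have "2 * pochhammer k m * \<epsilon> \<le> fact (m - 1) * pochhammer (1 - \<epsilon>) m"
      using pochhammer_bound_5_1[of \<epsilon>] 8 \<delta>0 by (simp add: k_def \<delta>_def fact_numeral)
    ultimately show ?thesis by (rule R3)
  next
    case 9
    have "Gamma (1 + \<delta>) * Gamma (real m - 1 - \<delta>) \<le> (4 * \<delta> - 6)"
      using Gamma_product_chord[of "3" 5 "1 + \<delta>"] G 9 \<delta> \<delta>0 by (simp add: algebra_simps)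
    moreover have "(4 * \<delta> - 6) * pochhammer k m * \<epsilon> \<le> fact (m - 1) * pochhammer (1 - \<epsilon>) m"
      using pochhammer_bound_5_2[of \<epsilon>] 9 \<delta>0 by (simp add: k_def \<delta>_def fact_numeral)
    ultimately show ?thesis by (rule R3)
  next
    case 10
    have "Gamma \<delta> * Gamma (real m - \<delta>) \<le> (4 * \<delta> - 10)"
      using Gamma_product_chord[of "3" 5 "\<delta>"] G 10 \<delta> \<delta>0 by (simp add: algebra_simps)
    moreover have "(4 * \<delta> - 10) * pochhammer (k + 1) (m - 1) * \<epsilon> \<le>
        fact (m - 1) * pochhammer (1 - \<epsilon>) (m - 1)"
      using pochhammer_bound_5_3[of \<epsilon>] 10 \<delta> by (simp add: k_def \<delta>_def fact_numeral add.commute)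
    ultimately show ?thesis by (rule R2)
  qed
qed

section \<open>The averaged kernel\<close>

abbreviation Ioo :: "real \<Rightarrow> ennreal" where "Ioo \<equiv> indicator {0<..<1}"

lemma Beta_add_nat_left:
  fixes x y :: real
  assumes "0 < x" "0 < y"
  shows "Beta (x + real j) y = Beta x y * pochhammer x j / pochhammer (x + y) j"
proof -
  have "Beta (x + real j) y = Gamma (x + real j) * Gamma y / Gamma ((x + y) + real j)"
    by (simp add: Beta_def add_ac)
  also have "\<dots> = (pochhammer x j * Gamma x) * Gamma y / (pochhammer (x + y) j * Gamma (x + y))"
    using assms by (simp only: Gamma_add_nat add_pos_pos)
  finally show ?thesis by (simp add: Beta_def mult_ac)
qed

lemma binomial_series_ennreal:
  fixes x u :: real
  assumes "0 < x" "0 \<le> u" "u < 1"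
  shows "(\<Sum>j. ennreal (pochhammer x j / fact j * u ^ j)) = ennreal ((1 - u) powr (- x))"
  using assms by (intro suminf_ennreal_eq binomial_series_real)
    (auto intro!: mult_nonneg_nonneg divide_nonneg_pos pochhammer_nonneg)

text \<open>Euler's integral for a Gauss hypergeometric series: expand (1 - q u)^(-x) and integrate
  termwise. Nonnegativity justifies the exchange, including the boundary case q = 1.\<close>

lemma nn_integral_Beta_binomial:
  assumes x: "0 < x" and y: "0 < y" and z: "0 < z" and q: "0 \<le> q" "q \<le> 1"
  shows "(\<Sum>j. ennreal (pochhammer x j / fact j * q ^ j * Beta (y + real j) z)) =
     (\<integral>\<^sup>+u. Ioo u * ennreal (u powr (y - 1) * (1 - u) powr (z - 1) * (1 - q * u) powr (- x)) \<partial>lborel)"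
proof -
  have "(\<Sum>j. ennreal (pochhammer x j / fact j * q ^ j * Beta (y + real j) z)) =
     (\<Sum>j. \<integral>\<^sup>+u. ennreal (pochhammer x j / fact j * q ^ j) *
        (Ioo u * ennreal (u powr (y + real j - 1) * (1 - u) powr (z - 1))) \<partial>lborel)"
  proof (intro suminf_cong)
    fix j
    have "0 \<le> pochhammer x j / fact j * q ^ j"
      using x q by (intro mult_nonneg_nonneg divide_nonneg_pos pochhammer_nonneg) auto
    then have "ennreal (pochhammer x j / fact j * q ^ j * Beta (y + real j) z) =
        ennreal (pochhammer x j / fact j * q ^ j) * ennreal (Beta (y + real j) z)"
      by (rule ennreal_mult')
    also have "ennreal (Beta (y + real j) z) =
        (\<integral>\<^sup>+u. Ioo u * ennreal (u powr (y + real j - 1) * (1 - u) powr (z - 1)) \<partial>lborel)"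
      using y z by (intro nn_integral_Beta[symmetric]) auto
    also have "ennreal (pochhammer x j / fact j * q ^ j) * \<dots> =
       (\<integral>\<^sup>+u. ennreal (pochhammer x j / fact j * q ^ j) *
        (Ioo u * ennreal (u powr (y + real j - 1) * (1 - u) powr (z - 1))) \<partial>lborel)"
      by (rule nn_integral_cmult[symmetric]) measurable
    finally show "ennreal (pochhammer x j / fact j * q ^ j * Beta (y + real j) z) =
      (\<integral>\<^sup>+u. ennreal (pochhammer x j / fact j * q ^ j) *
        (Ioo u * ennreal (u powr (y + real j - 1) * (1 - u) powr (z - 1))) \<partial>lborel)" .
  qed
  also have "\<dots> = (\<integral>\<^sup>+u. (\<Sum>j. ennreal (pochhammer x j / fact j * q ^ j) *
        (Ioo u * ennreal (u powr (y + real j - 1) * (1 - u) powr (z - 1)))) \<partial>lborel)"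
    by (rule nn_integral_suminf[symmetric]) measurable
  also have "\<dots> = (\<integral>\<^sup>+u. Ioo u * ennreal (u powr (y - 1) * (1 - u) powr (z - 1)
      * (1 - q * u) powr (- x)) \<partial>lborel)"
  proof (rule nn_integral_cong)
    fix u :: real
    show "(\<Sum>j. ennreal (pochhammer x j / fact j * q ^ j) *
        (Ioo u * ennreal (u powr (y + real j - 1) * (1 - u) powr (z - 1)))) =
       Ioo u * ennreal (u powr (y - 1) * (1 - u) powr (z - 1) * (1 - q * u) powr (- x))"
    proof (cases "u \<in> {0<..<1}")
      case True
      have qu: "0 \<le> q * u" "q * u < 1"
      proof -
        have "q * u \<le> 1 * u" using q True by (intro mult_right_mono) auto
        moreover have "u < 1" "0 \<le> q * u" using q True by auto
        ultimately show "0 \<le> q * u" "q * u < 1" by linarith+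
      qed
      have "ennreal (pochhammer x j / fact j * q ^ j) * ennreal (u powr (y + real j - 1)
          * (1 - u) powr (z - 1))
         = ennreal (u powr (y - 1) * (1 - u) powr (z - 1)) * ennreal (pochhammer x j / fact j
             * (q * u) ^ j)" for j
      proof -
        have "u powr (y + real j - 1) = u powr (y - 1) * u ^ j"
          using True by (simp add: powr_add powr_diff powr_realpow)
        then have "pochhammer x j / fact j * q ^ j * (u powr (y + real j - 1) * (1 - u) powr (z - 1)) =
            u powr (y - 1) * (1 - u) powr (z - 1) * (pochhammer x j / fact j * (q * u) ^ j)"
          by (simp add: power_mult_distrib mult_ac)
        moreover have "0 \<le> pochhammer x j / fact j * q ^ j" "0 \<le> u powr (y - 1) * (1 - u) powr (z - 1)"
          using x q by (auto intro!: mult_nonneg_nonneg divide_nonneg_pos pochhammer_nonneg)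
        ultimately show ?thesis by (simp only: ennreal_mult'[symmetric])
      qed
      then have "(\<Sum>j. ennreal (pochhammer x j / fact j * q ^ j) *
          (Ioo u * ennreal (u powr (y + real j - 1) * (1 - u) powr (z - 1)))) =
         ennreal (u powr (y - 1) * (1 - u) powr (z - 1)) * (\<Sum>j. ennreal (pochhammer x j / fact j
             * (q * u) ^ j))"
        using True by simp
      also have "\<dots> = ennreal (u powr (y - 1) * (1 - u) powr (z - 1)) * ennreal ((1 - q * u) powr (- x))"
        using x qu by (simp only: binomial_series_ennreal)
      finally show ?thesis using True by (simp add: ennreal_mult'')
    qed simp
  qed
  finally show ?thesis .
qed

text \<open>At q = 1 the powers of 1 - u in Euler's integral merge and leave a Beta integral; x < z
  is what makes it converge.\<close>

lemma Gauss_summation: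
  assumes x: "0 < x" and y: "0 < y" and xz: "x < z"
  shows "(\<Sum>j. ennreal (pochhammer x j / fact j * Beta (y + real j) z)) = ennreal (Beta y (z - x))"
proof -
  have "(\<Sum>j. ennreal (pochhammer x j / fact j * Beta (y + real j) z)) =
     (\<integral>\<^sup>+u. Ioo u * ennreal (u powr (y - 1) * (1 - u) powr (z - 1) * (1 - 1 * u) powr (- x)) \<partial>lborel)"
    using nn_integral_Beta_binomial[of x y z 1] assms by simp
  also have "\<dots> = (\<integral>\<^sup>+u. Ioo u * ennreal (u powr (y - 1) * (1 - u) powr ((z - x) - 1)) \<partial>lborel)"
    by (intro nn_integral_cong) (auto simp: mult.assoc powr_add[symmetric] algebra_simps split:
       split_indicator)
  also have "\<dots> = ennreal (Beta y (z - x))"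
    using assms by (intro nn_integral_Beta) auto
  finally show ?thesis .
qed

text \<open>The substitution r = t / (1 - q x) maps (0,1) onto (t,1). In the variable r the factor 1
  - q x, which mixes t and x, disappears, so that t can later be integrated out for fixed r. It is
  applied with mu = m, kappa = k and nu = n.\<close>

lemma nn_integral_Moebius_substitution:
  fixes t \<kappa> \<mu> \<nu> :: real
  assumes t: "0 < t" "t < 1"
  defines "q \<equiv> 1 - t"
  shows "(\<integral>\<^sup>+r. indicator {t<..<1} r * ennreal ((r - t) powr (\<mu> - 1)
      * (1 - r) powr (\<kappa> - 1) * r powr (\<nu> - \<kappa>)) \<partial>lborel) =
    ennreal (t powr (\<mu> + \<nu> - \<kappa>) * q powr (\<mu> + \<kappa> - 1)) *
    (\<integral>\<^sup>+x. Ioo x * ennreal (x powr (\<mu> - 1) * (1 - x) powr (\<kappa> - 1) * (1 - q * x) powr (- (\<mu> + \<nu>))) \<partial>lborel)"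
proof -
  have q: "0 < q" "q < 1" using t by (auto simp: q_def)
  define g where "g x = t / (1 - q * x)" for x
  define g' where "g' x = t * q / (1 - q * x)\<^sup>2" for x
  define f where "f r = indicator {t<..<1} r * ((r - t) powr (\<mu> - 1)
      * (1 - r) powr (\<kappa> - 1) * r powr (\<nu> - \<kappa>))" for r
  have qx: "0 < 1 - q * x" if "x \<in> {0..1}" for x
  proof -
    have "q * x \<le> q * 1" using that q by (intro mult_left_mono) auto
    then show ?thesis using q by linarith
  qed
  have "g 0 = t" "g 1 = 1" using t by (auto simp: g_def q_def)
  have eq: "ennreal (f (g x) * g' x * indicator {0..1} x) =
      ennreal (t powr (\<mu> + \<nu> - \<kappa>) * q powr (\<mu> + \<kappa> - 1)) *
      (Ioo x * ennreal (x powr (\<mu> - 1) * (1 - x) powr (\<kappa> - 1) * (1 - q * x) powr (- (\<mu> + \<nu>))))"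
    if x01: "x \<noteq> 0 \<and> x \<noteq> 1" for x
    proof (cases "x \<in> {0<..<1}")
      case False
      then show ?thesis using x01 by (auto simp: indicator_def)
    next
      case True
      define d where "d = 1 - q * x"
      have d: "0 < d" using qx[of x] True by (auto simp: d_def)
      have gt: "g x - t = t * q * x / d" using d
          by (simp add: g_def d_def[symmetric] field_simps) (simp add: d_def algebra_simps)
      have g1: "1 - g x = q * (1 - x) / d" using d
          by (simp add: g_def d_def[symmetric] field_simps) (simp add: d_def q_def algebra_simps)
      have "g x \<in> {t<..<1}"
      proof -
        have "0 < t * q * x / d" "0 < q * (1 - x) / d" using True t q d by auto
        then show ?thesis using gt g1 by auto
      qed
      then have "f (g x) * g' x = (t * q * x / d) powr (\<mu> - 1) * (q * (1 - x) / d) powr (\<kappa> - 1)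
          * (t / d) powr (\<nu> - \<kappa>) * (t * q / d\<^sup>2)"
        unfolding f_def gt g1 by (simp add: g_def g'_def d_def)
      \<comment> \<open>With all powers written as exponentials, collecting exponents is a
        polynomial identity in the parameters and the logarithms.\<close>
      also have "\<dots> = exp ((\<mu> - 1) * (ln t + ln q + ln x - ln d) + (\<kappa> - 1) * (ln q + ln (1 - x) - ln d)
          + (\<nu> - \<kappa>) * (ln t - ln d) + (ln t + ln q - 2 * ln d))"
      proof -
        have "(t * q * x / d) powr (\<mu> - 1) = exp ((\<mu> - 1) * (ln t + ln q + ln x - ln d))"
          using True t q d by (simp add: powr_def ln_mult ln_div)
        moreover have "(q * (1 - x) / d) powr (\<kappa> - 1) = exp ((\<kappa> - 1) * (ln q + ln (1 - x) - ln d))"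
          using True t q d by (simp add: powr_def ln_mult ln_div)
        moreover have "(t / d) powr (\<nu> - \<kappa>) = exp ((\<nu> - \<kappa>) * (ln t - ln d))"
          using t d by (simp add: powr_def ln_div)
        moreover have "t * q / d\<^sup>2 = exp (ln t + ln q - (ln d + ln d))"
          using t q d unfolding exp_diff exp_add by (simp add: power2_eq_square)
        ultimately show ?thesis by (simp only: exp_add[symmetric] mult_2)
      qed
      also have "\<dots> = exp ((\<mu> + \<nu> - \<kappa>) * ln t + (\<mu> + \<kappa> - 1) * ln q + (\<mu> - 1) * ln x + (\<kappa> - 1) * ln (1 - x)
          + (- (\<mu> + \<nu>)) * ln d)"
        by (intro arg_cong[where f = exp]) algebra
      also have "\<dots> = t powr (\<mu> + \<nu> - \<kappa>) * q powr (\<mu> + \<kappa> - 1) * (x powr (\<mu> - 1)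
          * (1 - x) powr (\<kappa> - 1) * d powr (- (\<mu> + \<nu>)))"
        using True t q d by (simp add: powr_def exp_add)
      finally show ?thesis using True by (simp add: d_def ennreal_mult'')
    qed
  have ae: "AE x in lborel. x \<noteq> 0 \<and> x \<noteq> (1::real)"
    by (intro AE_conjI AE_lborel_singleton)
  have "(\<integral>\<^sup>+r. ennreal (f r * indicator {g 0..g 1} r) \<partial>lborel) =
      (\<integral>\<^sup>+x. ennreal (f (g x) * g' x * indicator {0..1} x) \<partial>lborel)"
  proof (rule nn_integral_substitution)
    have "f \<in> borel_measurable borel" unfolding f_def by measurable
    then show "set_borel_measurable borel {g 0..g 1} f"
      unfolding set_borel_measurable_def by measurable
    show "(g has_real_derivative g' x) (at x)" if "x \<in> {0..1}" for x
      unfolding g_def g'_def using qx[OF that]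
      by (auto intro!: derivative_eq_intros simp: power2_eq_square field_simps)
    show "continuous_on {0..1} g'"
      unfolding g'_def using qx by (intro continuous_intros) (auto dest!: qx)
    show "0 \<le> g' x" if "x \<in> {0..1}" for x unfolding g'_def using t q by auto
  qed simp
  also have "(\<integral>\<^sup>+r. ennreal (f r * indicator {g 0..g 1} r) \<partial>lborel) =
    (\<integral>\<^sup>+r. indicator {t<..<1} r * ennreal ((r - t) powr (\<mu> - 1)
        * (1 - r) powr (\<kappa> - 1) * r powr (\<nu> - \<kappa>)) \<partial>lborel)"
    unfolding \<open>g 0 = t\<close> \<open>g 1 = 1\<close> f_def
    by (intro nn_integral_cong) (auto split: split_indicator)
  also have "(\<integral>\<^sup>+x. ennreal (f (g x) * g' x * indicator {0..1} x) \<partial>lborel) =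
     (\<integral>\<^sup>+x. ennreal (t powr (\<mu> + \<nu> - \<kappa>) * q powr (\<mu> + \<kappa> - 1)) *
      (Ioo x * ennreal (x powr (\<mu> - 1) * (1 - x) powr (\<kappa> - 1) * (1 - q * x) powr (- (\<mu> + \<nu>)))) \<partial>lborel)"
    by (rule nn_integral_cong_AE[OF eventually_mono[OF ae]]) (rule eq)
  also have "\<dots> = ennreal (t powr (\<mu> + \<nu> - \<kappa>) * q powr (\<mu> + \<kappa> - 1)) *
    (\<integral>\<^sup>+x. Ioo x * ennreal (x powr (\<mu> - 1) * (1 - x) powr (\<kappa> - 1) * (1 - q * x) powr (- (\<mu> + \<nu>))) \<partial>lborel)"
    by (rule nn_integral_cmult) measurable
  finally show ?thesis .
qed

text \<open>
  After the substitution \<open>r = t / (1 - (1 - t) x)\<close> in the integral representation of the kernel of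
  \<open>comp_op\<close>, the average over \<open>t\<close> for fixed \<open>r\<close> produces this function; see
  \<open>nn_integral_scale_profile\<close>.
\<close>

definition hilbert_profile :: "real \<Rightarrow> real \<Rightarrow> real \<Rightarrow> ennreal" where
  "hilbert_profile a \<mu> r =
     (\<integral>\<^sup>+\<tau>. Ioo \<tau> * ennreal (\<tau> powr (a - 1) * (1 - \<tau>) powr (\<mu> - 1) * (1 - r * \<tau>) powr (- (\<mu>
         + a - 1))) \<partial>lborel)"

lemma borel_measurable_hilbert_profile [measurable]:
  "hilbert_profile a \<mu> \<in> borel_measurable borel"
  unfolding hilbert_profile_def[abs_def] by measurable

text \<open>The scaling t = r tau moves the region t < r to (0,1) and collects the powers of r in
  front.\<close>

lemma nn_integral_scale_profile:
  assumes r: "0 < r" "r < 1"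
  shows "(\<integral>\<^sup>+t. indicator {0<..<r} t * ennreal (t powr (a - 1) * (1 - t) powr (1 - \<mu> - a)
      * (r - t) powr (\<mu> - 1)) \<partial>lborel) =
    ennreal (r powr (a + \<mu> - 1)) * hilbert_profile a \<mu> r"
proof -
  define f where "f t = indicator {0<..<r} t * ennreal (t powr (a - 1) * (1 - t) powr (1 - \<mu> - a)
      * (r - t) powr (\<mu> - 1))" for t
  have [measurable]: "f \<in> borel_measurable borel" unfolding f_def by measurable
  have "(\<integral>\<^sup>+t. f t \<partial>lborel) = ennreal \<bar>r\<bar> * (\<integral>\<^sup>+\<tau>. f (0 + r * \<tau>) \<partial>lborel)"
    using r by (intro nn_integral_real_affine) auto
  also have "\<dots> = (\<integral>\<^sup>+\<tau>. ennreal \<bar>r\<bar> * f (0 + r * \<tau>) \<partial>lborel)"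
    by (rule nn_integral_cmult[symmetric]) measurable
  also have "\<dots> = (\<integral>\<^sup>+\<tau>. ennreal (r powr (a + \<mu> - 1)) * (Ioo \<tau> * ennreal (\<tau> powr (a - 1)
      * (1 - \<tau>) powr (\<mu> - 1) * (1 - r * \<tau>) powr (- (\<mu> + a - 1)))) \<partial>lborel)"
  proof (rule nn_integral_cong)
    fix \<tau> :: real
    show "ennreal \<bar>r\<bar> * f (0 + r * \<tau>) = ennreal (r powr (a + \<mu> - 1)) * (Ioo \<tau> * ennreal (\<tau> powr (a - 1)
        * (1 - \<tau>) powr (\<mu> - 1) * (1 - r * \<tau>) powr (- (\<mu> + a - 1))))"
    proof (cases "\<tau> \<in> {0<..<1}")
      case False
      then have "\<not> (0 < r * \<tau> \<and> r * \<tau> < r)" using r by (auto simp: zero_less_mult_iff)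
      then have "r * \<tau> \<notin> {0<..<r}" by auto
      then show ?thesis using False by (simp add: f_def)
    next
      case True
      have in_r: "r * \<tau> \<in> {0<..<r}" using True r by simp
      have "r - r * \<tau> = r * (1 - \<tau>)" by (simp add: algebra_simps)
      then have "r * ((r * \<tau>) powr (a - 1) * (1 - r * \<tau>) powr (1 - \<mu> - a) * (r - r * \<tau>) powr (\<mu> - 1)) =
          (r powr 1 * r powr (a - 1) * r powr (\<mu> - 1)) * (\<tau> powr (a - 1) * (1 - \<tau>) powr (\<mu> - 1)
              * (1 - r * \<tau>) powr (- (\<mu> + a - 1)))"
        using True r by (simp add: powr_mult mult_ac) (simp add: algebra_simps)
      also have "r powr 1 * r powr (a - 1) * r powr (\<mu> - 1) = r powr (a + \<mu> - 1)"
        by (simp only: powr_add[symmetric]) (simp add: algebra_simps)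
      finally show ?thesis
        using True r in_r by (simp add: f_def ennreal_mult''[symmetric])
    qed
  qed
  also have "\<dots> = ennreal (r powr (a + \<mu> - 1)) * hilbert_profile a \<mu> r"
    unfolding hilbert_profile_def by (rule nn_integral_cmult) measurable
  finally show ?thesis by (simp add: f_def)
qed

text \<open>As mu + a - 1 >= 0, the integrand is at most its value at r = 1, where the powers of 1 -
  tau combine into the integrand of Beta a (1 - a).\<close>

lemma hilbert_profile_le:
  assumes a: "0 < a" "a < 1" and \<mu>: "1 - a \<le> \<mu>" and r: "0 \<le> r" "r < 1"
  shows "hilbert_profile a \<mu> r \<le> ennreal (Beta a (1 - a))"
proof -
  have "hilbert_profile a \<mu> r \<le> (\<integral>\<^sup>+\<tau>. Ioo \<tau> * ennreal (\<tau> powr (a - 1)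
      * (1 - \<tau>) powr ((1 - a) - 1)) \<partial>lborel)"
    unfolding hilbert_profile_def
  proof (intro nn_integral_mono)
    fix \<tau> :: real
    show "Ioo \<tau> * ennreal (\<tau> powr (a - 1) * (1 - \<tau>) powr (\<mu> - 1) * (1 - r * \<tau>) powr (- (\<mu> + a - 1)))
       \<le> Ioo \<tau> * ennreal (\<tau> powr (a - 1) * (1 - \<tau>) powr ((1 - a) - 1))"
    proof (cases "\<tau> \<in> {0<..<1}")
      case True
      have "r * \<tau> \<le> 1 * \<tau>" using True r by (intro mult_right_mono) auto
      then have "(1 - r * \<tau>) powr (- (\<mu> + a - 1)) \<le> (1 - \<tau>) powr (- (\<mu> + a - 1))"
        using True \<mu> by (intro powr_mono2') auto
      then have "\<tau> powr (a - 1) * (1 - \<tau>) powr (\<mu> - 1) * (1 - r * \<tau>) powr (- (\<mu> + a - 1)) \<le>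
          \<tau> powr (a - 1) * (1 - \<tau>) powr (\<mu> - 1) * (1 - \<tau>) powr (- (\<mu> + a - 1))"
        by (intro mult_left_mono) auto
      also have "\<dots> = \<tau> powr (a - 1) * (1 - \<tau>) powr ((1 - a) - 1)"
        by (simp only: mult.assoc powr_add[symmetric]) (simp add: algebra_simps)
      finally show ?thesis using True by (simp add: ennreal_leI)
    qed simp
  qed
  also have "\<dots> = ennreal (Beta a (1 - a))"
    using a by (intro nn_integral_Beta) auto
  finally show ?thesis .
qed

text \<open>Expanding the profile in powers of r turns its weighted integral, the zeroth moment when
  mu = m, into a 3F2 series at 1. Gauss's theorem does not apply to it directly, hence the two
  majorants that follow.\<close>

lemma nn_integral_profile_series:
  fixes a k \<mu> :: real
  assumes a: "0 < a" and \<mu>: "1 \<le> \<mu>" and k: "0 < k" "k < \<mu> + a"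
  shows "(\<integral>\<^sup>+r. Ioo r * ennreal ((1 - r) powr (k - 1) * r powr (\<mu>
      + a - 1 - k)) * hilbert_profile a \<mu> r \<partial>lborel) =
    (\<Sum>j. ennreal (pochhammer (\<mu> + a - 1) j / fact j * Beta (a + real j) \<mu> * Beta (\<mu> + a - k + real j) k))"
proof -
  define c where "c = \<mu> + a - 1"
  have c: "0 < c" using a \<mu> by (simp add: c_def)
  have C0: "0 \<le> pochhammer c j / fact j * Beta (a + real j) \<mu>" for j
    using c a \<mu> by (intro mult_nonneg_nonneg divide_nonneg_pos pochhammer_nonneg less_imp_le[OF
        Beta_real_pos]) auto
  have "(\<integral>\<^sup>+r. Ioo r * ennreal ((1 - r) powr (k - 1) * r powr (\<mu>
      + a - 1 - k)) * hilbert_profile a \<mu> r \<partial>lborel) =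
     (\<integral>\<^sup>+r. (\<Sum>j. ennreal (pochhammer c j / fact j * Beta (a + real j) \<mu>) *
        (Ioo r * ennreal (r powr ((\<mu> + a - k + real j) - 1) * (1 - r) powr (k - 1)))) \<partial>lborel)"
  proof (rule nn_integral_cong)
    fix r :: real
    show "Ioo r * ennreal ((1 - r) powr (k - 1) * r powr (\<mu> + a - 1 - k)) * hilbert_profile a \<mu> r =
      (\<Sum>j. ennreal (pochhammer c j / fact j * Beta (a + real j) \<mu>) *
        (Ioo r * ennreal (r powr ((\<mu> + a - k + real j) - 1) * (1 - r) powr (k - 1))))"
    proof (cases "r \<in> {0<..<1}")
      case True
      have "hilbert_profile a \<mu> r = (\<Sum>j. ennreal (pochhammer c j / fact j * r ^ j * Beta (a + real j) \<mu>))"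
        unfolding hilbert_profile_def c_def using True a \<mu> c
        by (intro nn_integral_Beta_binomial[symmetric]) (auto simp: c_def)
      then have "Ioo r * ennreal ((1 - r) powr (k - 1) * r powr (\<mu> + a - 1 - k)) * hilbert_profile a \<mu> r =
         (\<Sum>j. ennreal ((1 - r) powr (k - 1) * r powr (\<mu>
             + a - 1 - k)) * ennreal (pochhammer c j / fact j * r ^ j * Beta (a + real j) \<mu>))"
        using True by simp
      also have "\<dots> = (\<Sum>j. ennreal (pochhammer c j / fact j * Beta (a + real j) \<mu>) *
        ennreal (r powr ((\<mu> + a - k + real j) - 1) * (1 - r) powr (k - 1)))"
      proof (intro suminf_cong)
        fix j
        have "r powr ((\<mu> + a - k + real j) - 1) = r powr ((\<mu> + a - 1 - k) + real j)"
          by (simp add: algebra_simps)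
        also have "\<dots> = r powr (\<mu> + a - 1 - k) * r ^ j"
          using True by (simp only: powr_add) (simp add: powr_realpow)
        finally have "(1 - r) powr (k - 1) * r powr (\<mu> + a - 1 - k)
            * (pochhammer c j / fact j * r ^ j * Beta (a + real j) \<mu>) =
           pochhammer c j / fact j * Beta (a + real j) \<mu> * (r powr ((\<mu> + a - k + real j) - 1)
               * (1 - r) powr (k - 1))"
          by (simp add: mult_ac)
        moreover have "0 \<le> (1 - r) powr (k - 1) * r powr (\<mu> + a - 1 - k)" by simp
        ultimately show "ennreal ((1 - r) powr (k - 1) * r powr (\<mu>
            + a - 1 - k)) * ennreal (pochhammer c j / fact j * r ^ j * Beta (a + real j) \<mu>) =
          ennreal (pochhammer c j / fact j * Beta (a + real j) \<mu>) * ennreal (r powr ((\<mu> + a - k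
              + real j) - 1) * (1 - r) powr (k - 1))"
          using C0[of j] by (simp only: ennreal_mult'[symmetric])
      qed
      finally show ?thesis using True by simp
    qed simp
  qed
  also have "\<dots> = (\<Sum>j. \<integral>\<^sup>+r. ennreal (pochhammer c j / fact j * Beta (a + real j) \<mu>) *
        (Ioo r * ennreal (r powr ((\<mu> + a - k + real j) - 1) * (1 - r) powr (k - 1))) \<partial>lborel)"
    by (rule nn_integral_suminf) measurable
  also have "\<dots> = (\<Sum>j. ennreal (pochhammer c j / fact j * Beta (a + real j) \<mu> * Beta (\<mu> + a - k
      + real j) k))"
  proof (intro suminf_cong)
    fix j
    have "(\<integral>\<^sup>+r. ennreal (pochhammer c j / fact j * Beta (a + real j) \<mu>) *
        (Ioo r * ennreal (r powr ((\<mu> + a - k + real j) - 1) * (1 - r) powr (k - 1))) \<partial>lborel) =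
       ennreal (pochhammer c j / fact j * Beta (a + real j) \<mu>) *
        (\<integral>\<^sup>+r. Ioo r * ennreal (r powr ((\<mu> + a - k + real j) - 1) * (1 - r) powr (k - 1)) \<partial>lborel)"
      by (rule nn_integral_cmult) measurable
    also have "(\<integral>\<^sup>+r. Ioo r * ennreal (r powr ((\<mu> + a - k + real j) - 1) * (1 - r) powr (k - 1)) \<partial>lborel) =
        ennreal (Beta (\<mu> + a - k + real j) k)"
      using k by (intro nn_integral_Beta) auto
    finally show "(\<integral>\<^sup>+r. ennreal (pochhammer c j / fact j * Beta (a + real j) \<mu>) *
        (Ioo r * ennreal (r powr ((\<mu> + a - k + real j) - 1) * (1 - r) powr (k - 1))) \<partial>lborel) =
       ennreal (pochhammer c j / fact j * Beta (a + real j) \<mu> * Beta (\<mu> + a - k + real j) k)"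
      using C0[of j] by (simp only: ennreal_mult')
  qed
  finally show ?thesis by (simp only: c_def)
qed

section \<open>Estimates for the zeroth moment of the profile\<close>

lemma pochhammer_mono_real:
  fixes x y :: real
  assumes "0 \<le> x" "x \<le> y"
  shows "pochhammer x n \<le> pochhammer y n"
  unfolding pochhammer_prod using assms by (intro prod_mono) auto

text \<open>Lowering the first argument of the last Beta factor by 1 increases it and produces
  \<open>pochhammer c j\<close> in the denominator. This cancels against the numerator, and a
  Gauss-summable series remains.\<close>

lemma profile_series_bound_1:
  fixes a k \<mu> :: real
  assumes a: "0 < a" "a < 1" and \<mu>: "1 \<le> \<mu>" and k: "0 < k" "k < \<mu> + a - 1"
  shows "(\<Sum>j. ennreal (pochhammer (\<mu> + a - 1) j / fact j * Beta (a + real j) \<mu> * Beta (\<mu> + a - k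
      + real j) k))
    \<le> ennreal (Beta (\<mu> + a - 1 - k) k * Beta a (k + (1 - a)))"
proof -
  define c where "c = \<mu> + a - 1"
  have c: "0 < c" "0 < c - k" using k by (auto simp: c_def)
  have "(\<Sum>j. ennreal (pochhammer c j / fact j * Beta (a + real j) \<mu> * Beta (c - k + 1 + real j) k))
      \<le> (\<Sum>j. ennreal (Beta (c - k) k) * ennreal (pochhammer (c - k) j / fact j * Beta (a + real j) \<mu>))"
  proof (intro suminf_le allI)
    fix j
    have pp: "pochhammer c j > 0" using c by (intro pochhammer_pos)
    have "Beta (c - k + 1 + real j) k \<le> Beta (c - k + real j) k"
      using c k by (intro Beta_real_mono) auto
    also have "\<dots> = Beta (c - k) k * pochhammer (c - k) j / pochhammer c j"
      using Beta_add_nat_left[of "c - k" k j] c k by simp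
    finally have "pochhammer c j / fact j * Beta (a + real j) \<mu> * Beta (c - k + 1 + real j) k \<le>
       pochhammer c j / fact j * Beta (a + real j) \<mu>
           * (Beta (c - k) k * pochhammer (c - k) j / pochhammer c j)"
      using pp a \<mu> by (intro mult_left_mono mult_nonneg_nonneg divide_nonneg_pos less_imp_le[OF
          Beta_real_pos]) auto
    also have "\<dots> = Beta (c - k) k * (pochhammer (c - k) j / fact j * Beta (a + real j) \<mu>)"
      using pp by simp
    finally show "ennreal (pochhammer c j / fact j * Beta (a + real j) \<mu> * Beta (c - k + 1 + real j) k)
      \<le> ennreal (Beta (c - k) k) * ennreal (pochhammer (c - k) j / fact j * Beta (a + real j) \<mu>)"
      using Beta_real_pos[OF c(2) k(1)] by (simp only: ennreal_mult'[symmetric] less_imp_le ennreal_leI)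
  qed auto
  also have "\<dots> = ennreal (Beta (c - k) k) * ennreal (Beta a (\<mu> - (c - k)))"
    using c a k by (simp only: ennreal_suminf_cmult, subst Gauss_summation) (auto simp: c_def)
  also have "\<mu> - (c - k) = k + (1 - a)" by (simp add: c_def)
  also have "ennreal (Beta (c - k) k) * ennreal (Beta a (k + (1 - a))) =
      ennreal (Beta (c - k) k * Beta a (k + (1 - a)))"
    using Beta_real_pos[OF c(2) k(1)] by (intro ennreal_mult'[symmetric]) simp
  finally show ?thesis by (simp add: c_def algebra_simps)
qed

text \<open>The opposite adjustment: raising the numerator parameter mu + a - 1 by 1 makes it cancel
  the denominator coming from the last Beta factor. Gauss summation then needs mu + a - k < mu,
  which is a < k.\<close>

lemma profile_series_bound_2:
  fixes a k \<mu> :: real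
  assumes a: "0 < a" "a < k" and \<mu>: "1 \<le> \<mu>" and k: "k < \<mu> + a"
  shows "(\<Sum>j. ennreal (pochhammer (\<mu> + a - 1) j / fact j * Beta (a + real j) \<mu> * Beta (\<mu> + a - k
      + real j) k))
    \<le> ennreal (Beta (\<mu> + a - k) (k - a) * Beta a \<mu>)"
proof -
  define d where "d = \<mu> + a - k"
  have d: "0 < d" and k0: "0 < k" using k a by (auto simp: d_def)
  have c: "0 < d + k - 1" using a \<mu> by (simp add: d_def)
  have "(\<Sum>j. ennreal (pochhammer (d + k - 1) j / fact j * Beta (a + real j) \<mu> * Beta (d + real j) k))
      \<le> (\<Sum>j. ennreal (Beta d k) * ennreal (pochhammer d j / fact j * Beta (a + real j) \<mu>))"
  proof (intro suminf_le allI)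
    fix j
    have pp: "pochhammer (d + k) j > 0" using d k0 by (intro pochhammer_pos) auto
    have "pochhammer (d + k - 1) j / fact j * Beta (a + real j) \<mu> * Beta (d + real j) k \<le>
       pochhammer (d + k) j / fact j * Beta (a + real j) \<mu> * Beta (d + real j) k"
      using c a \<mu> d k0 by (intro mult_right_mono divide_right_mono pochhammer_mono_real less_imp_le[OF
          Beta_real_pos]) auto
    also have "\<dots> = Beta d k * (pochhammer d j / fact j * Beta (a + real j) \<mu>)"
      using pp Beta_add_nat_left[of d k j] d k0 by simp
    finally show "ennreal (pochhammer (d + k - 1) j / fact j * Beta (a + real j) \<mu> * Beta (d + real j) k)
      \<le> ennreal (Beta d k) * ennreal (pochhammer d j / fact j * Beta (a + real j) \<mu>)"
      using Beta_real_pos[OF d k0] by (simp only: ennreal_mult'[symmetric] less_imp_le ennreal_leI)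
  qed auto
  also have "\<dots> = ennreal (Beta d k) * ennreal (Beta a (\<mu> - d))"
    using d a by (simp only: ennreal_suminf_cmult, subst Gauss_summation) (auto simp: d_def)
  also have "\<dots> = ennreal (Beta d k * Beta a (\<mu> - d))"
    using Beta_real_pos[OF d k0] by (simp add: ennreal_mult')
  also have "Beta d k * Beta a (\<mu> - d) = Beta d (k - a) * Beta a \<mu>"
  proof -
    have "Gamma k > 0" "Gamma \<mu> > 0" "Gamma (\<mu> + a) > 0" using a \<mu> by (auto intro!: Gamma_real_pos)
    moreover have e: "\<mu> - d = k - a" "d + k = \<mu> + a" "a + (k - a) = k" "d + (k - a) = \<mu>" "a + \<mu> = \<mu> + a"
      by (auto simp: d_def)
    ultimately show ?thesis unfolding Beta_def e by simp
  qed
  finally show ?thesis by (simp add: d_def algebra_simps)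
qed

text \<open>
  After normalization the profile becomes an average of functions that are convex in \<open>r\<close> and
  take the value \<open>1\<close> at \<open>r = 1\<close>; hence the set where it stays below its value at \<open>1\<close> is an
  interval with right end point \<open>1\<close>.
\<close>
lemma hilbert_profile_below_upward:
  assumes a: "0 < a" "a < 1" "a \<le> k" and \<mu>: "1 \<le> \<mu>" and r: "0 < r" "r \<le> r'" "r' < 1"
    and below: "ennreal (r powr (a - k)) * hilbert_profile a \<mu> r \<le> ennreal (Beta a (1 - a))"
  shows "ennreal (r' powr (a - k)) * hilbert_profile a \<mu> r' \<le> ennreal (Beta a (1 - a))"
proof -
  define c where "c = \<mu> + a - 1"
  have c: "0 < c" using a \<mu> by (simp add: c_def)
  define l where "l = (r' - r) / (1 - r)"
  have l: "0 \<le> l" "l \<le> 1" using r by (auto simp: l_def field_simps)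
  have r'_eq: "r' = (1 - l) * r + l * 1"
  proof -
    have "l * (1 - r) = r' - r" using r by (simp add: l_def)
    then show ?thesis by (simp add: algebra_simps)
  qed
  define h where "h x \<tau> = x powr (a - k) * (\<tau> powr (a - 1) * (1 - \<tau>) powr (\<mu> - 1)
      * (1 - x * \<tau>) powr (- c))" for x \<tau>
  have h_eq: "ennreal (x powr (a - k)) * hilbert_profile a \<mu> x =
      (\<integral>\<^sup>+\<tau>. Ioo \<tau> * ennreal (h x \<tau>) \<partial>lborel)" for x
  proof -
    have "ennreal (x powr (a - k)) * hilbert_profile a \<mu> x =
      (\<integral>\<^sup>+\<tau>. ennreal (x powr (a - k)) * (Ioo \<tau> * ennreal (\<tau> powr (a - 1) * (1 - \<tau>) powr (\<mu> - 1)
          * (1 - x * \<tau>) powr (- c))) \<partial>lborel)"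
      unfolding hilbert_profile_def c_def by (rule nn_integral_cmult[symmetric]) measurable
    also have "\<dots> = (\<integral>\<^sup>+\<tau>. Ioo \<tau> * ennreal (h x \<tau>) \<partial>lborel)"
      by (intro nn_integral_cong) (simp add: h_def ennreal_mult' mult_ac)
    finally show ?thesis .
  qed
  have h1: "(\<integral>\<^sup>+\<tau>. Ioo \<tau> * ennreal (h 1 \<tau>) \<partial>lborel) = ennreal (Beta a (1 - a))"
  proof -
    have "(\<integral>\<^sup>+\<tau>. Ioo \<tau> * ennreal (h 1 \<tau>) \<partial>lborel) =
        (\<integral>\<^sup>+\<tau>. Ioo \<tau> * ennreal (\<tau> powr (a - 1) * (1 - \<tau>) powr ((1 - a) - 1)) \<partial>lborel)"
    proof (rule nn_integral_cong)
      fix \<tau> :: real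
      have "(1 - \<tau>) powr (\<mu> - 1) * (1 - \<tau>) powr (- c) = (1 - \<tau>) powr ((1 - a) - 1)"
        by (simp only: powr_add[symmetric]) (simp add: c_def)
      then show "Ioo \<tau> * ennreal (h 1 \<tau>) = Ioo \<tau> * ennreal (\<tau> powr (a - 1) * (1 - \<tau>) powr ((1 - a) - 1))"
        by (simp add: h_def mult.assoc)
    qed
    also have "\<dots> = ennreal (Beta a (1 - a))" using a by (intro nn_integral_Beta) auto
    finally show ?thesis .
  qed
  have conv: "h r' \<tau> \<le> (1 - l) * h r \<tau> + l * h 1 \<tau>" if \<tau>: "\<tau> \<in> {0<..<1}" for \<tau>
  proof -
    \<comment> \<open>The logarithm of the x-dependent part of \<open>h\<close>. Both coefficients
      are nonpositive and multiply logarithms of affine functions, so \<open>f\<close> is convex,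
      and exponentiating preserves convexity.\<close>
    define f where "f x = (a - k) * ln x + (- c) * ln (1 - x * \<tau>)" for x
    have pos: "0 < 1 - x * \<tau>" if "0 < x" "x \<le> 1" for x
    proof -
      have "x * \<tau> \<le> 1 * \<tau>" using that \<tau> by (intro mult_right_mono) auto
      moreover have "\<tau> < 1" using \<tau> by simp
      ultimately show ?thesis by linarith
    qed
    have fe: "x powr (a - k) * (1 - x * \<tau>) powr (- c) = exp (f x)" if "0 < x" "x \<le> 1" for x
      using pos[OF that] that unfolding f_def exp_add by (simp add: powr_def)
    have lnc: "(1 - l) * ln x + l * ln y \<le> ln ((1 - l) * x + l * y)" if "0 < x" "0 < y" for x y :: real
      using ln_concave that l concave_onD[of "{0<..}" ln l x y] by (simp add: concave_on_def)
    have "(a - k) * ln r' \<le> (a - k) * ((1 - l) * ln r + l * ln 1)"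
      unfolding r'_eq using a r by (intro mult_left_mono_neg lnc) auto
    moreover have "(- c) * ln (1 - r' * \<tau>) \<le> (- c) * ((1 - l) * ln (1 - r * \<tau>) + l * ln (1 - 1 * \<tau>))"
    proof -
      have "1 - r' * \<tau> = (1 - l) * (1 - r * \<tau>) + l * (1 - 1 * \<tau>)"
        unfolding r'_eq by (simp add: algebra_simps)
      then show ?thesis
        using c r pos[of r] pos[of 1] by (simp only:) (intro mult_left_mono_neg lnc, auto)
    qed
    ultimately have "f r' \<le> (1 - l) * f r + l * f 1" by (simp add: f_def algebra_simps)
    then have "exp (f r') \<le> exp ((1 - l) * f r + l * f 1)" by simp
    also have "\<dots> \<le> (1 - l) * exp (f r) + l * exp (f 1)"
      using convex_onD[OF exp_convex, of l "f r" "f 1"] l by simp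
    finally have "exp (f r') * (\<tau> powr (a - 1) * (1 - \<tau>) powr (\<mu> - 1)) \<le>
        ((1 - l) * exp (f r) + l * exp (f 1)) * (\<tau> powr (a - 1) * (1 - \<tau>) powr (\<mu> - 1))"
      by (intro mult_right_mono) auto
    moreover have "h x \<tau> = exp (f x) * (\<tau> powr (a - 1) * (1 - \<tau>) powr (\<mu> - 1))" if "0 < x" "x \<le> 1" for x
      unfolding fe[OF that, symmetric] by (simp add: h_def mult_ac)
    ultimately show ?thesis using r by (simp add: algebra_simps)
  qed
  have h0: "0 \<le> h x \<tau>" for x \<tau> by (simp add: h_def)
  have hm: "(\<lambda>\<tau>. Ioo \<tau> * ennreal (h x \<tau>)) \<in> borel_measurable lborel" for x
    unfolding h_def by measurable
  have "ennreal (r' powr (a - k)) * hilbert_profile a \<mu> r' \<le>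
     (\<integral>\<^sup>+\<tau>. ennreal (1 - l) * (Ioo \<tau> * ennreal (h r \<tau>)) + ennreal l * (Ioo \<tau> * ennreal (h 1 \<tau>)) \<partial>lborel)"
    unfolding h_eq
  proof (intro nn_integral_mono)
    fix \<tau> :: real
    show "Ioo \<tau> * ennreal (h r' \<tau>) \<le> ennreal (1 - l) * (Ioo \<tau> * ennreal (h r \<tau>)) + ennreal l
        * (Ioo \<tau> * ennreal (h 1 \<tau>))"
    proof (cases "\<tau> \<in> {0<..<1}")
      case True
      then show ?thesis
        using ennreal_leI[OF conv[OF True]] l h0 by (simp add: ennreal_plus ennreal_mult)
    qed simp
  qed
  also have "\<dots> = ennreal (1 - l) * (\<integral>\<^sup>+\<tau>. Ioo \<tau> * ennreal (h r \<tau>) \<partial>lborel) + ennreal l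
      * (\<integral>\<^sup>+\<tau>. Ioo \<tau> * ennreal (h 1 \<tau>) \<partial>lborel)"
    using hm by (subst nn_integral_add) (auto simp: nn_integral_cmult)
  also have "\<dots> \<le> ennreal (1 - l) * ennreal (Beta a (1 - a)) + ennreal l * ennreal (Beta a (1 - a))"
    unfolding h1 using below[unfolded h_eq] by (intro add_mono mult_left_mono) auto
  also have "\<dots> = ennreal (Beta a (1 - a))"
    using l Beta_real_pos[of a "1 - a"] a by (simp add: ennreal_mult'[symmetric] ennreal_plus[symmetric]
        algebra_simps del: ennreal_plus)
  finally show ?thesis .
qed

text \<open>This is (x - y) (P - B) <= 0, written additively because extended nonnegative numbers do
  not subtract well.\<close>

lemma rearrangement_ennreal:
  fixes x y :: real and P B :: ennreal
  assumes "0 \<le> x" "0 \<le> y" and "y \<le> x \<and> P \<le> B \<or> x \<le> y \<and> B \<le> P"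
  shows "ennreal x * P + ennreal y * B \<le> ennreal y * P + ennreal x * B"
  using assms(3)
proof (elim disjE conjE)
  assume *: "y \<le> x" "P \<le> B"
  have "ennreal x = ennreal y + ennreal (x - y)"
    using * assms by (simp add: ennreal_plus[symmetric] del: ennreal_plus)
  then have "ennreal x * P + ennreal y * B = (ennreal y * P + ennreal y * B) + ennreal (x - y) * P"
    by (simp add: distrib_right add_ac)
  also have "\<dots> \<le> (ennreal y * P + ennreal y * B) + ennreal (x - y) * B"
    using * by (intro add_left_mono mult_left_mono) auto
  also have "\<dots> = ennreal y * P + ennreal x * B"
    using \<open>ennreal x = _\<close> by (simp add: distrib_right add_ac)
  finally show ?thesis .
next
  assume *: "x \<le> y" "B \<le> P"
  have "ennreal y = ennreal x + ennreal (y - x)"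
    using * assms by (simp add: ennreal_plus[symmetric] del: ennreal_plus)
  then have "ennreal x * P + ennreal y * B = (ennreal x * P + ennreal x * B) + ennreal (y - x) * B"
    by (simp add: distrib_right add_ac)
  also have "\<dots> \<le> (ennreal x * P + ennreal x * B) + ennreal (y - x) * P"
    using * by (intro add_left_mono mult_left_mono) auto
  also have "\<dots> = ennreal y * P + ennreal x * B"
    using \<open>ennreal y = _\<close> by (simp add: distrib_right add_ac)
  finally show ?thesis .
qed

text \<open>Let rho be the point where psi drops to B. Then r^n - rho^n and psi - B have opposite
  signs everywhere, so integrating their product against w gives the n-th inequality from the zeroth
  one, scaled by rho^n.\<close>

lemma nn_integral_single_crossing:
  fixes \<psi> :: "real \<Rightarrow> ennreal" and w :: "real \<Rightarrow> ennreal" and B :: ennreal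
  assumes [measurable]: "\<psi> \<in> borel_measurable borel" "w \<in> borel_measurable borel"
    and up: "\<And>r r'. 0 < r \<Longrightarrow> r \<le> r' \<Longrightarrow> r' < 1 \<Longrightarrow> \<psi> r \<le> B \<Longrightarrow> \<psi> r' \<le> B"
    and base: "(\<integral>\<^sup>+r. Ioo r * (w r * \<psi> r) \<partial>lborel) \<le> (\<integral>\<^sup>+r. Ioo r * w r \<partial>lborel) * B"
    and fin: "(\<integral>\<^sup>+r. Ioo r * w r \<partial>lborel) < \<infinity>" and B: "B < \<infinity>"
  shows "(\<integral>\<^sup>+r. Ioo r * (w r * ennreal (r ^ n) * \<psi> r) \<partial>lborel) \<le>
      (\<integral>\<^sup>+r. Ioo r * (w r * ennreal (r ^ n)) \<partial>lborel) * B"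
proof -
  \<comment> \<open>Inserting 1 covers the case in which psi never drops to B; then rho = 1.\<close>
  define S where "S = insert 1 {r \<in> {0<..<1}. \<psi> r \<le> B}"
  define \<rho> where "\<rho> = Inf S"
  have bdd: "bdd_below S" by (intro bdd_belowI[of _ 0]) (auto simp: S_def)
  have \<rho>: "0 \<le> \<rho>" unfolding \<rho>_def by (intro cInf_greatest) (auto simp: S_def)
  have cross: "\<rho> ^ n \<le> r ^ n \<and> \<psi> r \<le> B \<or> r ^ n \<le> \<rho> ^ n \<and> B \<le> \<psi> r" if r: "r \<in> {0<..<1}" for r
  proof (cases "\<psi> r \<le> B")
    case True
    then have "r \<in> S" using r by (simp add: S_def)
    then have "\<rho> \<le> r" unfolding \<rho>_def by (intro cInf_lower bdd)
    then show ?thesis using True \<rho> by (auto intro: power_mono)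
  next
    case False
    have "r \<le> \<rho>" unfolding \<rho>_def
    proof (rule cInf_greatest)
      fix x assume "x \<in> S"
      show "r \<le> x"
      proof (rule ccontr)
        assume "\<not> r \<le> x"
        then have "x < r" by simp
        with \<open>x \<in> S\<close> r have "0 < x" "\<psi> x \<le> B" by (auto simp: S_def)
        with up[of x r] \<open>x < r\<close> r False show False by simp
      qed
    qed (auto simp: S_def)
    then show ?thesis using False r by (auto intro: power_mono)
  qed
  let ?W = "\<integral>\<^sup>+r. Ioo r * w r \<partial>lborel"
  have "(\<integral>\<^sup>+r. Ioo r * (w r * ennreal (r ^ n) * \<psi> r) \<partial>lborel) + ennreal (\<rho> ^ n) * (?W * B) =
     (\<integral>\<^sup>+r. Ioo r * (w r * (ennreal (r ^ n) * \<psi> r + ennreal (\<rho> ^ n) * B)) \<partial>lborel)"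
  proof -
    have "ennreal (\<rho> ^ n) * (?W * B) = (\<integral>\<^sup>+r. (Ioo r * w r) * (ennreal (\<rho> ^ n) * B) \<partial>lborel)"
      by (subst nn_integral_multc) (auto simp: mult_ac)
    then show ?thesis
      by (simp add: nn_integral_add[symmetric] distrib_left mult_ac)
  qed
  also have "\<dots> \<le> (\<integral>\<^sup>+r. Ioo r * (w r * (ennreal (\<rho> ^ n) * \<psi> r + ennreal (r ^ n) * B)) \<partial>lborel)"
  proof (intro nn_integral_mono)
    fix r :: real
    show "Ioo r * (w r * (ennreal (r ^ n) * \<psi> r + ennreal (\<rho> ^ n) * B)) \<le>
        Ioo r * (w r * (ennreal (\<rho> ^ n) * \<psi> r + ennreal (r ^ n) * B))"
    proof (cases "r \<in> {0<..<1}")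
      case True
      then show ?thesis
        using cross[OF True] \<rho> by (intro mult_left_mono rearrangement_ennreal) auto
    qed simp
  qed
  also have "\<dots> = ennreal (\<rho> ^ n) * (\<integral>\<^sup>+r. Ioo r * (w r * \<psi> r) \<partial>lborel) + (\<integral>\<^sup>+r. Ioo r
      * (w r * ennreal (r ^ n)) \<partial>lborel) * B"
  proof -
    have "ennreal (\<rho> ^ n) * (\<integral>\<^sup>+r. Ioo r * (w r * \<psi> r) \<partial>lborel) =
        (\<integral>\<^sup>+r. ennreal (\<rho> ^ n) * (Ioo r * (w r * \<psi> r)) \<partial>lborel)"
      by (rule nn_integral_cmult[symmetric]) measurable
    moreover have "(\<integral>\<^sup>+r. Ioo r * (w r * ennreal (r ^ n)) \<partial>lborel) * B =
        (\<integral>\<^sup>+r. Ioo r * (w r * ennreal (r ^ n)) * B \<partial>lborel)"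
      by (rule nn_integral_multc[symmetric]) measurable
    ultimately show ?thesis
      by (simp add: nn_integral_add[symmetric] distrib_left mult_ac)
  qed
  also have "\<dots> \<le> ennreal (\<rho> ^ n) * (?W * B) + (\<integral>\<^sup>+r. Ioo r * (w r * ennreal (r ^ n)) \<partial>lborel) * B"
    by (intro add_right_mono mult_left_mono base) auto
  finally have "ennreal (\<rho> ^ n) * (?W * B) + (\<integral>\<^sup>+r. Ioo r * (w r * ennreal (r ^ n) * \<psi> r) \<partial>lborel)
     \<le> ennreal (\<rho> ^ n) * (?W * B) + (\<integral>\<^sup>+r. Ioo r * (w r * ennreal (r ^ n)) \<partial>lborel) * B"
    by (simp only: add.commute)
  \<comment> \<open>The term added on both sides must be finite before it can be cancelled.\<close>
  moreover have "ennreal (\<rho> ^ n) * (?W * B) < \<infinity>"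
    using fin B by (simp add: ennreal_mult_less_top)
  ultimately show ?thesis by (auto simp: ennreal_add_left_cancel_le)
qed

text \<open>The powers of r are split so that the weight \<open>w\<close> has the moments Beta (m +
  n) k while \<open>psi\<close> has the reference value Beta a (1 - a) at r = 1. For k <= a the
  bound by this value holds pointwise. For k > a only the single crossing is available, and the
  zeroth moment comes from \<open>Beta_criterion\<close>.\<close>

lemma hilbert_profile_moment:
  fixes m :: nat and s :: real
  assumes m: "m \<in> {2, 3, 4, 5}" and s: "real m < s" "s < 2 * real m"
  defines "a \<equiv> s / (2 * real m)" and "k \<equiv> s - real m"
  shows "(\<integral>\<^sup>+r. Ioo r * ennreal ((1 - r) powr (k - 1) * r powr (real m
      + a - 1 - k) * r ^ n) * hilbert_profile a (real m) r \<partial>lborel)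
    \<le> ennreal (Beta a (1 - a) * Beta (real m + real n) k)"
proof -
  have m2: "2 \<le> real m" using m by auto
  have a: "1 / 2 < a" "a < 1" using s m2 by (auto simp: a_def field_simps)
  have k: "0 < k" "k < real m" using s by (auto simp: k_def)
  define B where "B = ennreal (Beta a (1 - a))"
  define \<psi> where "\<psi> r = ennreal (r powr (a - k)) * hilbert_profile a (real m) r" for r
  define w where "w r = ennreal ((1 - r) powr (k - 1) * r powr (real m - 1))" for r
  have [measurable]: "\<psi> \<in> borel_measurable borel" "w \<in> borel_measurable borel"
    unfolding \<psi>_def w_def by measurable
  have wn: "(\<integral>\<^sup>+r. Ioo r * (w r * ennreal (r ^ n)) \<partial>lborel) = ennreal (Beta (real m + real n) k)" for n
  proof -
    have "(\<integral>\<^sup>+r. Ioo r * (w r * ennreal (r ^ n)) \<partial>lborel) =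
        (\<integral>\<^sup>+r. Ioo r * ennreal (r powr ((real m + real n) - 1) * (1 - r) powr (k - 1)) \<partial>lborel)"
    proof (intro nn_integral_cong)
      fix r :: real
      show "Ioo r * (w r * ennreal (r ^ n)) =
          Ioo r * ennreal (r powr ((real m + real n) - 1) * (1 - r) powr (k - 1))"
      proof (cases "r \<in> {0<..<1}")
        case True
        then have "r powr ((real m + real n) - 1) = r powr (real m - 1) * r ^ n"
          using powr_add[of r "real m - 1" "real n"] by (simp add: powr_realpow algebra_simps)
        then show ?thesis using True by (simp add: w_def ennreal_mult'[symmetric] mult_ac)
      qed simp
    qed
    also have "\<dots> = ennreal (Beta (real m + real n) k)"
      using k m2 by (intro nn_integral_Beta) auto
    finally show ?thesis .
  qed
  have eq: "Ioo r * ennreal ((1 - r) powr (k - 1) * r powr (real m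
      + a - 1 - k) * r ^ n) * hilbert_profile a (real m) r =
      Ioo r * (w r * ennreal (r ^ n) * \<psi> r)" for r n
  proof (cases "r \<in> {0<..<1}")
    case True
    have "r powr (real m + a - 1 - k) = r powr (real m - 1) * r powr (a - k)"
      by (simp add: powr_add[symmetric] algebra_simps)
    then show ?thesis using True by (simp add: w_def \<psi>_def ennreal_mult' mult_ac)
  qed simp
  have "(\<integral>\<^sup>+r. Ioo r * (w r * ennreal (r ^ n) * \<psi> r) \<partial>lborel) \<le>
      (\<integral>\<^sup>+r. Ioo r * (w r * ennreal (r ^ n)) \<partial>lborel) * B"
  proof (cases "k \<le> a")
    case True
    have "\<psi> r \<le> B" if r: "r \<in> {0<..<1}" for r
    proof -
      have "r powr (a - k) \<le> 1" using True r powr_le1[of "a - k" r] by simp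
      then have "\<psi> r \<le> ennreal 1 * hilbert_profile a (real m) r"
        unfolding \<psi>_def by (intro mult_right_mono ennreal_leI) auto
      also have "\<dots> \<le> B"
        unfolding B_def using hilbert_profile_le[of a "real m" r] a m2 r by simp
      finally show ?thesis .
    qed
    then have "(\<integral>\<^sup>+r. Ioo r * (w r * ennreal (r ^ n) * \<psi> r) \<partial>lborel) \<le>
        (\<integral>\<^sup>+r. Ioo r * (w r * ennreal (r ^ n)) * B \<partial>lborel)"
      by (intro nn_integral_mono) (auto simp: mult.assoc indicator_def intro!: mult_left_mono)
    also have "\<dots> = (\<integral>\<^sup>+r. Ioo r * (w r * ennreal (r ^ n)) \<partial>lborel) * B"
      by (rule nn_integral_multc) measurable
    finally show ?thesis .
  next
    case False
    show ?thesis
    proof (rule nn_integral_single_crossing)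
      show "\<psi> r' \<le> B" if "0 < r" "r \<le> r'" "r' < 1" "\<psi> r \<le> B" for r r'
        using that hilbert_profile_below_upward[of a k "real m" r r'] a False m2 unfolding \<psi>_def B_def
            by auto
      \<comment> \<open>Expressed through epsilon, the parameters take the shape of
        \<open>Beta_criterion\<close>, and the present case k > a supplies its hypothesis on
        delta.\<close>
      define \<epsilon> where "\<epsilon> = 1 - a"
      have \<epsilon>: "0 < \<epsilon>" "\<epsilon> < 1" using a by (auto simp: \<epsilon>_def)
      have "2 * real m * a = s" using m2 by (simp add: a_def)
      then have e: "real m - 2 * real m * \<epsilon> = k" "(2 * real m - 1) * \<epsilon> = real m + a - 1 - k" "1 - \<epsilon> = a"
        by (auto simp: \<epsilon>_def k_def algebra_simps)
      have crit: "Beta (real m + a - 1 - k) k * Beta a (k + \<epsilon>) \<le> Beta a \<epsilon> * Beta (real m) k \<or>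
          Beta (1 + (real m + a - 1 - k)) (real m - 1 - (real m + a - 1 - k)) * Beta a (real m) \<le>
              Beta a \<epsilon> * Beta (real m) k"
        using Beta_criterion[OF m \<epsilon>] False unfolding e by simp
      have pos: "0 < (2 * real m - 1) * \<epsilon>" using \<epsilon> m2 by (intro mult_pos_pos) auto
      have "(\<integral>\<^sup>+r. Ioo r * ennreal ((1 - r) powr (k - 1) * r powr (real m
          + a - 1 - k)) * hilbert_profile a (real m) r \<partial>lborel)
         = (\<Sum>j. ennreal (pochhammer (real m + a - 1) j / fact j * Beta (a
             + real j) (real m) * Beta (real m + a - k + real j) k))"
        using a m2 k by (intro nn_integral_profile_series) auto
      also have "\<dots> \<le> ennreal (Beta a \<epsilon> * Beta (real m) k)"
        using crit
      proof
        assume "Beta (real m + a - 1 - k) k * Beta a (k + \<epsilon>) \<le> Beta a \<epsilon> * Beta (real m) k"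
        from order_trans[OF _ ennreal_leI[OF this]] show ?thesis
          using profile_series_bound_1[of a "real m" k] a m2 k pos unfolding e by (simp add: \<epsilon>_def)
      next
        assume "Beta (1 + (real m + a - 1 - k)) (real m - 1 - (real m + a - 1 - k)) * Beta a (real m) \<le>
            Beta a \<epsilon> * Beta (real m) k"
        from order_trans[OF _ ennreal_leI[OF this]] show ?thesis
          using profile_series_bound_2[of a k "real m"] a m2 k False by (simp add: algebra_simps)
      qed
      also have "\<dots> = ennreal (Beta (real m) k) * B"
        using Beta_real_pos[of "real m" k] m2 k
            by (simp add: B_def \<epsilon>_def ennreal_mult'[symmetric] mult.commute)
      finally show "(\<integral>\<^sup>+r. Ioo r * (w r * \<psi> r) \<partial>lborel) \<le> (\<integral>\<^sup>+r. Ioo r * w r \<partial>lborel) * B"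
        using eq[of _ 0] wn[of 0] by simp
      show "(\<integral>\<^sup>+r. Ioo r * w r \<partial>lborel) < \<infinity>" using wn[of 0] by simp
      show "B < \<infinity>" by (simp add: B_def)
    qed measurable
  qed
  also have "\<dots> = ennreal (Beta a (1 - a) * Beta (real m + real n) k)"
    using Beta_real_pos[of a "1 - a"] a by (simp add: wn B_def ennreal_mult' mult.commute)
  finally show ?thesis unfolding eq .
qed

text \<open>Bounds the average over t of the n-th diagonal entry for kappa = m. Times Beta m k, the
  inner sum is an Euler integral; substituting and exchanging the integrals turns the average into a
  moment of the profile. The ratio of Pochhammer symbols is the quotient of the Beta values for n
  and 0.\<close>

lemma averaged_composition_bound:
  fixes m :: nat and s :: real
  assumes m: "m \<in> {2, 3, 4, 5}" and s: "real m < s" "s < 2 * real m"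
  defines "a \<equiv> s / (2 * real m)"
  shows "(\<integral>\<^sup>+t. Ioo t * (ennreal (t powr (a - 1) * (1 - t) powr (- a) * t powr (2 * real m - s)
      * (1 - t) powr s) *
      (\<Sum>j. ennreal ((1 - t) powr (- real m) * t ^ n *
        (pochhammer (real m) j * pochhammer (real m + real n) j / (fact j * pochhammer s j)
            * (1 - t) ^ j)))) \<partial>lborel)
    \<le> ennreal (Beta a (1 - a) * (pochhammer (real m) n / pochhammer s n))" (is "?L \<le> _")
proof -
  define k where "k = s - real m"
  have m2: "2 \<le> real m" using m by auto
  have a: "1 / 2 < a" "a < 1" using s m2 by (auto simp: a_def field_simps)
  have k: "0 < k" "k < real m" using s by (auto simp: k_def)
  have mk: "real m + k = s" by (simp add: k_def)
  define Bm where "Bm = Beta (real m) k"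
  have Bm: "0 < Bm" unfolding Bm_def using k m2 by (intro Beta_real_pos) auto
  have s0: "0 < s" using s m2 by simp
  \<comment> \<open>The double integrand on the triangle t < r. The prefactor of the Moebius
    substitution absorbs the remaining powers of t and 1 - t, which leaves the exponents a - 1 and 1
    - m - a, independent of n.\<close>
  define H where "H t r = (if 0 < t \<and> t < r \<and> r < 1 then ennreal (t powr (a - 1)
      * (1 - t) powr (1 - real m - a) *
      (r - t) powr (real m - 1) * (1 - r) powr (k - 1) * r powr (real n - k)) else 0)" for t r
  have Hm: "case_prod H \<in> borel_measurable (lborel \<Otimes>\<^sub>M lborel)"
    unfolding H_def by measurable
  have inner_t: "ennreal Bm * (Ioo t * (ennreal (t powr (a - 1)
      * (1 - t) powr (- a) * t powr (2 * real m - s) * (1 - t) powr s) *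
      (\<Sum>j. ennreal ((1 - t) powr (- real m) * t ^ n *
        (pochhammer (real m) j * pochhammer (real m + real n) j / (fact j * pochhammer s j)
            * (1 - t) ^ j))))) =
     (\<integral>\<^sup>+r. H t r \<partial>lborel)" for t
  proof (cases "t \<in> {0<..<1}")
    case False
    then have "H t = (\<lambda>r. 0)" by (auto simp: H_def fun_eq_iff)
    then show ?thesis using False by simp
  next
    case True
    then have t: "0 < t" "t < 1" by auto
    define q where "q = 1 - t"
    have q: "0 < q" "q < 1" using t by (auto simp: q_def)
    define X where "X = (\<integral>\<^sup>+x. Ioo x * ennreal (x powr (real m - 1) * (1 - x) powr (k - 1)
        * (1 - q * x) powr (- (real m + real n))) \<partial>lborel)"
    have X: "X = (\<Sum>j. ennreal (pochhammer (real m + real n) j / fact j * q ^ j * Beta (real m + real j) k))"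
      unfolding X_def using m2 k q by (intro nn_integral_Beta_binomial[symmetric]) auto
    have S: "ennreal Bm * (\<Sum>j. ennreal (q powr (- real m) * t ^ n *
        (pochhammer (real m) j * pochhammer (real m + real n) j / (fact j * pochhammer s j) * q ^ j)))
       = ennreal (q powr (- real m) * t ^ n) * X"
    proof -
      have "ennreal Bm * ennreal (q powr (- real m) * t ^ n *
        (pochhammer (real m) j * pochhammer (real m + real n) j / (fact j * pochhammer s j) * q ^ j)) =
        ennreal (q powr (- real m) * t ^ n) * ennreal (pochhammer (real m
            + real n) j / fact j * q ^ j * Beta (real m + real j) k)" for j
      proof -
        have "Beta (real m + real j) k = Bm * pochhammer (real m) j / pochhammer s j"
          using Beta_add_nat_left[of "real m" k j] m2 k by (simp add: mk Bm_def)
        then have "Bm * (q powr (- real m) * t ^ n *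
            (pochhammer (real m) j * pochhammer (real m + real n) j / (fact j * pochhammer s j) * q ^ j)) =
          (q powr (- real m) * t ^ n) * (pochhammer (real m + real n) j / fact j * q ^ j * Beta (real m
              + real j) k)"
          by (simp add: mult_ac)
        moreover have "0 \<le> Bm" "0 \<le> q powr (- real m) * t ^ n" using Bm t by auto
        ultimately show ?thesis by (simp only: ennreal_mult'[symmetric])
      qed
      then show ?thesis unfolding X by (simp only: ennreal_suminf_cmult[symmetric])
    qed
    have "(\<integral>\<^sup>+r. H t r \<partial>lborel) = (\<integral>\<^sup>+r. ennreal (t powr (a - 1) * q powr (1 - real m - a)) *
        (indicator {t<..<1} r * ennreal ((r - t) powr (real m - 1)
            * (1 - r) powr (k - 1) * r powr (real n - k))) \<partial>lborel)"
      using t by (intro nn_integral_cong) (auto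
          simp: H_def q_def ennreal_mult'[symmetric] mult_ac split: split_indicator)
    also have "\<dots> = ennreal (t powr (a - 1) * q powr (1 - real m - a)) *
      (\<integral>\<^sup>+r. indicator {t<..<1} r * ennreal ((r - t) powr (real m - 1)
          * (1 - r) powr (k - 1) * r powr (real n - k)) \<partial>lborel)"
      by (rule nn_integral_cmult) measurable
    also have "(\<integral>\<^sup>+r. indicator {t<..<1} r * ennreal ((r - t) powr (real m - 1)
        * (1 - r) powr (k - 1) * r powr (real n - k)) \<partial>lborel)
       = ennreal (t powr (real m + real n - k) * q powr (real m + k - 1)) * X"
      unfolding X_def q_def by (rule nn_integral_Moebius_substitution[OF t])
    finally have "(\<integral>\<^sup>+r. H t r \<partial>lborel) =
       ennreal (t powr (a - 1) * q powr (1 - real m - a) * (t powr (real m + real n - k) * q powr (real m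
           + k - 1))) * X"
      by (simp add: ennreal_mult' mult.assoc)
    also have "t powr (a - 1) * q powr (1 - real m - a) * (t powr (real m + real n - k) * q powr (real m
        + k - 1)) =
       (t powr (a - 1) * q powr (- a) * t powr (2 * real m - s) * q powr s) * (q powr (- real m) * t ^ n)"
    proof -
      have 1: "t powr (real m + real n - k) = t powr (2 * real m - s) * t powr (real n)"
        by (simp only: powr_add[symmetric]) (simp add: k_def algebra_simps)
      have 3: "t powr (real n) = t ^ n" using t by (simp add: powr_realpow)
      have 2: "q powr (1 - real m - a) * q powr (real m + k - 1) =
          q powr (- a) * q powr s * q powr (- real m)"
        by (simp only: powr_add[symmetric]) (simp add: k_def)
      have gen: "A * Q1 * ((T * U) * Q2) = (A * Qa * T * Qs) * (Qm * U)" if "Q1 * Q2 = Qa * Qs * Qm"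
        for A Q1 Q2 T U Qa Qs Qm :: real
        using that by algebra
      show ?thesis unfolding 1 3 by (rule gen[OF 2])
    qed
    also have "ennreal \<dots> * X = ennreal (t powr (a - 1) * q powr (- a) * t powr (2 * real m
        - s) * q powr s) *
       (ennreal (q powr (- real m) * t ^ n) * X)"
      by (subst ennreal_mult') (auto simp: mult.assoc)
    finally have E: "(\<integral>\<^sup>+r. H t r \<partial>lborel) = ennreal (t powr (a - 1) * q powr (- a) * t powr (2 * real m
        - s) * q powr s) *
       (ennreal (q powr (- real m) * t ^ n) * X)" .
    have gen: "x * (Ioo t * (y * z)) = y * (x * z)" for x y z :: ennreal
      using True by (simp add: mult.left_commute)
    show ?thesis unfolding E S[symmetric] unfolding q_def by (rule gen)
  qed
  have inner_r: "(\<integral>\<^sup>+t. H t r \<partial>lborel) =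
      Ioo r * ennreal ((1 - r) powr (k - 1) * r powr (real m
          + a - 1 - k) * r ^ n) * hilbert_profile a (real m) r" for r
  proof (cases "r \<in> {0<..<1}")
    case False
    then have "H t r = 0" for t by (auto simp: H_def)
    then show ?thesis using False by simp
  next
    case True
    then have r: "0 < r" "r < 1" by auto
    have "(\<integral>\<^sup>+t. H t r \<partial>lborel) = (\<integral>\<^sup>+t. ennreal ((1 - r) powr (k - 1) * r powr (real n - k)) *
        (indicator {0<..<r} t * ennreal (t powr (a - 1) * (1 - t) powr (1 - real m - a)
            * (r - t) powr (real m - 1))) \<partial>lborel)"
      using r by (intro nn_integral_cong) (auto
          simp: H_def ennreal_mult'[symmetric] mult_ac split: split_indicator)
    also have "\<dots> = ennreal ((1 - r) powr (k - 1) * r powr (real n - k)) *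
       (\<integral>\<^sup>+t. indicator {0<..<r} t * ennreal (t powr (a - 1) * (1 - t) powr (1 - real m - a)
           * (r - t) powr (real m - 1)) \<partial>lborel)"
      by (rule nn_integral_cmult) measurable
    also have "\<dots> = ennreal ((1 - r) powr (k - 1) * r powr (real n - k)) * (ennreal (r powr (a
        + real m - 1)) * hilbert_profile a (real m) r)"
      by (simp only: nn_integral_scale_profile[OF r])
    also have "\<dots> = ennreal ((1 - r) powr (k - 1) * r powr (real n - k) * r powr (a
        + real m - 1)) * hilbert_profile a (real m) r"
      by (simp add: ennreal_mult' mult.assoc)
    also have "(1 - r) powr (k - 1) * r powr (real n - k) * r powr (a + real m - 1) =
        (1 - r) powr (k - 1) * r powr (real m + a - 1 - k) * r ^ n"
    proof -
      have "r powr (real n - k) * r powr (a + real m - 1) = r powr (real m + a - 1 - k) * r powr (real n)"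
        by (simp only: powr_add[symmetric]) (simp add: algebra_simps)
      then show ?thesis using r by (simp add: powr_realpow mult.assoc)
    qed
    finally show ?thesis using True by simp
  qed
  have "ennreal Bm * ?L = (\<integral>\<^sup>+t. \<integral>\<^sup>+r. H t r \<partial>lborel \<partial>lborel)"
    by (subst nn_integral_cmult[symmetric]) (measurable, simp only: inner_t)
  also have "\<dots> = (\<integral>\<^sup>+r. \<integral>\<^sup>+t. H t r \<partial>lborel \<partial>lborel)"
    by (rule lborel_pair.Fubini'[OF Hm, symmetric])
  also have "\<dots> \<le> ennreal (Beta a (1 - a) * Beta (real m + real n) k)"
    unfolding inner_r a_def k_def by (rule hilbert_profile_moment[OF m s])
  also have "Beta (real m + real n) k = Bm * (pochhammer (real m) n / pochhammer s n)"
    using Beta_add_nat_left[of "real m" k n] m2 k by (simp add: mk Bm_def)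
  finally have le: "ennreal Bm * ?L \<le> ennreal (Beta a (1 - a) * (Bm
      * (pochhammer (real m) n / pochhammer s n)))" .
  have "?L = ennreal (1 / Bm) * (ennreal Bm * ?L)"
    using Bm by (simp add: mult.assoc[symmetric] ennreal_mult'[symmetric])
  also have "\<dots> \<le> ennreal (1 / Bm) * ennreal (Beta a (1 - a) * (Bm
      * (pochhammer (real m) n / pochhammer s n)))"
    by (intro mult_left_mono le) auto
  also have "\<dots> = ennreal (Beta a (1 - a) * (pochhammer (real m) n / pochhammer s n))"
    using Bm by (simp add: ennreal_mult'[symmetric])
  finally show ?thesis .
qed

section \<open>Growth of Bergman functions\<close>

lemma norm_powr_even:
  fixes w :: complex
  assumes "0 < m"
  shows "cmod w powr (2 * real m) = (cmod (w ^ m))\<^sup>2"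
proof (cases "w = 0")
  case False
  then have "cmod w powr (2 * real m) = cmod w ^ (2 * m)"
    using powr_realpow[of "cmod w" "2 * m"] by simp
  then show ?thesis by (simp add: norm_power power_mult[symmetric] mult.commute)
qed (use assms in auto)

text \<open>As \<open>f ^ m\<close> lies in a Hilbert space with reproducing kernel of order
  \<open>s\<close>, the exponent \<open>a\<close> governs the growth of f at the boundary; a < 1 is
  what makes the integrals over (0,1) converge.\<close>

locale bergman_function =
  fixes m :: nat and \<alpha> s a :: real and f :: "complex \<Rightarrow> complex"
  assumes m: "2 \<le> m" and \<alpha>: "-1 < \<alpha>" "\<alpha> < 2 * real m - 2"
    and f: "f \<in> bergman_space (2 * real m) \<alpha>"
  defines "s \<equiv> \<alpha> + 2" and "a \<equiv> (\<alpha> + 2) / (2 * real m)"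
begin

definition N :: real where "N = (LINT z|disk_measure \<alpha>. cmod (f z) powr (2 * real m))"

definition c :: "nat \<Rightarrow> complex" where "c n = (deriv ^^ n) (\<lambda>z. f z ^ m) 0 / fact n"

lemma s: "1 < s" "s < 2 * real m" using \<alpha> by (auto simp: s_def)

lemma a: "0 < a" "a < 1" "2 * real m * a = s"
  using m \<alpha> by (auto simp: a_def s_def)

lemma holo: "f holomorphic_on ball 0 1" using f by (simp add: bergman_space_def)

lemma N_nonneg: "0 \<le> N" unfolding N_def by (intro integral_nonneg_AE) auto

lemma nn_integral_f: "(\<integral>\<^sup>+z. ennreal ((cmod (f z ^ m))\<^sup>2) \<partial>disk_measure \<alpha>) = ennreal N"
proof -
  have "integrable (disk_measure \<alpha>) (\<lambda>z. cmod (f z) powr (2 * real m))"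
    using f by (simp add: bergman_space_def)
  from nn_integral_eq_integral[OF this]
  have "(\<integral>\<^sup>+z. ennreal (cmod (f z) powr (2 * real m)) \<partial>disk_measure \<alpha>) = ennreal N"
    by (simp add: N_def)
  moreover have "0 < m" using m by simp
  ultimately show ?thesis by (simp only: norm_powr_even)
qed

lemma c_sums: "cmod z < 1 \<Longrightarrow> (\<lambda>n. c n * z ^ n) sums (f z ^ m)"
  using holomorphic_power_series[of "\<lambda>z. f z ^ m" 0 1 z] holo
  by (simp add: c_def holomorphic_on_power)

lemma N_series: "(\<Sum>n. ennreal ((cmod (c n))\<^sup>2 * (fact n / pochhammer s n))) = ennreal N"
  unfolding nn_integral_f[symmetric] s_def by (rule power_series_disk_norm[symmetric, OF \<alpha>(1) c_sums])

text \<open>The reproducing kernel estimate for \<open>f ^ m\<close>: Cauchy-Schwarz against the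
  series of (1 - |z|^2)^(-s).\<close>

lemma growth_power:
  assumes z: "0 < cmod z" "cmod z < 1"
  shows "(cmod (f z) ^ m)\<^sup>2 \<le> N * (1 - (cmod z)\<^sup>2) powr (- s)"
proof -
  define x where "x = cmod z"
  have x: "0 < x" "x < 1" using z by (auto simp: x_def)
  have x2: "x\<^sup>2 < 1" using x by (simp add: power_less_one_iff)
  \<comment> \<open>Chosen so that x^n v n sums to the kernel on the diagonal while x^n / v n is the
    Parseval weight. Positivity needs z to be nonzero.\<close>
  define v where "v n = x ^ n * pochhammer s n / fact n" for n
  have pp: "0 < pochhammer s n" for n using s by (intro pochhammer_pos) auto
  have v: "0 < v n" for n using x pp[of n] by (simp add: v_def)
  have sm: "summable (\<lambda>n. x ^ n * cmod (c n))"
    using power_series_summable_norm[of c x] c_sums x by (auto simp: sums_iff mult.commute)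
  have sv: "(\<lambda>n. x ^ n * v n) sums ((1 - x\<^sup>2) powr (- s))"
    using binomial_series_real[of "x\<^sup>2" s] x2
        by (simp add: v_def power2_eq_square power_mult_distrib mult_ac)
  have "cmod (f z ^ m) \<le> (\<Sum>n. norm (c n * z ^ n))"
    using c_sums[OF z(2)] sm by (subst sums_unique[OF c_sums[OF z(2)]], intro summable_norm)
      (simp add: norm_mult norm_power x_def mult.commute)
  also have "\<dots> = (\<Sum>n. x ^ n * cmod (c n))" by (simp add: norm_mult norm_power x_def mult.commute)
  finally have "ennreal ((cmod (f z ^ m))\<^sup>2) \<le> ennreal ((\<Sum>n. x ^ n * cmod (c n))\<^sup>2)"
    by (intro ennreal_leI power_mono) auto
  also have "\<dots> \<le> ennreal ((1 - x\<^sup>2) powr (- s)) * (\<Sum>n. ennreal (x ^ n * (cmod (c n))\<^sup>2 / v n))"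
    using x v by (intro weighted_Cauchy_Schwarz_ennreal sm sv) auto
  also have "(\<Sum>n. ennreal (x ^ n * (cmod (c n))\<^sup>2 / v n)) = ennreal N"
    unfolding N_series[symmetric] using x by (intro suminf_cong) (simp add: v_def mult_ac)
  also have "ennreal ((1 - x\<^sup>2) powr (- s)) * ennreal N = ennreal (N * (1 - x\<^sup>2) powr (- s))"
    using N_nonneg by (simp add: ennreal_mult mult.commute)
  finally show ?thesis
    using N_nonneg by (simp add: x_def norm_power ennreal_le_iff)
qed

lemma growth: "\<exists>C\<ge>0. \<forall>z. cmod z < 1 \<longrightarrow> cmod (f z) \<le> C * (1 - cmod z) powr (- a)"
proof -
  \<comment> \<open>The maximum takes care of z = 0, which \<open>growth_power\<close>
    excludes.\<close>
  define C where "C = max (N powr (1 / (2 * real m))) (cmod (f 0))"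
  have C0: "0 \<le> C" by (simp add: C_def le_max_iff_disj)
  have "cmod (f z) \<le> C * (1 - cmod z) powr (- a)" if z: "cmod z < 1" for z
  proof (cases "z = 0")
    case True
    then show ?thesis by (simp add: C_def)
  next
    case False
    define x where "x = cmod z"
    have x: "0 < x" "x < 1" using z False by (auto simp: x_def)
    have "x\<^sup>2 \<le> x" using x by (simp add: power2_eq_square mult_left_le)
    then have "(1 - x\<^sup>2) powr (- s) \<le> (1 - x) powr (- s)"
      using x s by (intro powr_mono2') auto
    then have "(cmod (f z) ^ m)\<^sup>2 \<le> N * (1 - x) powr (- s)"
      using growth_power[of z] x N_nonneg by (auto simp: x_def intro: order_trans mult_left_mono)
    then have "cmod (f z) powr (2 * real m) \<le> N * (1 - x) powr (- s)"
      using m norm_powr_even[of m "f z"] by (simp add: norm_power)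
    then have "(cmod (f z) powr (2 * real m)) powr (1 / (2 * real m)) \<le>
        (N * (1 - x) powr (- s)) powr (1 / (2 * real m))"
      by (intro powr_mono2) auto
    also have "(cmod (f z) powr (2 * real m)) powr (1 / (2 * real m)) = cmod (f z)"
      using m by (simp add: powr_powr)
    also have "(N * (1 - x) powr (- s)) powr (1 / (2 * real m)) =
        N powr (1 / (2 * real m)) * (1 - x) powr (- a)"
      using N_nonneg x by (simp add: powr_mult powr_powr a_def s_def minus_divide_left)
    also have "\<dots> \<le> C * (1 - x) powr (- a)"
      by (intro mult_right_mono) (auto simp: C_def)
    finally show ?thesis by (simp add: x_def)
  qed
  with C0 show ?thesis by blast
qed

end

lemma integrable_one_minus_powr:
  fixes a :: real
  assumes "a < 1"
  shows "integrable lborel (\<lambda>t. indicator {0<..<1} t * (C * (1 - t) powr (- a)))"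
proof -
  have "set_integrable lborel {0..1} (\<lambda>t. t powr (1 - 1) * (1 - t) powr ((1 - a) - 1))"
    using assms by (intro integrable_Beta) auto
  then have "set_integrable lborel {0<..<1} (\<lambda>t. t powr (1 - 1) * (1 - t) powr ((1 - a) - 1))"
    by (rule set_integrable_subset) auto
  then have I: "integrable lborel (\<lambda>t. C * (indicator {0<..<1} t *\<^sub>R (t powr (1 - 1)
      * (1 - t) powr ((1 - a) - 1))))"
    unfolding set_integrable_def by (rule integrable_mult_right)
  have eq: "C * (indicator {0<..<1} t *\<^sub>R (t powr (1 - 1) * (1 - t) powr ((1 - a) - 1))) =
      indicator {0<..<1} t * (C * (1 - t) powr (- a))" for t
    by (cases "t \<in> {0<..<1}") simp_all
  show ?thesis using I unfolding eq .
qed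

lemma integrable_dominated_unit_interval:
  fixes g :: "real \<Rightarrow> complex"
  assumes a: "a < 1" and g: "continuous_on {0<..<1} g"
    and bound: "\<And>t. 0 < t \<Longrightarrow> t < 1 \<Longrightarrow> cmod (g t) \<le> C * (1 - t) powr (- a)"
  shows "integrable lborel (\<lambda>t. indicator {0<..<1} t *\<^sub>R g t)"
proof (rule Bochner_Integration.integrable_bound[OF integrable_one_minus_powr[OF a, of C]])
  show "(\<lambda>t. indicator {0<..<1} t *\<^sub>R g t) \<in> borel_measurable lborel"
    using borel_measurable_continuous_on_indicator[OF _ g] by simp
  show "AE t in lborel. norm (indicator {0<..<1} t *\<^sub>R g t) \<le>
      norm (indicator {0<..<1} t * (C * (1 - t) powr (- a)))"
    using bound by (intro AE_I2) (auto simp: indicator_def intro: order_trans[OF _ abs_ge_self])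
qed

section \<open>The deformed path and the integral representation of the operator\<close>

definition comp_op :: "(complex \<Rightarrow> complex) \<Rightarrow> complex \<Rightarrow> real \<Rightarrow> complex" where
  "comp_op f z t = f (of_real t / (1 - of_real (1 - t) * z)) / (1 - of_real (1 - t) * z)"

lemma norm_denominator_ge:
  assumes "cmod z < 1" "0 \<le> t" "t \<le> 1"
  shows "1 - (1 - t) * cmod z \<le> cmod (1 - of_real (1 - t) * z)" "0 < 1 - (1 - t) * cmod z" "t \<le>
      1 - (1 - t) * cmod z"
    "1 - of_real (1 - t) * z \<noteq> 0"
proof -
  have n: "cmod (of_real (1 - t) * z) = (1 - t) * cmod z" using assms
      by (simp add: norm_mult del: of_real_diff)
  show 1: "1 - (1 - t) * cmod z \<le> cmod (1 - of_real (1 - t) * z)"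
    using norm_triangle_ineq2[of 1 "of_real (1 - t) * z"] unfolding n by simp
  have "(1 - t) * cmod z \<le> (1 - t) * 1" using assms by (intro mult_left_mono) auto
  then show 3: "t \<le> 1 - (1 - t) * cmod z" by simp
  have "(1 - t) * cmod z \<le> 1 * cmod z" using assms by (intro mult_right_mono) auto
  then show 2: "0 < 1 - (1 - t) * cmod z" using assms by linarith
  show "1 - of_real (1 - t) * z \<noteq> 0"
    using 1 2 by (metis norm_zero not_less)
qed

text \<open>Keeps the path inside the disk for t < 1 and shows that it approaches the circle no
  faster than a multiple of 1 - t, so that the growth of f becomes the integrable singularity (1 -
  t)^(-a).\<close>

lemma norm_Moebius_le:
  assumes "cmod z < 1" "0 \<le> t" "t \<le> 1"
  shows "(1 - t) * (1 - cmod z) \<le> 1 - cmod (of_real t / (1 - of_real (1 - t) * z))"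
proof -
  define d where "d = 1 - (1 - t) * cmod z"
  note n = norm_denominator_ge[OF assms, folded d_def]
  have "d \<le> 1" using assms by (simp add: d_def)
  have "cmod (of_real t / (1 - of_real (1 - t) * z)) = t / cmod (1 - of_real (1 - t) * z)"
    using assms by (simp add: norm_divide)
  also have "\<dots> \<le> t / d" using n assms by (intro divide_left_mono mult_pos_pos) auto
  finally have "1 - t / d \<le> 1 - cmod (of_real t / (1 - of_real (1 - t) * z))" by simp
  moreover have "1 - t / d = (1 - t) * (1 - cmod z) / d"
    using n by (simp add: field_simps) (simp add: d_def algebra_simps)
  moreover have "(1 - t) * (1 - cmod z) * 1 \<le> (1 - t) * (1 - cmod z) / d"
    using n \<open>d \<le> 1\<close> assms by (simp add: le_divide_eq mult_left_le)
  ultimately show ?thesis by linarith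
qed

context bergman_function
begin

lemma continuous_on_f: "continuous_on (ball 0 1) f"
  using holo by (rule holomorphic_on_imp_continuous_on)

lemma integrable_f: "integrable lborel (\<lambda>t. indicator {0<..<1} t *\<^sub>R f (of_real t))"
proof -
  obtain C where C: "0 \<le> C" "\<And>z. cmod z < 1 \<Longrightarrow> cmod (f z) \<le> C * (1 - cmod z) powr (- a)" using growth
      by blast
  show ?thesis
  proof (rule integrable_dominated_unit_interval[OF a(2)])
    show "continuous_on {0<..<1} (\<lambda>t. f (of_real t))"
      by (rule continuous_on_compose2[OF continuous_on_f]) (auto intro!: continuous_intros)
    show "cmod (f (of_real t)) \<le> C * (1 - t) powr (- a)" if "0 < t" "t < 1" for t
      using C(2)[of "of_real t"] that by simp
  qed
qed

lemma hilbert_op_eq: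
  "hilbert_op f z = (LINT t|lborel. indicator {0<..<1} t *\<^sub>R (f (of_real t) / (1 - of_real t * z)))"
  if z: "cmod z < 1"
proof -
  have nz: "1 - of_real t * z \<noteq> 0" if "t \<in> {0..<1}" for t
    using norm_denominator_ge(4)[of z "1 - t"] that z by simp
  have co: "continuous_on {0..<1} (\<lambda>t. f (of_real t) / (1 - of_real t * z))"
    using nz by (intro continuous_intros continuous_on_compose2[OF continuous_on_f]) auto
  have sub: "{0<..<1::real} \<subseteq> {0..<1}" by auto
  have ae: "AE t in lborel. t \<noteq> (0::real)" by (rule AE_lborel_singleton)
  show ?thesis
    unfolding hilbert_op_def set_lebesgue_integral_def
  proof (rule integral_cong_AE)
    show "(\<lambda>t. indicator {0..<1} t *\<^sub>R (f (of_real t) / (1 - of_real t * z))) \<in> borel_measurable lborel"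
      using borel_measurable_continuous_on_indicator[OF _ co] by simp
    show "(\<lambda>t. indicator {0<..<1} t *\<^sub>R (f (of_real t) / (1 - of_real t * z))) \<in> borel_measurable lborel"
      using borel_measurable_continuous_on_indicator[OF _ continuous_on_subset[OF co sub]] by simp
    show "AE t in lborel. indicator {0..<1} t *\<^sub>R (f (of_real t) / (1 - of_real t * z)) =
        indicator {0<..<1} t *\<^sub>R (f (of_real t) / (1 - of_real t * z))"
      by (rule eventually_mono[OF ae]) (auto simp: indicator_def)
  qed
qed

text \<open>Expand 1 / (1 - t z) geometrically; integrability of f on (0,1) pays for the exchange.
  The resulting power series yields holomorphy of \<open>hilbert_op f\<close>.\<close>

lemma hilbert_op_sums:
  assumes z: "cmod z < 1"
  shows "(\<lambda>n. (LINT t|lborel. indicator {0<..<1} t *\<^sub>R (f (of_real t) * of_real t ^ n)) * z ^ n) sums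
      hilbert_op f z"
proof -
  define K where "K = (LINT t|lborel. norm (indicator {0<..<1} t *\<^sub>R f (of_real t)))"
  define F where "F n t = (indicator {0<..<1} t *\<^sub>R f (of_real t)) * (of_real t * z) ^ n" for n t
  have m0: "(\<lambda>t. indicator {0<..<1} t *\<^sub>R f (of_real t)) \<in> borel_measurable lborel"
    using integrable_f by (rule borel_measurable_integrable)
  have Fn: "norm (F n t) \<le> norm (indicator {0<..<1} t *\<^sub>R f (of_real t)) * cmod z ^ n" for n t
  proof (cases "t \<in> {0<..<1}")
    case True
    then have "(t * cmod z) ^ n \<le> cmod z ^ n" by (intro power_mono) (auto intro: mult_left_le_one_le)
    then show ?thesis using True by (auto simp: F_def norm_mult norm_power intro!: mult_left_mono)
  qed (simp add: F_def)
  have Fi: "integrable lborel (F n)" for n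
  proof (rule Bochner_Integration.integrable_bound)
    show "integrable lborel (\<lambda>t. norm (indicator {0<..<1} t *\<^sub>R f (of_real t)) * cmod z ^ n)"
      using integrable_f by (intro integrable_mult_left integrable_norm)
    show "F n \<in> borel_measurable lborel"
      unfolding F_def[abs_def] by (intro borel_measurable_times m0 borel_measurable_power) measurable
    show "AE t in lborel. norm (F n t) \<le> norm (norm (indicator {0<..<1} t *\<^sub>R f (of_real t)) * cmod z ^ n)"
      using Fn by (intro AE_I2) simp
  qed
  have geo: "summable (\<lambda>n. cmod z ^ n)" using z by (intro summable_geometric) auto
  have "(\<lambda>n. LINT t|lborel. F n t) sums (LINT t|lborel. (\<Sum>n. F n t))"
  proof (rule sums_integral[OF Fi])
    show "AE t in lborel. summable (\<lambda>n. norm (F n t))"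
    proof (rule AE_I2)
      fix t
      show "summable (\<lambda>n. norm (F n t))"
        by (rule summable_comparison_test'[OF summable_mult[OF geo, of "norm (indicator {0<..<1} t *\<^sub>R f
           (of_real t))"]])
          (simp only: real_norm_def abs_norm_cancel Fn)
    qed
    show "summable (\<lambda>n. LINT t|lborel. norm (F n t))"
    proof (rule summable_comparison_test'[OF summable_mult[OF geo, of K]])
      fix n
      have "(LINT t|lborel. norm (F n t)) \<le> (LINT t|lborel. norm (indicator {0<..<1} t *\<^sub>R f
          (of_real t)) * cmod z ^ n)"
        by (rule integral_mono[OF integrable_norm[OF Fi] integrable_mult_left[OF integrable_norm[OF
           integrable_f]] Fn])
      also have "\<dots> = K * cmod z ^ n" by (simp add: K_def)
      finally show "norm (LINT t|lborel. norm (F n t)) \<le> K * cmod z ^ n"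
        by (simp add: integral_nonneg_AE)
    qed
  qed
  also have "(LINT t|lborel. (\<Sum>n. F n t)) = hilbert_op f z"
    unfolding hilbert_op_eq[OF z]
  proof (intro Bochner_Integration.integral_cong refl)
    fix t :: real
    show "(\<Sum>n. F n t) = indicator {0<..<1} t *\<^sub>R (f (of_real t) / (1 - of_real t * z))"
    proof (cases "t \<in> {0<..<1}")
      case True
      have "t * cmod z \<le> 1 * cmod z" using True by (intro mult_right_mono) auto
      then have "cmod (of_real t * z) < 1" using True z by (simp add: norm_mult)
      then show ?thesis
        using True by (simp add: F_def suminf_mult suminf_geometric summable_geometric)
    qed (simp add: F_def)
  qed
  finally have S: "(\<lambda>n. LINT t|lborel. F n t) sums hilbert_op f z" .
  have E: "(LINT t|lborel. F n t) = (LINT t|lborel. indicator {0<..<1} t *\<^sub>R (f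
      (of_real t) * of_real t ^ n)) * z ^ n" for n
  proof -
    have "(LINT t|lborel. F n t) = (LINT t|lborel. (indicator {0<..<1} t *\<^sub>R (f
        (of_real t) * of_real t ^ n)) * z ^ n)"
      by (intro Bochner_Integration.integral_cong refl) (simp add: F_def power_mult_distrib)
    also have "\<dots> = (LINT t|lborel. indicator {0<..<1} t *\<^sub>R (f (of_real t) * of_real t ^ n)) * z ^ n"
      by (rule integral_mult_left_zero)
    finally show ?thesis .
  qed
  show ?thesis using S unfolding E .
qed

lemma hilbert_op_holomorphic: "hilbert_op f holomorphic_on ball 0 1"
  by (rule power_series_holomorphic[where a =
     "\<lambda>n. LINT t|lborel. indicator {0<..<1} t *\<^sub>R (f (of_real t) * of_real t ^ n)"])
     (use hilbert_op_sums in auto)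

lemma continuous_on_comp_op:
  assumes z: "cmod z < 1"
  shows "continuous_on {0..<1} (comp_op f z)"
  unfolding comp_op_def
proof (intro continuous_intros continuous_on_compose2[OF continuous_on_f])
  show "(\<lambda>t. complex_of_real t / (1 - complex_of_real (1 - t) * z)) ` {0..<1} \<subseteq> ball 0 1"
  proof safe
    fix t :: real assume "t \<in> {0..<1}"
    moreover from this z have "0 < (1 - t) * (1 - cmod z)" by auto
    ultimately show "complex_of_real t / (1 - complex_of_real (1 - t) * z) \<in> ball 0 1"
      using norm_Moebius_le[OF z, of t] by auto
  qed
qed (use norm_denominator_ge(4)[OF z] in auto)

lemma comp_op_bound:
  assumes z: "cmod z < 1"
  shows "\<exists>C. \<forall>t. 0 \<le> t \<longrightarrow> t < 1 \<longrightarrow> cmod (comp_op f z t) \<le> C * (1 - t) powr (- a)"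
proof -
  obtain C where C: "0 \<le> C" "\<And>z. cmod z < 1 \<Longrightarrow> cmod (f z) \<le> C * (1 - cmod z) powr (- a)" using growth
      by blast
  have "cmod (comp_op f z t) \<le> (C * (1 - cmod z) powr (- a) / (1 - cmod z)) * (1 - t) powr (- a)"
      if t: "0 \<le> t" "t < 1" for t
  proof -
    define \<phi> where "\<phi> = complex_of_real t / (1 - of_real (1 - t) * z)"
    have pos: "0 < (1 - t) * (1 - cmod z)" using t z by auto
    have le: "(1 - t) * (1 - cmod z) \<le> 1 - cmod \<phi>"
      using norm_Moebius_le[OF z, of t] t by (simp add: \<phi>_def)
    have "cmod (f \<phi>) \<le> C * (1 - cmod \<phi>) powr (- a)" using le pos by (intro C) linarith
    also have "\<dots> \<le> C * ((1 - t) * (1 - cmod z)) powr (- a)"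
      using le pos a C by (intro mult_left_mono powr_mono2') auto
    also have "((1 - t) * (1 - cmod z)) powr (- a) = (1 - t) powr (- a) * (1 - cmod z) powr (- a)"
      using t z by (simp add: powr_mult)
    finally have 1: "cmod (f \<phi>) \<le> C * ((1 - t) powr (- a) * (1 - cmod z) powr (- a))" .
    have "(1 - t) * cmod z \<le> 1 * cmod z" using t by (intro mult_right_mono) auto
    then have 2: "1 - cmod z \<le> cmod (1 - of_real (1 - t) * z)"
      using norm_denominator_ge(1)[OF z, of t] t by linarith
    have "cmod (comp_op f z t) = cmod (f \<phi>) / cmod (1 - of_real (1 - t) * z)"
      by (simp only: comp_op_def \<phi>_def norm_divide)
    also have "\<dots> \<le> C * ((1 - t) powr (- a) * (1 - cmod z) powr (- a)) / (1 - cmod z)"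
      using 1 2 z C by (intro frac_le) auto
    finally show ?thesis by (simp add: mult_ac)
  qed
  then show ?thesis by blast
qed

lemma integrable_comp_op:
  assumes z: "cmod z < 1"
  shows "integrable lborel (\<lambda>t. indicator {0<..<1} t *\<^sub>R comp_op f z t)"
proof -
  obtain C where C: "\<And>t. 0 \<le> t \<Longrightarrow> t < 1 \<Longrightarrow> cmod (comp_op f z t) \<le> C * (1 - t) powr (- a)"
    using comp_op_bound[OF z] by blast
  show ?thesis
    by (rule integrable_dominated_unit_interval[where C =
       C, OF a(2) continuous_on_subset[OF continuous_on_comp_op[OF z]]])
       (use C in auto)
qed

end

context bergman_function
begin

text \<open>
  With a primitive \<open>P\<close> of \<open>f \<zeta> / (1 - \<zeta> z)\<close>, the integrand below is the derivative of
  \<open>P\<close> along the path \<open>t / (1 - (1 - t) z)\<close>; both paths run from \<open>0\<close> to \<open>1\<close>.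
\<close>
lemma hilbert_op_path:
  assumes z: "cmod z < 1"
  shows "hilbert_op f z = (LINT t|lborel. indicator {0<..<1} t *\<^sub>R comp_op f z t)"
proof -
  define F where "F \<zeta> = f \<zeta> / (1 - \<zeta> * z)" for \<zeta>
  have nz: "1 - \<zeta> * z \<noteq> 0" "1 - cmod z \<le> cmod (1 - \<zeta> * z)" if "cmod \<zeta> < 1" for \<zeta>
  proof -
    have "cmod (\<zeta> * z) \<le> 1 * cmod z" unfolding norm_mult using that by (intro mult_right_mono) auto
    then show "1 - cmod z \<le> cmod (1 - \<zeta> * z)" using norm_triangle_ineq2[of 1 "\<zeta> * z"] by simp
    then show "1 - \<zeta> * z \<noteq> 0" using z by auto
  qed
  have holF: "F holomorphic_on ball 0 1"
    unfolding F_def using nz by (intro holomorphic_intros holo) auto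
  then have contF: "continuous_on (ball 0 1) F" by (rule holomorphic_on_imp_continuous_on)
  obtain P where P: "\<And>\<zeta>. \<zeta> \<in> ball 0 1 \<Longrightarrow> (P has_field_derivative F \<zeta>) (at \<zeta> within ball 0 1)"
    by (rule holomorphic_convex_primitive'[OF _ _ holF]) auto
  have P': "(P has_field_derivative F \<zeta>) (at \<zeta>)" if "cmod \<zeta> < 1" for \<zeta>
    using that P[of \<zeta>] at_within_open[of \<zeta> "ball 0 1"] by simp
  define \<phi> where "\<phi> t = of_real t / (1 - of_real (1 - t) * z)" for t
  have \<phi>: "cmod (\<phi> t) < 1" "(1 - t) * (1 - cmod z) \<le> 1 - cmod (\<phi> t)" if "0 \<le> t" "t < 1" for t
  proof -
    show 1: "(1 - t) * (1 - cmod z) \<le> 1 - cmod (\<phi> t)"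
      using norm_Moebius_le[OF z, of t] that by (simp add: \<phi>_def)
    have "0 < (1 - t) * (1 - cmod z)" using that z by auto
    with 1 show "cmod (\<phi> t) < 1" by linarith
  qed
  have I1: "(LINT t|lborel. indicator {0..X} t *\<^sub>R F (of_real t)) = P (of_real X) - P 0"
      if X: "0 \<le> X" "X < 1" for X
  proof -
    have "(LINT t|lborel. indicator {0..X} t *\<^sub>R F (of_real t)) = P (of_real X) - P (of_real 0)"
    proof (rule integral_FTC_atLeastAtMost[OF X(1)])
      fix x :: real assume x: "0 \<le> x" "x \<le> X"
      then have "cmod (of_real x) < 1" using X by simp
      from has_vector_derivative_real_field[OF P'[OF this], of "{0..X}"]
      show "((\<lambda>x. P (of_real x)) has_vector_derivative F (of_real x)) (at x within {0..X})" .
    qed (use X in \<open>auto intro!: continuous_on_compose2[OF contF] continuous_intros\<close>)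
    then show ?thesis by simp
  qed
  have I2: "(LINT t|lborel. indicator {0..X} t *\<^sub>R comp_op f z t) = P (\<phi> X) - P 0"
      if X: "0 \<le> X" "X < 1" for X
  proof -
    have "(LINT t|lborel. indicator {0..X} t *\<^sub>R comp_op f z t) = P (\<phi> X) - P (\<phi> 0)"
    proof (rule integral_FTC_atLeastAtMost[OF X(1)])
      fix x :: real assume x: "0 \<le> x" "x \<le> X"
      have d0: "1 - (1 - of_real x) * z \<noteq> 0" using norm_denominator_ge(4)[OF z, of x] x X by simp
      have z1: "1 - z \<noteq> 0" using z by auto
      have "((\<lambda>w. w / (1 - (1 - w) * z)) has_field_derivative (1 - z) / (1 - (1
          - of_real x) * z)\<^sup>2) (at (of_real x))"
        using d0 by (auto intro!: derivative_eq_intros simp: power2_eq_square field_simps)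
      from has_vector_derivative_real_field[OF this, of "{0..X}"]
      have D: "(\<phi> has_vector_derivative (1 - z) / (1 - (1 - of_real x) * z)\<^sup>2) (at x within {0..X})"
        by (simp add: \<phi>_def[abs_def])
      have "cmod (\<phi> x) < 1" using \<phi>(1)[of x] x X by simp
      from field_vector_diff_chain_within[OF D has_field_derivative_at_within[OF P'[OF this]]]
      have "((P \<circ> \<phi>) has_vector_derivative (1 - z) / (1 - (1
          - of_real x) * z)\<^sup>2 * F (\<phi> x)) (at x within {0..X})" .
      moreover have "(1 - z) / (1 - (1 - of_real x) * z)\<^sup>2 * F (\<phi> x) = comp_op f z x"
      proof -
        define d where "d = 1 - (1 - of_real x) * z"
        \<comment> \<open>The factor 1 - z from the derivative of the path cancels here, and one of
          the two powers of d survives.\<close>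
        have "1 - \<phi> x * z = (1 - z) / d"
          using d0 by (simp add: \<phi>_def d_def[symmetric] field_simps) (simp add: d_def algebra_simps)
        then have "F (\<phi> x) = f (\<phi> x) * d / (1 - z)" by (simp add: F_def)
        then have "(1 - z) / d\<^sup>2 * F (\<phi> x) = f (\<phi> x) / d"
          using d0 z1 by (simp add: d_def[symmetric] power2_eq_square)
        then show ?thesis by (simp add: comp_op_def \<phi>_def d_def)
      qed
      ultimately show "((\<lambda>x. P (\<phi> x)) has_vector_derivative comp_op f z x) (at x within {0..X})"
        by (simp add: o_def)
    qed (use X in \<open>auto intro!: continuous_on_subset[OF continuous_on_comp_op[OF z]]\<close>)
    then show ?thesis by (simp add: \<phi>_def)
  qed
  \<comment> \<open>Since f may be singular at 1, the fundamental theorem of calculus is applied up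
    to X n < 1 only, and n then tends to infinity.\<close>
  define X where "X n = 1 - 1 / (real n + 2)" for n
  have X: "0 \<le> X n" "X n < 1" "1 - X n = 1 / (real n + 2)" for n by (auto simp: X_def field_simps)
  have X_lim: "X \<longlonglongrightarrow> 1"
  proof -
    have "(\<lambda>n. 1 / (real n + 2)) \<longlonglongrightarrow> 0"
      using LIMSEQ_ignore_initial_segment[OF lim_1_over_n, of 2] by (simp add: add.commute)
    then have "(\<lambda>n. 1 - 1 / (real n + 2)) \<longlonglongrightarrow> 1 - 0" by (intro tendsto_diff tendsto_const)
    then show ?thesis by (simp add: X_def[abs_def])
  qed
  have lim: "(\<lambda>n. LINT t|lborel. indicator {0..X n} t *\<^sub>R u t) \<longlonglongrightarrow>
      (LINT t|lborel. indicator {0<..<1} t *\<^sub>R u t)"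
    if u: "integrable lborel (\<lambda>t. indicator {0<..<1} t *\<^sub>R u t)"
        and uc: "continuous_on {0..<1} u" for u :: "real \<Rightarrow> complex"
  proof (rule integral_dominated_convergence)
    show "(\<lambda>t. indicator {0<..<1} t *\<^sub>R u t) \<in> borel_measurable lborel" using u
        by (rule borel_measurable_integrable)
    show "(\<lambda>t. indicator {0..X n} t *\<^sub>R u t) \<in> borel_measurable lborel" for n
    proof -
      have "{0..X n} \<subseteq> {0..<1}" using X[of n] by auto
      then show ?thesis
        using borel_measurable_continuous_on_indicator[OF _ continuous_on_subset[OF uc], of "{0..X n}"]
            by simp
    qed
    show "integrable lborel (\<lambda>t. norm (indicator {0<..<1} t *\<^sub>R u t))" using u by (rule integrable_norm)
    have ae: "AE t in lborel. t \<noteq> (0::real)" by (rule AE_lborel_singleton)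
    show "AE t in lborel. (\<lambda>n. indicator {0..X n} t *\<^sub>R u t) \<longlonglongrightarrow> indicator {0<..<1} t *\<^sub>R u t"
    proof (rule eventually_mono[OF ae])
      fix t :: real assume t0: "t \<noteq> 0"
      show "(\<lambda>n. indicator {0..X n} t *\<^sub>R u t) \<longlonglongrightarrow> indicator {0<..<1} t *\<^sub>R u t"
      proof (cases "t \<in> {0<..<1}")
        case True
        then have "eventually (\<lambda>n. t < X n) sequentially" using X_lim by (auto intro: order_tendstoD)
        then have "eventually (\<lambda>n. indicator {0..X n} t *\<^sub>R u t =
            indicator {0<..<1} t *\<^sub>R u t) sequentially"
          by (rule eventually_mono) (use True in auto)
        then show ?thesis by (rule tendsto_eventually)
      next
        case False
        then have eq: "indicator {0..X n} t *\<^sub>R u t = indicator {0<..<1} t *\<^sub>R u t" for n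
          using t0 X[of n] by (auto simp: indicator_def)
        show ?thesis unfolding eq by (rule tendsto_const)
      qed
    qed
    show "AE t in lborel. norm (indicator {0..X n} t *\<^sub>R u t) \<le> norm (indicator {0<..<1} t *\<^sub>R u t)" for n
      by (rule eventually_mono[OF ae]) (use X[of n] in \<open>auto simp: indicator_def\<close>)
  qed
  obtain C where C: "0 \<le> C" "\<And>z. cmod z < 1 \<Longrightarrow> cmod (f z) \<le> C * (1 - cmod z) powr (- a)" using growth
      by blast
  have F_bound: "cmod (F (of_real t)) \<le> C / (1 - cmod z) * (1 - t) powr (- a)" if "0 < t" "t < 1" for t
  proof -
    have "cmod (F (of_real t)) \<le> (C * (1 - t) powr (- a)) / (1 - cmod z)"
      unfolding F_def norm_divide using that C(2)[of "of_real t"] nz(2)[of "of_real t"] z C(1)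
      by (intro frac_le) auto
    then show ?thesis by simp
  qed
  have contF': "continuous_on {0..<1} (\<lambda>t. F (of_real t))"
    by (intro continuous_on_compose2[OF contF] continuous_intros) auto
  have intF: "integrable lborel (\<lambda>t. indicator {0<..<1} t *\<^sub>R F (of_real t))"
  proof (rule integrable_dominated_unit_interval[OF a(2)])
    show "continuous_on {0<..<1} (\<lambda>t. F (of_real t))" by (rule continuous_on_subset[OF contF']) auto
  qed (rule F_bound)
  have L1: "(\<lambda>n. P (of_real (X n)) - P 0) \<longlonglongrightarrow> hilbert_op f z"
    using lim[OF intF contF'] unfolding I1[OF X(1,2)] unfolding F_def hilbert_op_eq[OF z] .
  have L2: "(\<lambda>n. P (\<phi> (X n)) - P 0) \<longlonglongrightarrow> (LINT t|lborel. indicator {0<..<1} t *\<^sub>R comp_op f z t)"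
    using lim[OF integrable_comp_op[OF z] continuous_on_comp_op[OF z]] unfolding I2[OF X(1,2)] .
  define K where "K = C * (1 - cmod z) powr (- a) / (1 - cmod z) / (1 - cmod z)"
  \<comment> \<open>The truncated paths end at different points. With q = 1 - X n these are O(q)
    apart and F is O(q^(-a)) between them, so the primitives differ by O(q^(1 - a)), which vanishes
    because a < 1.\<close>
  have diff: "cmod (P (\<phi> (X n)) - P (of_real (X n))) \<le> K * (1 - X n) powr (1 - a)" for n
  proof -
    define q where "q = 1 - X n"
    have q: "0 < q" "q \<le> 1" using X[of n] by (auto simp: q_def)
    \<comment> \<open>A radius whose ball contains both end points and on which 1 - |zeta| is still
      at least q (1 - |z|); convexity of the ball permits the mean value bound.\<close>
    define \<rho> where "\<rho> = 1 - q * (1 - cmod z)"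
    have \<rho>: "\<rho> < 1" using q z by (auto simp: \<rho>_def)
    have "q * (1 - cmod z) \<le> q * 1" using q by (intro mult_left_mono) auto
    then have XS: "of_real (X n) \<in> cball (0::complex) \<rho>" using X[of n] by (simp add: \<rho>_def q_def)
    have \<phi>S: "\<phi> (X n) \<in> cball 0 \<rho>" using \<phi>(2)[OF X(1,2), of n] by (simp add: \<rho>_def q_def)
    have S1: "cmod (P (\<phi> (X n)) - P (of_real (X n))) \<le>
        (C * (q * (1 - cmod z)) powr (- a) / (1 - cmod z)) * cmod (\<phi> (X n) - of_real (X n))"
    proof (rule field_differentiable_bound[OF convex_cball _ _ \<phi>S XS])
      fix \<zeta> assume "\<zeta> \<in> cball (0::complex) \<rho>"
      then have \<zeta>: "cmod \<zeta> \<le> \<rho>" by simp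
      then have \<zeta>1: "cmod \<zeta> < 1" using \<rho> by linarith
      show "(P has_field_derivative F \<zeta>) (at \<zeta> within cball 0 \<rho>)"
        using P'[OF \<zeta>1] by (rule has_field_derivative_at_within)
      have "cmod (f \<zeta>) \<le> C * (1 - cmod \<zeta>) powr (- a)" by (rule C(2)[OF \<zeta>1])
      also have "\<dots> \<le> C * (q * (1 - cmod z)) powr (- a)"
        using C(1) a q z \<zeta> by (intro mult_left_mono powr_mono2') (auto simp: \<rho>_def)
      finally show "cmod (F \<zeta>) \<le> C * (q * (1 - cmod z)) powr (- a) / (1 - cmod z)"
        unfolding F_def norm_divide using nz(2)[OF \<zeta>1] z C(1) by (intro frac_le) auto
    qed
    have S2: "cmod (\<phi> (X n) - of_real (X n)) \<le> q / (1 - cmod z)"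
    proof -
      define d where "d = 1 - of_real q * z"
      have d: "1 - cmod z \<le> cmod d" "d \<noteq> 0" using nz[of "of_real q"] norm_denominator_ge[OF z, of "X n"]
          X[of n] q
      proof -
        have "q * cmod z \<le> 1 * cmod z" using q by (intro mult_right_mono) auto
        then show "1 - cmod z \<le> cmod d" "d \<noteq> 0"
          using norm_denominator_ge(1,4)[OF z, of "X n"] X(1,2)[of n] by (simp_all add: d_def q_def)
      qed
      have "\<phi> (X n) = of_real (X n) / d" by (simp add: \<phi>_def d_def q_def)
      then have "\<phi> (X n) - of_real (X n) = of_real (X n) * (1 - d) / d"
        using d(2) by (simp add: diff_divide_distrib right_diff_distrib)
      also have "1 - d = of_real q * z" by (simp add: d_def)
      finally have "\<phi> (X n) - of_real (X n) = of_real (X n) * (of_real q * z) / d" .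
      then have "cmod (\<phi> (X n) - of_real (X n)) = X n * (q * cmod z) / cmod d"
        using X(1)[of n] q by (simp add: norm_mult norm_divide)
      also have "\<dots> \<le> 1 * (q * 1) / (1 - cmod z)"
        using X(1,2)[of n] q z d by (intro frac_le mult_mono) auto
      finally show ?thesis by simp
    qed
    have "cmod (P (\<phi> (X n)) - P (of_real (X n))) \<le>
        (C * (q * (1 - cmod z)) powr (- a) / (1 - cmod z)) * (q / (1 - cmod z))"
      using C(1) z by (intro order_trans[OF S1 mult_left_mono[OF S2]]) auto
    also have "\<dots> = K * (q powr (- a) * q powr 1)"
      using q z by (simp add: K_def powr_mult mult_ac)
    also have "q powr (- a) * q powr 1 = q powr (1 - a)" by (simp only: powr_add[symmetric]) simp
    finally show ?thesis by (simp add: q_def)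
  qed
  have "(\<lambda>n. K * (1 - X n) powr (1 - a)) \<longlonglongrightarrow> K * 0"
  proof (intro tendsto_mult tendsto_const)
    have "(\<lambda>n. (1 - X n) powr (1 - a)) \<longlonglongrightarrow> (1 - 1) powr (1 - a)"
      using X a by (intro tendsto_powr' tendsto_diff tendsto_const X_lim) (auto intro: less_imp_le)
    then show "(\<lambda>n. (1 - X n) powr (1 - a)) \<longlonglongrightarrow> 0" by simp
  qed
  then have "(\<lambda>n. P (\<phi> (X n)) - P (of_real (X n))) \<longlonglongrightarrow> 0"
    by (intro Lim_null_comparison[OF always_eventually[OF allI[OF diff]]]) simp
  moreover have "(\<lambda>n. P (\<phi> (X n)) - P (of_real (X n))) \<longlonglongrightarrow>
      (LINT t|lborel. indicator {0<..<1} t *\<^sub>R comp_op f z t) - hilbert_op f z"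
    using tendsto_diff[OF L2 L1] by simp
  ultimately show ?thesis using LIMSEQ_unique by fastforce
qed

end

section \<open>The upper bound\<close>

lemma norm_powr_of_real:
  assumes "w \<noteq> 0"
  shows "cmod (w powr of_real x) = cmod w powr x"
  using assms by (simp add: powr_def)

text \<open>The tangent to u^p at c lies below the curve, by Bernoulli's inequality. Integrated with
  c the mean value, this yields Jensen's inequality.\<close>

lemma Young_power:
  fixes c u :: real
  assumes "0 \<le> c" "0 \<le> u" "0 < p"
  shows "real p * c ^ (p - 1) * u \<le> u ^ p + (real p - 1) * c ^ p"
proof (cases "c = 0")
  case True
  then show ?thesis using assms by (cases "p = 1") (auto simp: power_0_left)
next
  case False
  then have c: "0 < c" using assms by simp
  have "1 + real p * (u / c - 1) \<le> (1 + (u / c - 1)) ^ p"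
    using c assms by (intro Bernoulli_inequality) (simp add: field_simps)
  then have "c ^ p * (1 + real p * (u / c - 1)) \<le> c ^ p * (u / c) ^ p"
    using c by (intro mult_left_mono) auto
  also have "c ^ p * (u / c) ^ p = u ^ p" using c by (simp add: power_divide)
  also have "c ^ p * (1 + real p * (u / c - 1)) = real p * c ^ (p - 1) * u - (real p - 1) * c ^ p"
  proof -
    have "c ^ p = c * c ^ (p - 1)" using assms by (cases p) auto
    then show ?thesis using c by (simp add: field_simps)
  qed
  finally show ?thesis by simp
qed

context bergman_function
begin

text \<open>
  Up to constants, \<open>b t\<close> is the factor by which \<open>comp_op\<close> scales the critical function
  \<open>(1 - z) powr (- a)\<close> at the boundary point \<open>1\<close>, which makes Jensen's inequality asymptotically sharp.
\<close>

definition b :: "real \<Rightarrow> real" where "b t = t powr (a - 1) * (1 - t) powr (- a)"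

definition B :: real where "B = Beta a (1 - a)"

lemma B_pos: "0 < B" unfolding B_def using a by (intro Beta_real_pos) auto

lemma b_pos: "0 < t \<Longrightarrow> t < 1 \<Longrightarrow> 0 < b t" by (simp add: b_def)

lemma b_measurable [measurable]: "b \<in> borel_measurable borel" unfolding b_def[abs_def] by measurable

lemma nn_integral_b: "(\<integral>\<^sup>+t. Ioo t * ennreal (b t) \<partial>lborel) = ennreal B"
  using nn_integral_Beta[of a "1 - a"] a by (simp add: b_def B_def)

text \<open>As 2 m a = s, the weight is the power b^(-2m). Hence b times the weight, which occurs
  below, is the factor b^(1 - 2m) that Jensen's inequality produces.\<close>

lemma b_power: "0 < t \<Longrightarrow> t < 1 \<Longrightarrow> b t ^ (2 * m) * (t powr (2 * real m - s) * (1 - t) powr s) = 1"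
proof -
  assume t: "0 < t" "t < 1"
  have "b t ^ (2 * m) = (t powr (a - 1)) powr real (2 * m) * ((1 - t) powr (- a)) powr real (2 * m)"
    using t unfolding b_def by (simp add: power_mult_distrib powr_realpow[symmetric])
  also have "\<dots> = t powr ((a - 1) * real (2 * m)) * (1 - t) powr ((- a) * real (2 * m))"
    by (simp only: powr_powr)
  also have "(a - 1) * real (2 * m) = s - 2 * real m" using a(3) by (simp add: algebra_simps)
  also have "(- a) * real (2 * m) = - s" using a(3) by (simp add: algebra_simps)
  finally have "b t ^ (2 * m) * (t powr (2 * real m - s) * (1 - t) powr s) =
      (t powr (s - 2 * real m) * t powr (2 * real m - s)) * ((1 - t) powr (- s) * (1 - t) powr s)" by simp
  also have "\<dots> = 1" using t by (simp add: powr_add[symmetric])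
  finally show ?thesis .
qed

text \<open>Jensen's inequality for |\<open>comp_op\<close>| / b and the probability density b / B,
  applied to the path representation. The right-hand side may be infinite.\<close>

lemma hilbert_op_pointwise:
  assumes z: "cmod z < 1"
  shows "ennreal (cmod (hilbert_op f z) ^ (2 * m)) \<le> ennreal (B ^ (2 * m - 1)) *
    (\<integral>\<^sup>+t. Ioo t * ennreal (b t * (t powr (2 * real m - s)
        * (1 - t) powr s) * cmod (comp_op f z t) ^ (2 * m)) \<partial>lborel)"
    (is "_ \<le> _ * ?J")
proof -
  define p where "p = 2 * m"
  have p: "2 \<le> p" using m by (simp add: p_def)
  define I where "I = (LINT t|lborel. norm (indicator {0<..<1} t *\<^sub>R comp_op f z t))"
  have int: "integrable lborel (\<lambda>t. norm (indicator {0<..<1} t *\<^sub>R comp_op f z t))"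
    using integrable_comp_op[OF z] by (rule integrable_norm)
  have I0: "0 \<le> I" unfolding I_def by (intro integral_nonneg_AE) auto
  have HI: "cmod (hilbert_op f z) \<le> I"
    unfolding hilbert_op_path[OF z] I_def by (rule integral_norm_bound)
  have cm: "(\<lambda>t. indicator {0<..<1} t *\<^sub>R comp_op f z t) \<in> borel_measurable lborel"
    using integrable_comp_op[OF z] by (rule borel_measurable_integrable)
  have nI: "(\<integral>\<^sup>+t. Ioo t * ennreal (cmod (comp_op f z t)) \<partial>lborel) = ennreal I"
  proof -
    have "(\<integral>\<^sup>+t. Ioo t * ennreal (cmod (comp_op f z t)) \<partial>lborel) =
        (\<integral>\<^sup>+t. ennreal (norm (indicator {0<..<1} t *\<^sub>R comp_op f z t)) \<partial>lborel)"
      by (intro nn_integral_cong) (auto split: split_indicator)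
    also have "\<dots> = ennreal I" unfolding I_def by (intro nn_integral_eq_integral int) auto
    finally show ?thesis .
  qed
  \<comment> \<open>The mean of |\<open>comp_op\<close>| / b with respect to b / B, at which the
    tangent is taken.\<close>
  define c where "c = I / B"
  have c: "0 \<le> c" using I0 B_pos by (simp add: c_def)
  have mJ: "(\<lambda>t. Ioo t * ennreal (b t * (t powr (2 * real m - s)
      * (1 - t) powr s) * cmod (comp_op f z t) ^ (2 * m))) \<in> borel_measurable lborel"
  proof -
    have "(\<lambda>t. Ioo t * ennreal (b t * (t powr (2 * real m - s)
        * (1 - t) powr s) * cmod (indicator {0<..<1} t *\<^sub>R comp_op f z t) ^ (2 * m)))
            \<in> borel_measurable lborel"
      using cm by measurable
    also have "(\<lambda>t. Ioo t * ennreal (b t * (t powr (2 * real m - s)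
        * (1 - t) powr s) * cmod (indicator {0<..<1} t *\<^sub>R comp_op f z t) ^ (2 * m))) =
      (\<lambda>t. Ioo t * ennreal (b t * (t powr (2 * real m - s)
          * (1 - t) powr s) * cmod (comp_op f z t) ^ (2 * m)))"
      by (auto simp: fun_eq_iff split: split_indicator)
    finally show ?thesis .
  qed
  have mC: "(\<lambda>t. Ioo t * ennreal (cmod (comp_op f z t))) \<in> borel_measurable lborel"
  proof -
    have "(\<lambda>t. ennreal (norm (indicator {0<..<1} t *\<^sub>R comp_op f z t))) \<in> borel_measurable lborel"
      using cm by measurable
    also have "(\<lambda>t. ennreal (norm (indicator {0<..<1} t *\<^sub>R comp_op f z t))) =
        (\<lambda>t. Ioo t * ennreal (cmod (comp_op f z t)))"
      by (auto simp: fun_eq_iff split: split_indicator)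
    finally show ?thesis .
  qed
  have "ennreal (real p * c ^ (p - 1)) * ennreal I =
      (\<integral>\<^sup>+t. ennreal (real p * c ^ (p - 1)) * (Ioo t * ennreal (cmod (comp_op f z t))) \<partial>lborel)"
    unfolding nI[symmetric] by (rule nn_integral_cmult[symmetric, OF mC])
  also have "\<dots> \<le> (\<integral>\<^sup>+t. Ioo t * ennreal (b t * (t powr (2 * real m - s)
      * (1 - t) powr s) * cmod (comp_op f z t) ^ (2 * m)) +
       ennreal ((real p - 1) * c ^ p) * (Ioo t * ennreal (b t)) \<partial>lborel)"
  proof (intro nn_integral_mono)
    fix t :: real
    show "ennreal (real p * c ^ (p - 1)) * (Ioo t * ennreal (cmod (comp_op f z t))) \<le>
       Ioo t * ennreal (b t * (t powr (2 * real m - s) * (1 - t) powr s) * cmod (comp_op f z t) ^ (2 * m)) +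
       ennreal ((real p - 1) * c ^ p) * (Ioo t * ennreal (b t))"
    proof (cases "t \<in> {0<..<1}")
      case True
      then have t: "0 < t" "t < 1" by auto
      define u where "u = cmod (comp_op f z t) / b t"
      have bt: "0 < b t" using b_pos t by auto
      have u: "0 \<le> u" "cmod (comp_op f z t) = b t * u" using bt by (auto simp: u_def)
      have "b t * (real p * c ^ (p - 1) * u) \<le> b t * (u ^ p + (real p - 1) * c ^ p)"
        using Young_power[OF c u(1), of p] p bt by (intro mult_left_mono) auto
      also have "u ^ p = (t powr (2 * real m - s) * (1 - t) powr s) * cmod (comp_op f z t) ^ (2 * m)"
      proof -
        have "u ^ p * 1 = u ^ p * (b t ^ (2 * m) * (t powr (2 * real m - s) * (1 - t) powr s))"
          by (simp only: b_power[OF t])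
        then show ?thesis unfolding u(2) by (simp add: power_mult_distrib p_def mult_ac)
      qed
      finally have "ennreal (b t * (real p * c ^ (p - 1) * u)) \<le>
         ennreal (b t * (t powr (2 * real m - s) * (1 - t) powr s) * cmod (comp_op f z t) ^ (2 * m)
             + (real p - 1) * c ^ p * b t)"
        by (intro ennreal_leI) (simp add: algebra_simps)
      also have "\<dots> = ennreal (b t * (t powr (2 * real m - s)
          * (1 - t) powr s) * cmod (comp_op f z t) ^ (2 * m)) + ennreal ((real p - 1) * c ^ p * b t)"
        using bt c p by (intro ennreal_plus) auto
      also have "ennreal (b t * (real p * c ^ (p - 1) * u)) =
          ennreal (real p * c ^ (p - 1)) * ennreal (cmod (comp_op f z t))"
        using c u bt by (subst ennreal_mult[symmetric]) (auto simp: mult_ac)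
      also have "ennreal ((real p - 1) * c ^ p * b t) = ennreal ((real p - 1) * c ^ p) * ennreal (b t)"
        using c bt p by (intro ennreal_mult) auto
      finally show ?thesis using True by simp
    qed simp
  qed
  also have "\<dots> = ?J + ennreal ((real p - 1) * c ^ p) * ennreal B"
  proof -
    have "(\<lambda>t. ennreal ((real p - 1) * c ^ p) * (Ioo t * ennreal (b t))) \<in> borel_measurable lborel"
        by measurable
    from nn_integral_add[OF mJ this] show ?thesis
      by (simp add: nn_integral_cmult nn_integral_b)
  qed
  finally have "ennreal (real p * c ^ (p - 1)) * ennreal I \<le>
      ?J + ennreal ((real p - 1) * c ^ p) * ennreal B" .
  moreover have "ennreal (real p * c ^ (p - 1)) * ennreal I =
      ennreal (c ^ p * B) + ennreal ((real p - 1) * c ^ p * B)"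
  proof -
    have "c ^ (p - 1) * I = c ^ p * B"
    proof -
      have "I = c * B" using B_pos by (simp add: c_def)
      moreover have "c ^ p = c ^ (p - 1) * c" using p by (cases p) auto
      ultimately show ?thesis by simp
    qed
    then have "real p * c ^ (p - 1) * I = c ^ p * B + (real p - 1) * c ^ p * B" by (simp add: algebra_simps)
    then show ?thesis
      using c I0 B_pos p by (simp only: ennreal_mult[symmetric] mult_nonneg_nonneg of_nat_0_le_iff
          zero_le_power)
        (subst ennreal_plus, auto)
  qed
  moreover have "ennreal ((real p - 1) * c ^ p) * ennreal B = ennreal ((real p - 1) * c ^ p * B)"
    using c B_pos p by (intro ennreal_mult[symmetric]) auto
  \<comment> \<open>The finite term (p - 1) c^p B stands on both sides and cancels.\<close>
  ultimately have "ennreal (c ^ p * B) \<le> ?J"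
    by (simp add: add.commute ennreal_add_left_cancel_le)
  then have 1: "ennreal (B ^ (p - 1)) * ennreal (c ^ p * B) \<le> ennreal (B ^ (p - 1)) * ?J"
    by (intro mult_left_mono) auto
  have 2: "ennreal (B ^ (p - 1)) * ennreal (c ^ p * B) = ennreal (I ^ p)"
  proof -
    have "B ^ (p - 1) * (c ^ p * B) = (c * B) ^ p"
      using p by (cases p) (auto simp: power_mult_distrib)
    then show ?thesis using B_pos c by (simp add: ennreal_mult[symmetric] c_def)
  qed
  have "ennreal (cmod (hilbert_op f z) ^ p) \<le> ennreal (I ^ p)"
    using HI by (intro ennreal_leI power_mono) auto
  from order_trans[OF this 1[unfolded 2]] show ?thesis by (simp only: p_def)
qed

text \<open>This is where evenness of the exponent enters: the m-th power of \<open>comp_op\<close>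
  is the weighted composition operator with kappa = m applied to \<open>f ^ m\<close>, so that L^2
  methods become available.\<close>

lemma comp_op_power_m:
  assumes z: "cmod z < 1" and t: "0 < t" "t < 1"
  shows "cmod (comp_op f z t) ^ (2 * m) =
    (cmod ((1 - of_real (1 - t) * z) powr (- of_real (real m)) * f (of_real t / (1 - of_real (1
        - t) * z)) ^ m))\<^sup>2"
proof -
  define w where "w = 1 - complex_of_real (1 - t) * z"
  have w: "w \<noteq> 0" using norm_denominator_ge(4)[OF z, of t] t by (simp add: w_def)
  have "w powr (- of_real (real m)) = 1 / w ^ m"
    using w by (simp add: powr_minus powr_nat inverse_eq_divide)
  then have "w powr (- of_real (real m)) * f (of_real t / w) ^ m = comp_op f z t ^ m"
    by (simp add: comp_op_def w_def power_divide)
  then show ?thesis by (simp add: w_def norm_power power_mult[symmetric] mult.commute)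
qed

text \<open>Exchanges kappa = m for kappa = s at the price of |w|^(s - m). As |w| >= t, this is at
  most t^(s - m) because s <= m.\<close>

lemma comp_op_power_s:
  assumes z: "cmod z < 1" and t: "0 < t" "t < 1" and sm: "s \<le> real m"
  shows "cmod (comp_op f z t) ^ (2 * m) \<le> t powr (2 * (s - real m)) *
    (cmod ((1 - of_real (1 - t) * z) powr (- of_real s) * f (of_real t / (1 - of_real (1 - t) * z)) ^ m))\<^sup>2"
proof -
  define w where "w = 1 - complex_of_real (1 - t) * z"
  have w: "w \<noteq> 0" "t \<le> cmod w" using norm_denominator_ge[OF z, of t] t by (auto simp: w_def)
  define F where "F = cmod (f (of_real t / w)) ^ m"
  have F: "0 \<le> F" by (simp add: F_def)
  have nm: "cmod (w powr (- of_real (real m))) = cmod w powr (s - real m) * cmod w powr (- s)"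
    using norm_powr_of_real[OF w(1), of "- real m"] by (simp add: powr_add[symmetric])
  have ns: "cmod (w powr (- of_real s)) = cmod w powr (- s)"
    using norm_powr_of_real[OF w(1), of "- s"] by simp
  have "cmod w powr (s - real m) \<le> t powr (s - real m)"
    using w t sm by (intro powr_mono2') auto
  then have "cmod w powr (s - real m) * (cmod w powr (- s) * F) \<le>
      t powr (s - real m) * (cmod w powr (- s) * F)"
    using F by (intro mult_right_mono) auto
  then have "(cmod w powr (s - real m) * (cmod w powr (- s) * F))\<^sup>2 \<le>
      (t powr (s - real m) * (cmod w powr (- s) * F))\<^sup>2"
    using F by (intro power_mono) auto
  also have "\<dots> = t powr (2 * (s - real m)) * (cmod w powr (- s) * F)\<^sup>2"
  proof -
    have "(t powr (s - real m))\<^sup>2 = t powr (2 * (s - real m))"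
      using t by (simp add: power2_eq_square powr_add[symmetric])
    then show ?thesis by (simp add: power_mult_distrib)
  qed
  finally show ?thesis
    unfolding comp_op_power_m[OF z t] w_def[symmetric] norm_mult nm ns norm_power F_def[symmetric]
    by (simp add: mult.assoc)
qed

end

context bergman_function
begin

lemma nn_integral_comp_op_le:
  assumes t: "0 < t" "t < 1" and \<kappa>: "0 < \<kappa>"
  shows "(\<integral>\<^sup>+z. ennreal ((cmod ((1 - of_real (1 - t) * z) powr (- of_real \<kappa>) * f (of_real t / (1
      - of_real (1 - t) * z)) ^ m))\<^sup>2) \<partial>disk_measure \<alpha>)
    \<le> (\<Sum>n. ennreal ((cmod (c n))\<^sup>2 * fact n / pochhammer \<kappa> n) *
          (\<Sum>j. ennreal ((1 - t) powr (- \<kappa>) * t ^ n *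
             (pochhammer \<kappa> j * pochhammer (\<kappa> + real n) j / (fact j * pochhammer s j) * (1 - t) ^ j))))"
  unfolding s_def by (rule weighted_composition_norm_le[OF \<alpha>(1) \<kappa> t c_sums])

text \<open>With kappa = s the Pochhammer symbols of the operator and of the norm cancel, the sum
  over j is binomial, and the factor t^n disappears. All diagonal entries are then equal and the
  form is a multiple of N.\<close>

lemma comp_op_norm_small_s:
  assumes t: "0 < t" "t < 1" and sm: "s \<le> real m"
  shows "(\<integral>\<^sup>+z. ennreal (cmod (comp_op f z t) ^ (2 * m)) \<partial>disk_measure \<alpha>) \<le>
      ennreal (t powr (s - 2 * real m) * (1 - t) powr (- s)) * ennreal N"
proof -
  define q where "q = 1 - t"
  have q: "0 < q" "q < 1" using t by (auto simp: q_def)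
  have s0: "0 < s" using s by simp
  have inner: "(\<Sum>j. ennreal (q powr (- s) * t ^ n *
             (pochhammer s j * pochhammer (s + real n) j / (fact j * pochhammer s j) * q ^ j))) =
                 ennreal (q powr (- s) * t powr (- s))" for n
  proof -
    have "q powr (- s) * t ^ n * (pochhammer s j * pochhammer (s
        + real n) j / (fact j * pochhammer s j) * q ^ j) =
        (q powr (- s) * t ^ n) * (pochhammer (s + real n) j / fact j * q ^ j)" for j
      using pochhammer_pos[OF s0, of j] by simp
    then have "(\<Sum>j. ennreal (q powr (- s) * t ^ n *
             (pochhammer s j * pochhammer (s + real n) j / (fact j * pochhammer s j) * q ^ j))) =
        (\<Sum>j. ennreal (q powr (- s) * t ^ n) * ennreal (pochhammer (s + real n) j / fact j * q ^ j))"
      using t by (simp only:) (subst ennreal_mult', auto)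
    also have "\<dots> = ennreal (q powr (- s) * t ^ n) * ennreal ((1 - q) powr (- (s + real n)))"
      using s0 q by (simp only: ennreal_suminf_cmult binomial_series_ennreal add_pos_nonneg
          of_nat_0_le_iff less_imp_le)
    also have "\<dots> = ennreal (q powr (- s) * t ^ n * t powr (- (s + real n)))"
      using t by (simp add: ennreal_mult' q_def)
    also have "q powr (- s) * t ^ n * t powr (- (s + real n)) =
        q powr (- s) * (t powr real n * t powr (- (s + real n)))"
      using t by (simp add: powr_realpow)
    also have "t powr real n * t powr (- (s + real n)) = t powr (- s)"
      by (simp only: powr_add[symmetric]) simp
    finally show ?thesis .
  qed
  have "(\<integral>\<^sup>+z. ennreal (cmod (comp_op f z t) ^ (2 * m)) \<partial>disk_measure \<alpha>) \<le>
     (\<integral>\<^sup>+z. ennreal (t powr (2 * (s - real m))) *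
       ennreal ((cmod ((1 - of_real (1 - t) * z) powr (- of_real s) * f (of_real t / (1 - of_real (1
           - t) * z)) ^ m))\<^sup>2) \<partial>disk_measure \<alpha>)"
    using comp_op_power_s[OF _ t sm] by (intro nn_integral_mono)
        (simp add: ennreal_mult'[symmetric] ennreal_leI)
  also have "\<dots> = ennreal (t powr (2 * (s - real m))) *
     (\<integral>\<^sup>+z. ennreal ((cmod ((1 - of_real (1 - t) * z) powr (- of_real s) * f (of_real t / (1 - of_real (1
         - t) * z)) ^ m))\<^sup>2) \<partial>disk_measure \<alpha>)"
  proof (rule nn_integral_cmult)
    \<comment> \<open>A power series that agrees with the integrand's base on the disk; its
      holomorphy provides measurability.\<close>
    define h where "h z = (\<Sum>j. (\<Sum>n. c n * of_real (t ^ n * (1 - t) ^ j * pochhammer (s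
        + real n) j / fact j)) * z ^ j)" for z
    have "h holomorphic_on ball 0 1"
    proof (rule power_series_holomorphic)
      fix w :: complex assume "w \<in> ball 0 1"
      then have "cmod w < 1" by simp
      from weighted_composition_coefficients(1)[OF s0 t c_sums this]
      show "(\<lambda>j. (\<Sum>n. c n * of_real (t ^ n * (1 - t) ^ j * pochhammer (s + real n) j / fact j))
          * (w - 0) ^ j) sums h w"
        by (simp add: h_def sums_iff)
    qed
    then have "h \<in> borel_measurable (disk_measure \<alpha>)"
      by (intro continuous_on_imp_measurable_disk holomorphic_on_imp_continuous_on)
    moreover have "h z = (1 - of_real (1 - t) * z) powr (- of_real s) * f (of_real t / (1 - of_real (1
        - t) * z)) ^ m"
      if "z \<in> space (disk_measure \<alpha>)" for z
      using weighted_composition_coefficients(1)[OF s0 t c_sums, of z] that by (simp add: h_def sums_iff)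
    ultimately show "(\<lambda>z. ennreal ((cmod ((1 - of_real (1 - t) * z) powr (- of_real s) * f (of_real t / (1
        - of_real (1 - t) * z)) ^ m))\<^sup>2)) \<in> borel_measurable (disk_measure \<alpha>)"
      by (subst measurable_cong[where g = "\<lambda>z. ennreal ((cmod (h z))\<^sup>2)"]) auto
  qed
  also have "\<dots> \<le> ennreal (t powr (2 * (s - real m)))
      * (\<Sum>n. ennreal ((cmod (c n))\<^sup>2 * fact n / pochhammer s n) * ennreal (q powr (- s) * t powr (- s)))"
    using nn_integral_comp_op_le[OF t s0] unfolding inner[unfolded q_def] q_def
        by (rule mult_left_mono) simp
  also have "\<dots> = ennreal (t powr (2 * (s - real m))) * (ennreal N * ennreal (q powr (- s) * t powr (- s)))"
    unfolding N_series[symmetric] by simp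
  also have "\<dots> = ennreal (t powr (s - 2 * real m) * q powr (- s)) * ennreal N"
  proof -
    have gen: "ennreal x * (ennreal N * ennreal y) = ennreal (x * y) * ennreal N" if "0 \<le> x" for x y
      using that by (simp add: ennreal_mult' mult_ac)
    have "t powr (2 * (s - real m)) * t powr (- s) = t powr (s - 2 * real m)"
      by (simp only: powr_add[symmetric]) (simp add: algebra_simps)
    then have "t powr (2 * (s - real m)) * (q powr (- s) * t powr (- s)) =
        t powr (s - 2 * real m) * q powr (- s)"
      by (metis mult.assoc mult.commute)
    then show ?thesis by (simp only: gen powr_ge_zero)
  qed
  finally show ?thesis by (simp add: q_def)
qed

text \<open>For s <= m the weight cancels the bound at every t, leaving the integral of b. For s > m
  only the average of each diagonal entry is bounded, so the sum over n is pulled out of the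
  integral first.\<close>

lemma averaged_comp_op_norm:
  assumes m5: "m \<in> {2, 3, 4, 5}"
  shows "(\<integral>\<^sup>+t. Ioo t * (ennreal (b t * (t powr (2 * real m - s) * (1 - t) powr s)) *
      (\<integral>\<^sup>+z. ennreal (cmod (comp_op f z t) ^ (2 * m)) \<partial>disk_measure \<alpha>)) \<partial>lborel) \<le> ennreal B * ennreal N"
proof (cases "s \<le> real m")
  case True
  have "(\<integral>\<^sup>+t. Ioo t * (ennreal (b t * (t powr (2 * real m - s) * (1 - t) powr s)) *
      (\<integral>\<^sup>+z. ennreal (cmod (comp_op f z t) ^ (2 * m)) \<partial>disk_measure \<alpha>)) \<partial>lborel) \<le>
      (\<integral>\<^sup>+t. Ioo t * ennreal (b t) * ennreal N \<partial>lborel)"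
  proof (intro nn_integral_mono)
    fix t :: real
    show "Ioo t * (ennreal (b t * (t powr (2 * real m - s) * (1 - t) powr s)) *
      (\<integral>\<^sup>+z. ennreal (cmod (comp_op f z t) ^ (2 * m)) \<partial>disk_measure \<alpha>)) \<le> Ioo t * ennreal (b t) * ennreal N"
    proof (cases "t \<in> {0<..<1}")
      case t: True
      then have t': "0 < t" "t < 1" by auto
      define W where "W = t powr (2 * real m - s) * (1 - t) powr s"
      define V where "V = t powr (s - 2 * real m) * (1 - t) powr (- s)"
      have "W * V = 1"
      proof -
        have "W * V = (t powr (2 * real m - s) * t powr (s - 2 * real m)) * ((1 - t) powr s
            * (1 - t) powr (- s))"
          by (simp add: W_def V_def)
        also have "\<dots> = 1" using t' by (simp add: powr_add[symmetric])
        finally show ?thesis .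
      qed
      have "ennreal (b t * W) * (\<integral>\<^sup>+z. ennreal (cmod (comp_op f z t) ^ (2 * m)) \<partial>disk_measure \<alpha>) \<le>
          ennreal (b t * W) * (ennreal V * ennreal N)"
        unfolding V_def by (intro mult_left_mono comp_op_norm_small_s t' True) auto
      also have "\<dots> = ennreal (b t * (W * V)) * ennreal N"
        using b_pos[OF t'] by (simp add: ennreal_mult'[symmetric] mult.assoc[symmetric] W_def)
      finally show ?thesis using t \<open>W * V = 1\<close> by (simp add: W_def)
    qed simp
  qed
  also have "\<dots> = ennreal B * ennreal N"
    by (subst nn_integral_multc) (measurable, simp only: nn_integral_b)
  finally show ?thesis .
next
  case False
  have m0: "0 < real m" using m by simp
  \<comment> \<open>Multiplied by the ratio of Pochhammer symbols from
    \<open>averaged_composition_bound\<close>, these become the terms of the series for N.\<close>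
  define A where "A n = (cmod (c n))\<^sup>2 * fact n / pochhammer (real m) n" for n
  have A0: "0 \<le> A n" for n using pochhammer_pos[OF m0, of n] by (simp add: A_def)
  define K where "K n t = (\<Sum>j. ennreal ((1 - t) powr (- real m) * t ^ n *
        (pochhammer (real m) j * pochhammer (real m + real n) j / (fact j * pochhammer s j)
            * (1 - t) ^ j)))" for n t
  have [measurable]: "K n \<in> borel_measurable borel" for n
    unfolding K_def[abs_def] by measurable
  have "(\<integral>\<^sup>+t. Ioo t * (ennreal (b t * (t powr (2 * real m - s) * (1 - t) powr s)) *
      (\<integral>\<^sup>+z. ennreal (cmod (comp_op f z t) ^ (2 * m)) \<partial>disk_measure \<alpha>)) \<partial>lborel) \<le>
      (\<integral>\<^sup>+t. (\<Sum>n. ennreal (A n) * (Ioo t * (ennreal (b t * (t powr (2 * real m - s)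
          * (1 - t) powr s)) * K n t))) \<partial>lborel)"
  proof (intro nn_integral_mono)
    fix t :: real
    show "Ioo t * (ennreal (b t * (t powr (2 * real m - s) * (1 - t) powr s)) *
      (\<integral>\<^sup>+z. ennreal (cmod (comp_op f z t) ^ (2 * m)) \<partial>disk_measure \<alpha>)) \<le>
      (\<Sum>n. ennreal (A n) * (Ioo t * (ennreal (b t * (t powr (2 * real m - s) * (1 - t) powr s)) * K n t)))"
    proof (cases "t \<in> {0<..<1}")
      case True
      then have t: "0 < t" "t < 1" by auto
      have "(\<integral>\<^sup>+z. ennreal (cmod (comp_op f z t) ^ (2 * m)) \<partial>disk_measure \<alpha>) =
        (\<integral>\<^sup>+z. ennreal ((cmod ((1 - of_real (1 - t) * z) powr (- of_real (real m)) * f (of_real t / (1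
            - of_real (1 - t) * z)) ^ m))\<^sup>2) \<partial>disk_measure \<alpha>)"
        using comp_op_power_m[OF _ t] by (intro nn_integral_cong) auto
      also have "\<dots> \<le> (\<Sum>n. ennreal (A n) * K n t)"
        unfolding A_def K_def by (rule nn_integral_comp_op_le[OF t m0])
      finally have "ennreal (b t * (t powr (2 * real m - s) * (1 - t) powr s)) *
          (\<integral>\<^sup>+z. ennreal (cmod (comp_op f z t) ^ (2 * m)) \<partial>disk_measure \<alpha>) \<le>
          ennreal (b t * (t powr (2 * real m - s) * (1 - t) powr s)) * (\<Sum>n. ennreal (A n) * K n t)"
        by (intro mult_left_mono) auto
      also have "\<dots> = (\<Sum>n. ennreal (A n) * (ennreal (b t * (t powr (2 * real m - s)
          * (1 - t) powr s)) * K n t))"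
        by (simp only: ennreal_suminf_cmult[symmetric] mult.left_commute)
      finally show ?thesis using True by simp
    qed simp
  qed
  also have "\<dots> = (\<Sum>n. \<integral>\<^sup>+t. ennreal (A n) * (Ioo t * (ennreal (b t * (t powr (2 * real m - s)
      * (1 - t) powr s)) * K n t)) \<partial>lborel)"
    by (rule nn_integral_suminf) measurable
  also have "\<dots> = (\<Sum>n. ennreal (A n) * (\<integral>\<^sup>+t. Ioo t * (ennreal (b t * (t powr (2 * real m - s)
      * (1 - t) powr s)) * K n t) \<partial>lborel))"
    by (intro suminf_cong nn_integral_cmult) measurable
  also have "\<dots> \<le> (\<Sum>n. ennreal (A n) * ennreal (B * (pochhammer (real m) n / pochhammer s n)))"
  proof (intro suminf_le allI mult_left_mono)
    fix n
    have "(\<integral>\<^sup>+t. Ioo t * (ennreal (t powr (s / (2 * real m) - 1)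
        * (1 - t) powr (- (s / (2 * real m))) * t powr (2 * real m - s) * (1 - t) powr s) * K n t) \<partial>lborel)
       \<le> ennreal (Beta (s / (2 * real m)) (1 - s / (2 * real m))
           * (pochhammer (real m) n / pochhammer s n))"
      unfolding K_def by (rule averaged_composition_bound) (use m5 False s in auto)
    then show "(\<integral>\<^sup>+t. Ioo t * (ennreal (b t * (t powr (2 * real m - s) * (1 - t) powr s)) * K n t) \<partial>lborel)
      \<le> ennreal (B * (pochhammer (real m) n / pochhammer s n))"
      by (simp add: b_def B_def a_def s_def mult.assoc)
  qed auto
  also have "\<dots> = (\<Sum>n. ennreal B * ennreal ((cmod (c n))\<^sup>2 * (fact n / pochhammer s n)))"
  proof (intro suminf_cong)
    fix n
    have "0 < pochhammer (real m) n" using m0 by (intro pochhammer_pos)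
    then have "A n * (B * (pochhammer (real m) n / pochhammer s n)) =
        B * ((cmod (c n))\<^sup>2 * (fact n / pochhammer s n))"
      by (simp add: A_def)
    then show "ennreal (A n) * ennreal (B * (pochhammer (real m) n / pochhammer s n)) =
        ennreal B * ennreal ((cmod (c n))\<^sup>2 * (fact n / pochhammer s n))"
      using A0[of n] B_pos by (simp only: ennreal_mult'[symmetric] less_imp_le)
  qed
  also have "\<dots> = ennreal B * ennreal N" by (simp only: ennreal_suminf_cmult N_series)
  finally show ?thesis .
qed

text \<open>Needed for Fubini. \<open>comp_op\<close> is jointly continuous on the open set
  \<open>U\<close>, so its extension \<open>G\<close> by zero is Borel, and the two integrands agree
  on the product space.\<close>

lemma comp_op_jointly_measurable:
  "(\<lambda>(t, z). Ioo t * ennreal (b t * (t powr (2 * real m - s)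
      * (1 - t) powr s) * cmod (comp_op f z t) ^ (2 * m)))
    \<in> borel_measurable (lborel \<Otimes>\<^sub>M disk_measure \<alpha>)"
proof -
  define U where "U = {0<..<1::real} \<times> ball (0::complex) 1"
  define G where "G p = indicator U p *\<^sub>R comp_op f (snd p) (fst p)" for p
  have nz: "1 - of_real (1 - fst p) * snd p \<noteq> 0" if "p \<in> U" for p
    using norm_denominator_ge(4)[of "snd p" "fst p"] that by (auto simp: U_def)
  have "continuous_on U (\<lambda>p. comp_op f (snd p) (fst p))"
    unfolding comp_op_def
  proof (intro continuous_intros continuous_on_compose2[OF continuous_on_f])
    show "(\<lambda>p. complex_of_real (fst p) / (1 - complex_of_real (1 - fst p) * snd p)) ` U \<subseteq> ball 0 1"
    proof safe
      fix t :: real and z :: complex assume "(t, z) \<in> U"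
      then have tz: "0 < t" "t < 1" "cmod z < 1" by (auto simp: U_def)
      then have "0 < (1 - t) * (1 - cmod z)" by auto
      then have "cmod (of_real t / (1 - of_real (1 - t) * z)) < 1"
        using norm_Moebius_le[of z t] tz by linarith
      then show "complex_of_real (fst (t, z)) / (1 - complex_of_real (1 - fst (t, z)) * snd (t, z))
          \<in> ball 0 1"
        by simp
    qed
  qed (use nz in auto)
  moreover have "U \<in> sets borel" unfolding U_def by (intro borel_open open_Times) auto
  ultimately have G: "G \<in> borel_measurable borel"
    unfolding G_def[abs_def] by (intro borel_measurable_continuous_on_indicator)
  have id: "(\<lambda>p. (fst p, snd p)) \<in> lborel \<Otimes>\<^sub>M disk_measure \<alpha> \<rightarrow>\<^sub>M (borel :: (real \<times> complex) measure)"
  proof -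
    have "snd \<in> lborel \<Otimes>\<^sub>M disk_measure \<alpha> \<rightarrow>\<^sub>M borel"
      using measurable_compose[OF measurable_snd[of lborel "disk_measure \<alpha>"]
          borel_measurable_disk_measureI[OF measurable_ident_sets[OF refl], of \<alpha>]] by simp
    moreover have "fst \<in> lborel \<Otimes>\<^sub>M disk_measure \<alpha> \<rightarrow>\<^sub>M borel"
      using measurable_fst[of lborel "disk_measure \<alpha>"] by simp
    ultimately show ?thesis unfolding borel_prod[symmetric] by (rule measurable_Pair[rotated])
  qed
  have M: "(\<lambda>p. Ioo (fst p) * ennreal (b (fst p) * (fst p powr (2 * real m - s)
      * (1 - fst p) powr s) * cmod (G (fst p, snd p)) ^ (2 * m)))
    \<in> borel_measurable (lborel \<Otimes>\<^sub>M disk_measure \<alpha>)"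
  proof -
    have [measurable]: "(\<lambda>p. G (fst p, snd p)) \<in> borel_measurable (lborel \<Otimes>\<^sub>M disk_measure \<alpha>)"
      by (rule measurable_compose[OF id G])
    show ?thesis by measurable
  qed
  have E: "Ioo t * ennreal (b t * (t powr (2 * real m - s) * (1 - t) powr s) * cmod (G (t, z)) ^ (2 * m)) =
      Ioo t * ennreal (b t * (t powr (2 * real m - s) * (1 - t) powr s) * cmod (comp_op f z t) ^ (2 * m))"
    if "z \<in> ball 0 1" for t z
  proof (cases "t \<in> {0<..<1}")
    case True
    then have "G (t, z) = comp_op f z t" using that by (simp add: G_def U_def)
    then show ?thesis by (simp only:)
  qed simp
  have "(\<lambda>p. Ioo (fst p) * ennreal (b (fst p) * (fst p powr (2 * real m - s)
      * (1 - fst p) powr s) * cmod (G (fst p, snd p)) ^ (2 * m)))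
    \<in> borel_measurable (lborel \<Otimes>\<^sub>M disk_measure \<alpha>) \<longleftrightarrow> ?thesis"
  proof (rule measurable_cong)
    fix p :: "real \<times> complex" assume "p \<in> space (lborel \<Otimes>\<^sub>M disk_measure \<alpha>)"
    then obtain t z where p: "p = (t, z)" and z: "z \<in> ball 0 1" by (auto simp: space_pair_measure)
    show "Ioo (fst p) * ennreal (b (fst p) * (fst p powr (2 * real m - s)
        * (1 - fst p) powr s) * cmod (G (fst p, snd p)) ^ (2 * m)) =
        (case p of (t, z) \<Rightarrow> Ioo t * ennreal (b t * (t powr (2 * real m - s)
            * (1 - t) powr s) * cmod (comp_op f z t) ^ (2 * m)))"
      unfolding p fst_conv snd_conv prod.case by (rule E[OF z])
  qed
  from this[THEN iffD1, OF M] show ?thesis .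
qed

lemma nn_integral_hilbert_op_le:
  assumes m5: "m \<in> {2, 3, 4, 5}"
  shows "(\<integral>\<^sup>+z. ennreal (cmod (hilbert_op f z) ^ (2 * m)) \<partial>disk_measure \<alpha>) \<le> ennreal (B ^ (2 * m) * N)"
proof -
  interpret D: finite_measure "disk_measure \<alpha>" by (rule finite_measure_disk_measure[OF \<alpha>(1)])
  interpret P: pair_sigma_finite lborel "disk_measure \<alpha>" by unfold_locales
  let ?w = "\<lambda>t. b t * (t powr (2 * real m - s) * (1 - t) powr s)"
  let ?H = "\<lambda>t z. Ioo t * ennreal (?w t * cmod (comp_op f z t) ^ (2 * m))"
  note meas = comp_op_jointly_measurable
  have meas_z: "(\<lambda>z. \<integral>\<^sup>+t. ?H t z \<partial>lborel) \<in> borel_measurable (disk_measure \<alpha>)"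
    using measurable_pair_swap[OF meas] by (intro lborel.borel_measurable_nn_integral)
        (simp add: case_prod_unfold)
  have "(\<integral>\<^sup>+z. ennreal (cmod (hilbert_op f z) ^ (2 * m)) \<partial>disk_measure \<alpha>) \<le>
      (\<integral>\<^sup>+z. ennreal (B ^ (2 * m - 1)) * (\<integral>\<^sup>+t. ?H t z \<partial>lborel) \<partial>disk_measure \<alpha>)"
    using hilbert_op_pointwise by (intro nn_integral_mono) simp
  also have "\<dots> = ennreal (B ^ (2 * m - 1)) * (\<integral>\<^sup>+z. \<integral>\<^sup>+t. ?H t z \<partial>lborel \<partial>disk_measure \<alpha>)"
    by (rule nn_integral_cmult[OF meas_z])
  also have "(\<integral>\<^sup>+z. \<integral>\<^sup>+t. ?H t z \<partial>lborel \<partial>disk_measure \<alpha>) = (\<integral>\<^sup>+t. \<integral>\<^sup>+z. ?H t z \<partial>disk_measure \<alpha> \<partial>lborel)"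
    by (rule P.Fubini'[OF meas])
  also have "\<dots> = (\<integral>\<^sup>+t. Ioo t * (ennreal (?w t)
      * (\<integral>\<^sup>+z. ennreal (cmod (comp_op f z t) ^ (2 * m)) \<partial>disk_measure \<alpha>)) \<partial>lborel)"
  proof (rule nn_integral_cong)
    fix t :: real
    show "(\<integral>\<^sup>+z. ?H t z \<partial>disk_measure \<alpha>) = Ioo t * (ennreal (?w t)
        * (\<integral>\<^sup>+z. ennreal (cmod (comp_op f z t) ^ (2 * m)) \<partial>disk_measure \<alpha>))"
    proof (cases "t \<in> {0<..<1}")
      case True
      then have wt: "0 < ?w t" using b_pos[of t] by simp
      have "Pair t \<in> disk_measure \<alpha> \<rightarrow>\<^sub>M lborel \<Otimes>\<^sub>M disk_measure \<alpha>"
        by (rule measurable_Pair1') simp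
      from measurable_compose[OF this meas]
      have "(\<lambda>z. ?H t z) \<in> borel_measurable (disk_measure \<alpha>)" by (simp only: prod.case)
      \<comment> \<open>Dividing a section by its positive weight yields measurability of the bare
        power, so that the weight can be taken out of the integral.\<close>
      then have "(\<lambda>z. ennreal (1 / ?w t) * ?H t z) \<in> borel_measurable (disk_measure \<alpha>)"
        by (rule borel_measurable_times_ennreal[OF borel_measurable_const])
      also have "(\<lambda>z. ennreal (1 / ?w t) * ?H t z) = (\<lambda>z. ennreal (cmod (comp_op f z t) ^ (2 * m)))"
      proof (rule ext)
        fix z
        have "ennreal (1 / ?w t) * ?H t z = ennreal (1 / ?w t * (?w t * cmod (comp_op f z t) ^ (2 * m)))"
          using True wt by (subst ennreal_mult') auto
        also have "1 / ?w t * (?w t * cmod (comp_op f z t) ^ (2 * m)) = cmod (comp_op f z t) ^ (2 * m)"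
        proof -
          have "1 / W * (W * x) = x" if "0 < W" for W x :: real using that by simp
          from this[OF wt] show ?thesis .
        qed
        finally show "ennreal (1 / ?w t) * ?H t z = ennreal (cmod (comp_op f z t) ^ (2 * m))" .
      qed
      finally have "(\<integral>\<^sup>+z. ennreal (?w t) * ennreal (cmod (comp_op f z t) ^ (2 * m)) \<partial>disk_measure \<alpha>) =
          ennreal (?w t) * (\<integral>\<^sup>+z. ennreal (cmod (comp_op f z t) ^ (2 * m)) \<partial>disk_measure \<alpha>)"
        by (rule nn_integral_cmult)
      then show ?thesis using True wt by (simp add: ennreal_mult')
    qed simp
  qed
  also have "ennreal (B ^ (2 * m - 1)) * \<dots> \<le> ennreal (B ^ (2 * m - 1)) * (ennreal B * ennreal N)"
    by (intro mult_left_mono averaged_comp_op_norm[OF m5]) auto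
  also have "\<dots> = ennreal (B ^ (2 * m) * N)"
  proof -
    have "B ^ (2 * m - 1) * (B * N) = B ^ (2 * m) * N"
      using m by (simp add: mult.assoc[symmetric] power_Suc2[symmetric] del: power_Suc power_Suc2)
    then show ?thesis using B_pos N_nonneg by (simp add: ennreal_mult[symmetric])
  qed
  finally show ?thesis .
qed

end

section \<open>The lower bound\<close>

definition pow_fun :: "real \<Rightarrow> complex \<Rightarrow> complex" where
  "pow_fun \<delta> z = (1 - z) powr (- of_real \<delta>)"

lemma Re_one_minus_pos: "cmod z < 1 \<Longrightarrow> 0 < Re (1 - z)"
  using complex_Re_le_cmod[of z] by simp

lemma pow_fun_holomorphic: "pow_fun \<delta> holomorphic_on ball 0 1"
  unfolding pow_fun_def
proof (intro holomorphic_intros)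
  fix z :: complex assume "z \<in> ball 0 1"
  then have "0 < Re (1 - z)" by (intro Re_one_minus_pos) simp
  then show "1 - z \<notin> \<real>\<^sub>\<le>\<^sub>0" using complex_nonpos_Reals_iff by (auto simp del: minus_complex.simps)
qed

lemma norm_pow_fun: "cmod z < 1 \<Longrightarrow> cmod (pow_fun \<delta> z) = cmod (1 - z) powr (- \<delta>)"
  using norm_powr_of_real[of "1 - z" "- \<delta>"] by (cases "z = 1") (auto simp: pow_fun_def)

text \<open>Parseval turns the norm into a Gauss sum; 2 sigma < alpha + 2 is its convergence
  condition.\<close>

lemma nn_integral_pow_fun:
  assumes \<alpha>: "-1 < \<alpha>" and \<sigma>: "0 < \<sigma>" "2 * \<sigma> < \<alpha> + 2"
  shows "(\<integral>\<^sup>+z. ennreal ((cmod (pow_fun \<sigma> z))\<^sup>2) \<partial>disk_measure \<alpha>) =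
    ennreal (Gamma (\<alpha> + 2 - 2 * \<sigma>) * Gamma (\<alpha> + 2) / (Gamma (\<alpha> + 2 - \<sigma>))\<^sup>2)"
proof -
  define s where "s = \<alpha> + 2"
  have s: "2 * \<sigma> < s" "0 < s" using \<alpha> \<sigma> by (auto simp: s_def)
  have Bp: "0 < Beta \<sigma> (s - \<sigma>)" using s \<sigma> by (intro Beta_real_pos) auto
  have "(\<integral>\<^sup>+z. ennreal ((cmod (pow_fun \<sigma> z))\<^sup>2) \<partial>disk_measure \<alpha>) =
      (\<Sum>n. ennreal ((cmod (of_real (pochhammer \<sigma> n / fact n)))\<^sup>2 * (fact n / pochhammer (\<alpha> + 2) n)))"
    unfolding pow_fun_def by (rule power_series_disk_norm[OF \<alpha> binomial_series_complex])
  also have "\<dots> = (\<Sum>n. ennreal (1 / Beta \<sigma> (s - \<sigma>)) * ennreal (pochhammer \<sigma> n / fact n * Beta (\<sigma>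
      + real n) (s - \<sigma>)))"
  proof (intro suminf_cong)
    fix n
    have p: "0 < pochhammer \<sigma> n" "0 < pochhammer s n" using \<sigma> s by (auto intro: pochhammer_pos)
    have "Beta (\<sigma> + real n) (s - \<sigma>) = Beta \<sigma> (s - \<sigma>) * pochhammer \<sigma> n / pochhammer s n"
      using Beta_add_nat_left[of \<sigma> "s - \<sigma>" n] \<sigma> s by simp
    then have "(cmod (of_real (pochhammer \<sigma> n / fact n)))\<^sup>2 * (fact n / pochhammer (\<alpha> + 2) n) =
        1 / Beta \<sigma> (s - \<sigma>) * (pochhammer \<sigma> n / fact n * Beta (\<sigma> + real n) (s - \<sigma>))"
      using p Bp by (simp add: s_def power2_eq_square norm_divide norm_of_real del: of_real_divide)
    then show "ennreal ((cmod (of_real (pochhammer \<sigma> n / fact n)))\<^sup>2 * (fact n / pochhammer (\<alpha> + 2) n)) =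
      ennreal (1 / Beta \<sigma> (s - \<sigma>)) * ennreal (pochhammer \<sigma> n / fact n * Beta (\<sigma> + real n) (s - \<sigma>))"
      using Bp by (simp only: ennreal_mult'[symmetric] divide_nonneg_pos zero_le_one)
  qed
  also have "\<dots> = ennreal (1 / Beta \<sigma> (s - \<sigma>)) * ennreal (Beta \<sigma> (s - \<sigma> - \<sigma>))"
    using \<sigma> s by (simp only: ennreal_suminf_cmult, subst Gauss_summation) auto
  also have "\<dots> = ennreal (1 / Beta \<sigma> (s - \<sigma>) * Beta \<sigma> (s - \<sigma> - \<sigma>))"
    using Bp by (intro ennreal_mult'[symmetric]) auto
  also have "1 / Beta \<sigma> (s - \<sigma>) * Beta \<sigma> (s - \<sigma> - \<sigma>) = Gamma (s - 2 * \<sigma>) * Gamma s / (Gamma (s - \<sigma>))\<^sup>2"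
  proof -
    have "0 < Gamma \<sigma>" "0 < Gamma (s - \<sigma>)" "0 < Gamma s" using \<sigma> s by (auto intro!: Gamma_real_pos)
    moreover have "s - \<sigma> - \<sigma> = s - 2 * \<sigma>" "\<sigma> + (s - 2 * \<sigma>) = s - \<sigma>" "\<sigma> + (s - \<sigma>) = s" by auto
    ultimately show ?thesis by (simp add: Beta_def power2_eq_square)
  qed
  finally show ?thesis by (simp add: s_def)
qed

lemma pow_fun_power:
  assumes "cmod z < 1"
  shows "pow_fun \<delta> z ^ m = pow_fun (real m * \<delta>) z"
proof -
  have "1 - z \<noteq> 0" using assms by auto
  then show ?thesis
    by (simp add: pow_fun_def powr_def exp_of_nat_mult[symmetric] mult_ac)
qed

lemma nn_integral_pow_fun_power:
  assumes \<alpha>: "-1 < \<alpha>" and m: "0 < m" and \<delta>: "0 < \<delta>" "2 * real m * \<delta> < \<alpha> + 2"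
  shows "(\<integral>\<^sup>+z. ennreal (cmod (pow_fun \<delta> z) powr (2 * real m)) \<partial>disk_measure \<alpha>) =
    ennreal (Gamma (\<alpha> + 2 - 2 * (real m * \<delta>)) * Gamma (\<alpha> + 2) / (Gamma (\<alpha> + 2 - real m * \<delta>))\<^sup>2)"
proof -
  have "(\<integral>\<^sup>+z. ennreal (cmod (pow_fun \<delta> z) powr (2 * real m)) \<partial>disk_measure \<alpha>) =
      (\<integral>\<^sup>+z. ennreal ((cmod (pow_fun (real m * \<delta>) z))\<^sup>2) \<partial>disk_measure \<alpha>)"
    by (intro nn_integral_cong) (simp add: norm_powr_even[OF m] pow_fun_power)
  then show ?thesis using assms by (simp only:) (rule nn_integral_pow_fun, auto)
qed

lemma pow_fun_measurable:
  "(\<lambda>z. cmod (pow_fun \<delta> z) powr p) \<in> borel_measurable (disk_measure \<alpha>)"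
proof -
  have [measurable]: "pow_fun \<delta> \<in> borel_measurable (disk_measure \<alpha>)"
    by (intro continuous_on_imp_measurable_disk holomorphic_on_imp_continuous_on pow_fun_holomorphic)
  show ?thesis by measurable
qed

lemma pow_fun_in_bergman_space:
  assumes \<alpha>: "-1 < \<alpha>" and m: "0 < m" and \<delta>: "0 < \<delta>" "2 * real m * \<delta> < \<alpha> + 2"
  shows "pow_fun \<delta> \<in> bergman_space (2 * real m) \<alpha>"
  unfolding bergman_space_def
proof (intro CollectI conjI pow_fun_holomorphic)
  show "integrable (disk_measure \<alpha>) (\<lambda>z. cmod (pow_fun \<delta> z) powr (2 * real m))"
    using nn_integral_pow_fun_power[OF assms] by (intro integrableI_nonneg pow_fun_measurable) auto
qed

text \<open>As delta increases to the critical exponent, the argument of the first Gamma factor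
  tends to 0 from above and meets its pole, while the other factors stay positive and finite. The
  pole is isolated as 1 / \<open>u\<close> through the functional equation.\<close>

lemma pow_fun_norm_unbounded:
  assumes \<alpha>: "-1 < \<alpha>" and m: "0 < m"
  shows "filterlim (\<lambda>\<delta>. Gamma (\<alpha> + 2 - 2 * (real m * \<delta>)) * Gamma (\<alpha> + 2) / (Gamma (\<alpha>
      + 2 - real m * \<delta>))\<^sup>2) at_top
    (at_left ((\<alpha> + 2) / (2 * real m)))"
proof -
  define a where "a = (\<alpha> + 2) / (2 * real m)"
  define s where "s = \<alpha> + 2"
  have s: "0 < s" using \<alpha> by (simp add: s_def)
  have ma: "real m * a = s / 2" using m by (simp add: a_def s_def)
  define u where "u \<delta> = s - 2 * (real m * \<delta>)" for \<delta>
  have u_lim: "(u \<longlongrightarrow> 0) (at_left a)"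
  proof -
    have "(u \<longlongrightarrow> s - 2 * (real m * a)) (at_left a)"
      unfolding u_def by (intro tendsto_intros)
    then show ?thesis by (simp add: ma)
  qed
  have u_pos: "eventually (\<lambda>\<delta>. 0 < u \<delta>) (at_left a)"
  proof (rule eventually_at_leftI[of 0])
    show "0 < a" using \<alpha> m by (simp add: a_def)
    fix \<delta> assume "\<delta> \<in> {0<..<a}"
    then have "real m * \<delta> < real m * a" using m by simp
    then show "0 < u \<delta>" by (simp add: u_def ma)
  qed
  define L where "L \<delta> = Gamma (1 + u \<delta>) * Gamma s / (Gamma (s - real m * \<delta>))\<^sup>2" for \<delta>
  have L_lim: "(L \<longlongrightarrow> Gamma (1 + 0) * Gamma s / (Gamma (s - real m * a))\<^sup>2) (at_left a)"
    unfolding L_def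
  proof (intro tendsto_intros u_lim)
    have h: "s - real m * a = s / 2" by (simp add: ma)
    show "s - real m * a \<notin> \<int>\<^sub>\<le>\<^sub>0" unfolding h using s by (auto dest: nonpos_Ints_nonpos)
    show "(Gamma (s - real m * a))\<^sup>2 \<noteq> 0" unfolding h using Gamma_real_pos[of "s / 2"] s
        by (metis half_gt_zero less_irrefl zero_eq_power2)
  qed (auto dest: nonpos_Ints_nonpos)
  have L_pos: "0 < Gamma (1 + 0) * Gamma s / (Gamma (s - real m * a))\<^sup>2"
    using s Gamma_real_pos[of s] Gamma_real_pos[of "s / 2"] unfolding ma
    by (intro divide_pos_pos mult_pos_pos zero_less_power) auto
  have "filterlim (\<lambda>\<delta>. L \<delta> * inverse (u \<delta>)) at_top (at_left a)"
    by (rule filterlim_tendsto_pos_mult_at_top[OF L_lim L_pos filterlim_inverse_at_top[OF u_lim u_pos]])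
  moreover have "eventually (\<lambda>\<delta>. L \<delta> * inverse (u \<delta>) =
      Gamma (s - 2 * (real m * \<delta>)) * Gamma s / (Gamma (s - real m * \<delta>))\<^sup>2) (at_left a)"
    using u_pos
  proof eventually_elim
    case (elim \<delta>)
    have "Gamma (1 + u \<delta>) = u \<delta> * Gamma (u \<delta>)"
      using Gamma_add_nat[OF elim, of 1] by (simp add: add.commute)
    then show ?case using elim by (simp add: L_def) (simp add: u_def)
  qed
  ultimately show ?thesis unfolding a_def s_def by (rule filterlim_cong[THEN iffD1, OF refl refl, rotated])
qed

text \<open>At delta = a and z = 1 the integrand is the density b of the upper bound, which is why
  both bounds meet in the same Beta value.\<close>

definition hilbert_symbol :: "real \<Rightarrow> complex \<Rightarrow> complex" where
  "hilbert_symbol \<delta> z = (LINT t|lborel. indicator {0<..<1} t *\<^sub>R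
     (of_real ((1 - t) powr (- \<delta>)) * (1 - of_real (1 - t) * z) powr of_real (\<delta> - 1)))"

lemma comp_op_pow_fun:
  assumes z: "cmod z < 1" and t: "0 < t" "t < 1"
  shows "comp_op (pow_fun \<delta>) z t =
    pow_fun \<delta> z * (of_real ((1 - t) powr (- \<delta>)) * (1 - of_real (1 - t) * z) powr of_real (\<delta> - 1))"
proof -
  define q where "q = 1 - t"
  define w where "w = 1 - complex_of_real q * z"
  define v where "v = 1 - z"
  have q: "0 < q" "q < 1" using t by (auto simp: q_def)
  have w0: "w \<noteq> 0" using norm_denominator_ge(4)[OF z, of t] t by (simp add: w_def q_def)
  have v0: "v \<noteq> 0" using z by (auto simp: v_def)
  have "cmod (of_real q * z) < 1"
    using norm_denominator_ge(2)[OF z, of t] t by (simp add: norm_mult q_def del: of_real_diff)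
  then have Rw: "0 < Re w" unfolding w_def by (rule Re_one_minus_pos)
  have Rv: "0 < Re v" unfolding v_def using z by (rule Re_one_minus_pos)
  have phi: "1 - complex_of_real t / w = of_real q * v / w"
    using w0 by (simp add: field_simps) (simp add: w_def v_def q_def algebra_simps)
  \<comment> \<open>Both v and w lie in the right half plane, so their arguments differ by less than
    pi and the principal logarithms combine without a correction by 2 pi.\<close>
  have "Ln (of_real q * v / w) = of_real (ln q) + Ln v - Ln w"
  proof (rule Ln_unique)
    show "exp (of_real (ln q) + Ln v - Ln w) = of_real q * v / w"
      using q v0 w0 by (simp add: exp_add exp_diff exp_of_real)
    have "\<bar>Im (Ln v)\<bar> < pi / 2" "\<bar>Im (Ln w)\<bar> < pi / 2"
      using Rv Rw v0 w0 Re_Ln_pos_lt by auto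
    then show "- pi < Im (of_real (ln q) + Ln v - Ln w)" "Im (of_real (ln q) + Ln v - Ln w) \<le> pi"
      by (auto simp: abs_less_iff)
  qed
  then have "of_real q * v / w \<noteq> 0 \<Longrightarrow> (of_real q * v / w) powr (- of_real \<delta>) =
      exp (- of_real \<delta> * of_real (ln q) + - of_real \<delta> * Ln v + of_real \<delta> * Ln w)"
    by (simp only: powr_def if_False) (simp add: algebra_simps)
  then have "(of_real q * v / w) powr (- of_real \<delta>) =
      exp (- of_real \<delta> * of_real (ln q)) * exp (- of_real \<delta> * Ln v) * exp (of_real \<delta> * Ln w)"
    using q v0 w0 by (simp only: exp_add) simp
  then have "comp_op (pow_fun \<delta>) z t =
     exp (- of_real \<delta> * of_real (ln q)) * exp (- of_real \<delta> * Ln v) * (exp (of_real \<delta> * Ln w) / w)"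
    by (simp add: comp_op_def pow_fun_def w_def[symmetric] phi[symmetric] flip: q_def)
  also have "exp (of_real \<delta> * Ln w) / w = w powr of_real (\<delta> - 1)"
  proof -
    have "w powr of_real (\<delta> - 1) = exp (of_real \<delta> * Ln w - Ln w)" using w0
        by (simp add: powr_def algebra_simps)
    then show ?thesis using w0 by (simp add: exp_diff)
  qed
  also have "exp (- of_real \<delta> * of_real (ln q)) = complex_of_real (q powr (- \<delta>))"
    using q by (simp add: powr_def exp_of_real[symmetric])
  also have "exp (- of_real \<delta> * Ln v) = pow_fun \<delta> z"
    using v0 by (simp add: pow_fun_def v_def[symmetric] powr_def)
  finally show ?thesis by (simp add: w_def q_def mult_ac)
qed

text \<open>The test function factors out of each composition and hence out of the path
  integral.\<close>

lemma hilbert_op_pow_fun: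
  assumes m: "2 \<le> m" and \<alpha>: "-1 < \<alpha>" "\<alpha> < 2 * real m - 2"
    and \<delta>: "0 < \<delta>" "2 * real m * \<delta> < \<alpha> + 2" and z: "cmod z < 1"
  shows "hilbert_op (pow_fun \<delta>) z = pow_fun \<delta> z * hilbert_symbol \<delta> z"
proof -
  interpret bergman_function m \<alpha> "\<alpha> + 2" "(\<alpha> + 2) / (2 * real m)" "pow_fun \<delta>"
    by unfold_locales (use assms pow_fun_in_bergman_space[of \<alpha> m \<delta>] in auto)
  have "hilbert_op (pow_fun \<delta>) z = (LINT t|lborel. pow_fun \<delta> z * (indicator {0<..<1} t *\<^sub>R
     (of_real ((1 - t) powr (- \<delta>)) * (1 - of_real (1 - t) * z) powr of_real (\<delta> - 1))))"
    unfolding hilbert_op_path[OF z]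
    by (rule Bochner_Integration.integral_cong)
       (auto simp: indicator_def comp_op_pow_fun[OF z] simp del: of_real_diff)
  also have "\<dots> = pow_fun \<delta> z * hilbert_symbol \<delta> z"
    unfolding hilbert_symbol_def by (rule integral_mult_right_zero)
  finally show ?thesis .
qed

lemma hilbert_symbol_tendsto:
  fixes a :: real
  assumes a: "0 < a" "a < 1"
    and \<delta>: "d \<longlonglongrightarrow> a" "\<And>n. a / 2 \<le> d n" "\<And>n. d n \<le> a"
    and z: "z \<longlonglongrightarrow> 1" "\<And>n. cmod (z n) < 1"
  shows "(\<lambda>n. hilbert_symbol (d n) (z n)) \<longlonglongrightarrow> of_real (Beta a (1 - a))"
proof -
  define g where "g \<delta> z t = indicator {0<..<1} t *\<^sub>R
     (of_real ((1 - t) powr (- \<delta>)) * (1 - of_real (1 - t) * z) powr of_real (\<delta> - 1))"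
         for \<delta> t :: real and z :: complex
  define \<phi> where "\<phi> t = indicator {0<..<1} t * ((1 - t) powr (- a) * t powr (a - 1))" for t :: real
  \<comment> \<open>A majorant for all n at once: d n >= a / 2 controls the singularity at t = 0 and
    d n <= a the one at t = 1.\<close>
  define w where "w t = indicator {0<..<1} t * (t powr (a / 2 - 1)
      * (1 - t) powr (1 - a - 1))" for t :: real
  have mw: "w \<in> borel_measurable lborel" unfolding w_def by measurable
  have m\<phi>: "\<phi> \<in> borel_measurable lborel" unfolding \<phi>_def by measurable
  have "(\<integral>\<^sup>+t. ennreal (w t) \<partial>lborel) = ennreal (Beta (a / 2) (1 - a))"
  proof (rule trans[OF _ nn_integral_Beta[of "a / 2" "1 - a"]])
    show "(\<integral>\<^sup>+t. ennreal (w t) \<partial>lborel) = (\<integral>\<^sup>+t. indicator {0<..<1} t * ennreal (t powr (a / 2 - 1)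
        * (1 - t) powr (1 - a - 1)) \<partial>lborel)"
      by (rule nn_integral_cong) (auto simp: w_def indicator_def mult.commute)
  qed (use a in auto)
  then have iw: "integrable lborel w"
    using mw by (intro integrableI_nonneg) (auto simp: w_def)
  have n\<phi>: "(\<integral>\<^sup>+t. ennreal (\<phi> t) \<partial>lborel) = ennreal (Beta a (1 - a))"
  proof (rule trans[OF _ nn_integral_Beta[of a "1 - a"]])
    show "(\<integral>\<^sup>+t. ennreal (\<phi> t) \<partial>lborel) = (\<integral>\<^sup>+t. indicator {0<..<1} t * ennreal (t powr (a - 1)
        * (1 - t) powr (1 - a - 1)) \<partial>lborel)"
      by (rule nn_integral_cong) (auto simp: \<phi>_def indicator_def mult.commute)
  qed (use a in auto)
  have Bpos: "0 < Beta a (1 - a)" using a by (intro Beta_real_pos) auto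
  have "integral\<^sup>L lborel \<phi> = Beta a (1 - a)"
    using n\<phi> Bpos m\<phi> by (subst integral_eq_nn_integral) (auto simp: \<phi>_def)
  then have lim: "(LINT t|lborel. complex_of_real (\<phi> t)) = of_real (Beta a (1 - a))" by simp
  have mg: "g \<delta> z \<in> borel_measurable lborel" if z: "cmod z < 1" for \<delta> z
  proof -
    have "continuous_on {0<..<1} (\<lambda>t. complex_of_real ((1 - t) powr (- \<delta>))
        * (1 - of_real (1 - t) * z) powr of_real (\<delta> - 1))"
    proof (intro continuous_on_mult continuous_on_powr_complex continuous_intros)
      have *: "0 < Re (1 - of_real (1 - t) * z)" if t: "t \<in> {0<..<1}" for t :: real
        by (rule Re_one_minus_pos)
           (use norm_denominator_ge(2)[OF z, of t] t in \<open>simp add: norm_mult del: of_real_diff\<close>)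
      show "{0<..<1} \<subseteq> {t. 0 \<le> Re (1 - of_real (1 - t) * z) \<or> Im (1 - of_real (1 - t) * z) \<noteq> 0}"
        using * by (blast intro: less_imp_le)
      show "0 < Re (of_real (\<delta> - 1))" if "t \<in> {0<..<1}" "1 - of_real (1 - t) * z = 0" for t :: real
        using *[OF that(1)] unfolding that(2) by simp
    qed auto
    then show ?thesis unfolding g_def
      using borel_measurable_continuous_on_indicator[of "{0<..<1::real}"] by simp
  qed
  have "(\<lambda>n. LINT t|lborel. g (d n) (z n) t) \<longlonglongrightarrow> (LINT t|lborel. complex_of_real (\<phi> t))"
  proof (rule integral_dominated_convergence[where w = w])
    show "AE t in lborel. (\<lambda>n. g (d n) (z n) t) \<longlonglongrightarrow> complex_of_real (\<phi> t)"
    proof (rule AE_I2)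
      fix t :: real
      show "(\<lambda>n. g (d n) (z n) t) \<longlonglongrightarrow> complex_of_real (\<phi> t)"
      proof (cases "0 < t \<and> t < 1")
        case True
        have "(\<lambda>n. complex_of_real ((1 - t) powr (- d n))
            * (1 - of_real (1 - t) * z n) powr of_real (d n - 1))
            \<longlonglongrightarrow> of_real ((1 - t) powr (- a)) * (1 - of_real (1 - t) * 1) powr of_real (a - 1)"
          using True by (intro tendsto_intros \<delta> z) auto
        moreover have "(1 - complex_of_real (1 - t) * 1) powr of_real (a - 1) = of_real (t powr (a - 1))"
        proof -
          have "1 - complex_of_real (1 - t) * 1 = of_real t" by simp
          then show ?thesis using True by (simp only: powr_of_real[of t "a - 1"] less_imp_le)
        qed
        ultimately show ?thesis using True by (simp add: g_def \<phi>_def del: of_real_diff)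
      qed (auto simp: g_def \<phi>_def)
    qed
    show "AE t in lborel. norm (g (d n) (z n) t) \<le> w t" for n
    proof (rule AE_I2)
      fix t :: real
      show "norm (g (d n) (z n) t) \<le> w t"
      proof (cases "0 < t \<and> t < 1")
        case True
        define v where "v = 1 - complex_of_real (1 - t) * z n"
        have v: "t \<le> cmod v" "v \<noteq> 0"
          using norm_denominator_ge[OF z(2), of t n] True by (auto simp: v_def simp del: of_real_diff)
        have "cmod (v powr of_real (d n - 1)) = cmod v powr (d n - 1)" using v(2)
            by (rule norm_powr_of_real)
        also have "\<dots> \<le> t powr (d n - 1)" using v True \<delta>(3)[of n] a by (intro powr_mono2') auto
        also have "\<dots> \<le> t powr (a / 2 - 1)" using True \<delta>(2)[of n] by (intro powr_mono') auto
        finally have 1: "cmod (v powr of_real (d n - 1)) \<le> t powr (a / 2 - 1)" .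
        have 2: "(1 - t) powr (- d n) \<le> (1 - t) powr (- a)" using True \<delta>(3)[of n] by (intro powr_mono') auto
        have "norm (g (d n) (z n) t) = (1 - t) powr (- d n) * cmod (v powr of_real (d n - 1))"
          using True by (simp add: g_def norm_mult v_def del: of_real_diff)
        also have "\<dots> \<le> (1 - t) powr (- a) * t powr (a / 2 - 1)" using 1 2 by (intro mult_mono) auto
        finally show ?thesis using True by (simp add: w_def mult.commute)
      qed (auto simp: g_def w_def)
    qed
  qed (use iw mg z(2) m\<phi> in auto)
  then show ?thesis unfolding lim hilbert_symbol_def g_def .
qed

text \<open>A uniform lower bound near (a, 1), obtained by contradiction from sequential continuity:
  failing neighbourhoods shrinking to that point would give sequences with too small a
  limit.\<close>

lemma hilbert_symbol_ge:
  fixes a D :: real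
  assumes a: "0 < a" "a < 1" and D: "D < Beta a (1 - a)"
  obtains \<rho> where "0 < \<rho>" "\<rho> < a"
    "\<And>\<delta> z. \<lbrakk>a - \<rho> < \<delta>; \<delta> < a; cmod z < 1; cmod (z - 1) < \<rho>\<rbrakk> \<Longrightarrow> D \<le> cmod (hilbert_symbol \<delta> z)"
proof (rule ccontr)
  assume "\<not> thesis"
  note no = this[unfolded not_def]
  \<comment> \<open>Radii tending to 0 but never above a / 2, so that the sequence d meets the lower
    bound required by \<open>hilbert_symbol_tendsto\<close>.\<close>
  define r where "r n = a / (2 * (real n + 1))" for n
  have r: "0 < r n" "r n \<le> a / 2" for n using a by (auto simp: r_def field_simps)
  have "\<exists>\<delta> z. a - r n < \<delta> \<and> \<delta> < a \<and> cmod z < 1 \<and> cmod (z - 1) < r n \<and> cmod (hilbert_symbol \<delta> z) < D" for n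
  proof (rule ccontr)
    assume *: "\<not> ?thesis"
    have "r n < a" using r[of n] a by linarith
    with * r[of n] no show False by (meson not_less that)
  qed
  then obtain d z where dz: "\<And>n. a - r n < d n" "\<And>n. d n < a" "\<And>n. cmod (z n) < 1"
      "\<And>n. cmod (z n - 1) < r n" "\<And>n. cmod (hilbert_symbol (d n) (z n)) < D"
    by metis
  have r0: "r \<longlonglongrightarrow> 0" unfolding r_def by real_asymp
  have "d \<longlonglongrightarrow> a"
  proof (rule tendsto_sandwich)
    show "(\<lambda>n. a - r n) \<longlonglongrightarrow> a" using tendsto_diff[OF tendsto_const r0, of a] by simp
    show "eventually (\<lambda>n. a - r n \<le> d n) sequentially" "eventually (\<lambda>n. d n \<le> a) sequentially"
      using dz(1,2) by (auto intro!: always_eventually less_imp_le)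
  qed auto
  moreover have "z \<longlonglongrightarrow> 1"
  proof (rule Lim_null[THEN iffD2], rule tendsto_norm_zero_cancel, rule tendsto_sandwich[of "\<lambda>_. 0" _ _ r])
    show "eventually (\<lambda>n. cmod (z n - 1) \<le> r n) sequentially"
      using dz(4) by (auto intro!: always_eventually less_imp_le)
  qed (use r0 in auto)
  moreover have "a / 2 \<le> d n" "d n \<le> a" for n using dz(1,2)[of n] r[of n] by linarith+
  ultimately have "(\<lambda>n. hilbert_symbol (d n) (z n)) \<longlonglongrightarrow> of_real (Beta a (1 - a))"
    using hilbert_symbol_tendsto[OF a, of d z] dz(3) by blast
  then have "(\<lambda>n. cmod (hilbert_symbol (d n) (z n))) \<longlonglongrightarrow> cmod (of_real (Beta a (1 - a)))"
      by (rule tendsto_norm)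
  then have "cmod (of_real (Beta a (1 - a))) \<le> D"
    by (rule tendsto_upperbound) (auto intro!: always_eventually less_imp_le dz(5))
  then show False using D by simp
qed

section \<open>Both bounds for the operator norm\<close>

lemma bergman_norm_power:
  assumes "0 < p" "integrable (disk_measure \<alpha>) (\<lambda>z. cmod (f z) powr p)"
  shows "ennreal (bergman_norm p \<alpha> f powr p) = (\<integral>\<^sup>+z. ennreal (cmod (f z) powr p) \<partial>disk_measure \<alpha>)"
proof -
  have "0 \<le> (LINT z|disk_measure \<alpha>. cmod (f z) powr p)" by (intro integral_nonneg_AE) auto
  then have "bergman_norm p \<alpha> f powr p = (LINT z|disk_measure \<alpha>. cmod (f z) powr p)"
    using assms(1) by (simp add: bergman_norm_def powr_powr)
  then show ?thesis using nn_integral_eq_integral[OF assms(2)] by simp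
qed

lemma (in bergman_function) hilbert_op_bounded:
  assumes "m \<in> {2, 3, 4, 5}"
  shows "hilbert_op f \<in> bergman_space (2 * real m) \<alpha>"
    "bergman_norm (2 * real m) \<alpha> (hilbert_op f) \<le> B * bergman_norm (2 * real m) \<alpha> f"
proof -
  define p where "p = 2 * real m"
  have p: "0 < p" using m by (simp add: p_def)
  have pw: "x powr p = x ^ (2 * m)" if "0 \<le> x" for x :: real
    using powr_realpow'[OF that, of "2 * m"] m by (simp add: p_def)
  have [measurable]: "hilbert_op f \<in> borel_measurable (disk_measure \<alpha>)"
    by (intro continuous_on_imp_measurable_disk holomorphic_on_imp_continuous_on hilbert_op_holomorphic)
  have le: "(\<integral>\<^sup>+z. ennreal (cmod (hilbert_op f z) powr p) \<partial>disk_measure \<alpha>) \<le> ennreal (B ^ (2 * m) * N)"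
    using nn_integral_hilbert_op_le[OF assms] by (simp add: pw)
  have int: "integrable (disk_measure \<alpha>) (\<lambda>z. cmod (hilbert_op f z) powr p)"
  proof (rule integrableI_nonneg)
    show "(\<lambda>z. cmod (hilbert_op f z) powr p) \<in> borel_measurable (disk_measure \<alpha>)" by measurable
    show "(\<integral>\<^sup>+z. ennreal (cmod (hilbert_op f z) powr p) \<partial>disk_measure \<alpha>) < \<infinity>"
      using le by (rule order.strict_trans1) simp
  qed simp
  then show "hilbert_op f \<in> bergman_space (2 * real m) \<alpha>"
    using hilbert_op_holomorphic by (simp add: bergman_space_def p_def)
  have "ennreal (LINT z|disk_measure \<alpha>. cmod (hilbert_op f z) powr p) \<le> ennreal (B ^ (2 * m) * N)"
    using le nn_integral_eq_integral[OF int] by simp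
  then have "(LINT z|disk_measure \<alpha>. cmod (hilbert_op f z) powr p) \<le> B powr p * N"
    using B_pos N_nonneg by (simp add: pw ennreal_le_iff)
  then have "(LINT z|disk_measure \<alpha>. cmod (hilbert_op f z) powr p) powr (1 / p) \<le>
      (B powr p * N) powr (1 / p)"
    using p by (intro powr_mono2 integral_nonneg_AE) auto
  also have "\<dots> = B * N powr (1 / p)"
    using B_pos N_nonneg p by (simp add: powr_mult powr_powr)
  finally show "bergman_norm (2 * real m) \<alpha> (hilbert_op f) \<le> B * bergman_norm (2 * real m) \<alpha> f"
    by (simp add: bergman_norm_def N_def p_def)
qed

text \<open>If C < D < Beta a (1 - a), the symbol is at least D near 1, and the test functions are
  bounded elsewhere. Hence D^p N(delta) <= C^p N(delta) + D^p K with K independent of delta, which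
  fails once N(delta) is large.\<close>

lemma hilbert_op_norm_ge:
  assumes m: "2 \<le> m" and \<alpha>: "-1 < \<alpha>" "\<alpha> < 2 * real m - 2"
    and C: "0 \<le> C" "\<And>f. f \<in> bergman_space (2 * real m) \<alpha> \<Longrightarrow> hilbert_op f \<in> bergman_space (2 * real m) \<alpha> \<and>
      bergman_norm (2 * real m) \<alpha> (hilbert_op f) \<le> C * bergman_norm (2 * real m) \<alpha> f"
  shows "Beta ((\<alpha> + 2) / (2 * real m)) (1 - (\<alpha> + 2) / (2 * real m)) \<le> C"
proof (rule ccontr)
  define p where "p = 2 * real m"
  define a where "a = (\<alpha> + 2) / p"
  assume "\<not> ?thesis"
  then have "C < Beta a (1 - a)" by (simp add: a_def p_def)
  then obtain D where D: "C < D" "D < Beta a (1 - a)" using dense by blast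
  have p: "0 < p" using m by (simp add: p_def)
  have a: "0 < a" "a < 1" using m \<alpha> by (auto simp: a_def p_def)
  obtain \<rho> where \<rho>: "0 < \<rho>" "\<rho> < a"
    and ge: "\<And>\<delta> z. \<lbrakk>a - \<rho> < \<delta>; \<delta> < a; cmod z < 1; cmod (z - 1) < \<rho>\<rbrakk> \<Longrightarrow> D \<le> cmod (hilbert_symbol \<delta> z)"
    using hilbert_symbol_ge[OF a D(2)] by metis
  define N where "N \<delta> = Gamma (\<alpha> + 2 - 2 * (real m * \<delta>)) * Gamma (\<alpha> + 2) / (Gamma (\<alpha>
      + 2 - real m * \<delta>))\<^sup>2" for \<delta>
  \<comment> \<open>Bounds |1 - z|^(-delta p) at distance at least rho from 1, uniformly in delta <
    a, because rho < 1.\<close>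
  define K where "K = \<rho> powr (- a * p)"
  have CD: "C powr p < D powr p" using C D p by (intro powr_less_mono2) auto
  have bound: "(D powr p - C powr p) * N \<delta> \<le> D powr p * K" if \<delta>: "a - \<rho> < \<delta>" "\<delta> < a" for \<delta>
  proof -
    have \<delta>0: "0 < \<delta>" using \<delta> \<rho> by linarith
    have "p * \<delta> < p * a" using \<delta> p by simp
    then have \<delta>1: "2 * real m * \<delta> < \<alpha> + 2" using p by (simp add: a_def p_def)
    have mem: "pow_fun \<delta> \<in> bergman_space p \<alpha>"
      unfolding p_def using m by (intro pow_fun_in_bergman_space \<alpha> \<delta>0 \<delta>1) auto
    then have int: "integrable (disk_measure \<alpha>) (\<lambda>z. cmod (pow_fun \<delta> z) powr p)"
        "integrable (disk_measure \<alpha>) (\<lambda>z. cmod (hilbert_op (pow_fun \<delta>) z) powr p)"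
      using C(2)[of "pow_fun \<delta>"] by (auto simp: bergman_space_def p_def)
    have N: "(\<integral>\<^sup>+z. ennreal (cmod (pow_fun \<delta> z) powr p) \<partial>disk_measure \<alpha>) = ennreal (N \<delta>)"
      unfolding p_def N_def using m by (intro nn_integral_pow_fun_power \<alpha> \<delta>0 \<delta>1) auto
    have "real m * \<delta> < \<alpha> + 2" using \<delta>1 \<delta>0 m mult_pos_pos[of "real m" \<delta>] by linarith
    then have N0: "0 \<le> N \<delta>" unfolding N_def using \<delta>1 \<alpha>
      by (intro divide_nonneg_nonneg mult_nonneg_nonneg less_imp_le[OF Gamma_real_pos]) auto
    have pt: "D powr p * cmod (pow_fun \<delta> z) powr p \<le> cmod (hilbert_op (pow_fun \<delta>) z) powr p + D powr p * K"
      if z: "cmod z < 1" for z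
    proof (cases "cmod (z - 1) < \<rho>")
      case True
      have "D powr p * cmod (pow_fun \<delta> z) powr p = (D * cmod (pow_fun \<delta> z)) powr p"
        using C D by (simp add: powr_mult)
      also have "\<dots> \<le> (cmod (hilbert_symbol \<delta> z) * cmod (pow_fun \<delta> z)) powr p"
        using ge[OF \<delta> z True] C D p by (intro powr_mono2 mult_right_mono) auto
      also have "\<dots> = cmod (hilbert_op (pow_fun \<delta>) z) powr p"
        using hilbert_op_pow_fun[OF m \<alpha> \<delta>0 \<delta>1 z] by (simp add: norm_mult mult.commute)
      finally have "D powr p * cmod (pow_fun \<delta> z) powr p \<le> cmod (hilbert_op (pow_fun \<delta>) z) powr p" .
      moreover have "0 \<le> D powr p * K" by (simp add: K_def)
      ultimately show ?thesis by linarith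
    next
      case False
      have "cmod (pow_fun \<delta> z) powr p = cmod (1 - z) powr (- (\<delta> * p))"
        using z by (simp add: norm_pow_fun powr_powr)
      also have "\<dots> \<le> \<rho> powr (- (\<delta> * p))"
        using False \<rho> \<delta>0 p by (intro powr_mono2') (auto simp: norm_minus_commute)
      also have "\<dots> \<le> K" unfolding K_def using \<rho> a \<delta> p by (intro powr_mono') auto
      finally have "D powr p * cmod (pow_fun \<delta> z) powr p \<le> D powr p * K" by (intro mult_left_mono) auto
      moreover have "0 \<le> cmod (hilbert_op (pow_fun \<delta>) z) powr p" by simp
      ultimately show ?thesis by linarith
    qed
    have "ennreal (D powr p * N \<delta>) = (\<integral>\<^sup>+z. ennreal (D powr p) * ennreal (cmod (pow_fun \<delta> z) powr p)
        \<partial>disk_measure \<alpha>)"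
      using int(1) by (subst nn_integral_cmult) (auto simp: N ennreal_mult')
    also have "\<dots> \<le> (\<integral>\<^sup>+z. ennreal (cmod (hilbert_op (pow_fun \<delta>) z) powr p)
        + ennreal (D powr p * K) \<partial>disk_measure \<alpha>)"
    proof (rule nn_integral_mono)
      fix z assume "z \<in> space (disk_measure \<alpha>)"
      then have "cmod z < 1" by simp
      from ennreal_leI[OF pt[OF this]]
      show "ennreal (D powr p) * ennreal (cmod (pow_fun \<delta> z) powr p) \<le>
          ennreal (cmod (hilbert_op (pow_fun \<delta>) z) powr p) + ennreal (D powr p * K)"
        by (simp add: ennreal_mult' ennreal_plus K_def)
    qed
    also have "\<dots> = (\<integral>\<^sup>+z. ennreal (cmod (hilbert_op (pow_fun \<delta>) z) powr p) \<partial>disk_measure \<alpha>)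
        + ennreal (D powr p * K)"
      using int(2) emeasure_disk_measure[OF \<alpha>(1)] by (subst nn_integral_add) auto
    also have "(\<integral>\<^sup>+z. ennreal (cmod (hilbert_op (pow_fun \<delta>) z) powr p) \<partial>disk_measure \<alpha>) =
        ennreal (bergman_norm p \<alpha> (hilbert_op (pow_fun \<delta>)) powr p)"
      by (rule bergman_norm_power[OF p int(2), symmetric])
    also have "\<dots> \<le> ennreal ((C * bergman_norm p \<alpha> (pow_fun \<delta>)) powr p)"
      using C(2)[of "pow_fun \<delta>"] mem p
      by (intro ennreal_leI powr_mono2) (auto simp: p_def bergman_norm_def)
    also have "\<dots> = ennreal (C powr p) * ennreal (bergman_norm p \<alpha> (pow_fun \<delta>) powr p)"
      using C(1) by (simp add: powr_mult ennreal_mult' bergman_norm_def)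
    also have "\<dots> = ennreal (C powr p * N \<delta>)"
      by (simp only: bergman_norm_power[OF p int(1)] N) (simp add: ennreal_mult')
    finally have "ennreal (D powr p * N \<delta>) \<le> ennreal (C powr p * N \<delta>) + ennreal (D powr p * K)" by simp
    then have "D powr p * N \<delta> \<le> C powr p * N \<delta> + D powr p * K"
      using N0 by (simp add: K_def ennreal_le_iff flip: ennreal_plus)
    then show ?thesis by (simp add: algebra_simps)
  qed
  have "filterlim N at_top (at_left a)"
    using pow_fun_norm_unbounded[of \<alpha> m] m \<alpha> unfolding N_def a_def p_def by simp
  then have "eventually (\<lambda>\<delta>. D powr p * K / (D powr p - C powr p) < N \<delta>) (at_left a)"
    by (simp add: filterlim_at_top_dense)
  moreover have "eventually (\<lambda>\<delta>. \<delta> \<in> {a - \<rho><..<a}) (at_left a)"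
    using \<rho> by (intro eventually_at_left_real) auto
  ultimately have "eventually (\<lambda>\<delta>. False) (at_left a)"
  proof eventually_elim
    case (elim \<delta>)
    with bound[of \<delta>] CD show ?case by (simp add: divide_less_eq mult.commute)
  qed
  then show False by simp
qed

theorem theorem1p4:
  fixes m :: nat and \<alpha> :: real
  assumes "m \<in> {2, 3, 4, 5}"
    and "-1 < \<alpha>" and "\<alpha> < 2 * real m - 2"
  shows "bergman_opnorm (2 * real m) \<alpha> hilbert_op =
           ereal (Beta ((\<alpha> + 2) / (2 * real m)) (1 - (\<alpha> + 2) / (2 * real m))) \<and>
         Beta ((\<alpha> + 2) / (2 * real m)) (1 - (\<alpha> + 2) / (2 * real m)) =
           pi / sin ((\<alpha> + 2) * pi / (2 * real m))"
proof
  have m: "2 \<le> m" using assms(1) by auto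
  define e where "e = (\<alpha> + 2) / (2 * real m)"
  have e: "0 < e" "e < 1" using m assms by (auto simp: e_def)
  have "0 \<le> Beta e (1 - e)" using e by (intro less_imp_le[OF Beta_real_pos]) auto
  moreover have "hilbert_op f \<in> bergman_space (2 * real m) \<alpha> \<and>
      bergman_norm (2 * real m) \<alpha> (hilbert_op f) \<le> Beta e (1 - e) * bergman_norm (2 * real m) \<alpha> f"
    if "f \<in> bergman_space (2 * real m) \<alpha>" for f
  proof -
    interpret bergman_function m \<alpha> "\<alpha> + 2" "(\<alpha> + 2) / (2 * real m)" f
      by unfold_locales (use assms m that in auto)
    show ?thesis using hilbert_op_bounded[OF assms(1)] by (auto simp: B_def e_def)
  qed
  \<comment> \<open>The Beta value is itself an admissible constant and lies below every other one,
    so the infimum is attained.\<close>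
  ultimately show "bergman_opnorm (2 * real m) \<alpha> hilbert_op =
      ereal (Beta ((\<alpha> + 2) / (2 * real m)) (1 - (\<alpha> + 2) / (2 * real m)))"
    unfolding bergman_opnorm_def e_def
    by (intro antisym INF_lower INF_greatest) (auto intro: hilbert_op_norm_ge[OF m assms(2,3)])
  show "Beta ((\<alpha> + 2) / (2 * real m)) (1 - (\<alpha> + 2) / (2 * real m)) =
      pi / sin ((\<alpha> + 2) * pi / (2 * real m))"
    using Gamma_reflection_real_pi[of e] by (simp add: Beta_def e_def mult.commute)
qed

end
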